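(* Let $n\ge1$, let $F(x,y_0,y_1,\dots,y_n)$ be a function holomorphic near $0\in\mathbb{C}^{n+2}$, and let the generalized power series $\varphi=\sum_{k=1}^{\infty}c_kx^{\lambda_k}$ (with $\mathrm{Re}\,\lambda_1>0$) formally satisfy the $q$-difference equation $F(x,y,\sigma y,\dots,\sigma^n y)=0$. Suppose that $$F'_{y_j}(x,\varphi,\sigma\varphi,\ldots,\sigma^n\varphi)=A_jx^{\nu}+o(x^\nu)\in\mathcal{G},\qquad j=0,1,\dots,n,$$ where $A_j\in\mathbb{C}$, the number $\nu\in\mathbb{C}$ is the same for all $j=0,1,\ldots,n$, and at least one of the $A_j$'s is nonzero. Let $\Gamma$ be the finitely generated additive semigroup, with generators $\rho_1,\dots,\rho_\tau$ linearly independent over $\mathbb{Z}$ and having positive real parts, such that $\varphi\in\mathbb{C}[[x^\Gamma]]$ (see the context). Put $L(z)=A_nz^n+\ldots+A_1z+A_0$. For a nonzero $a\in\mathbb{C}$ consider the diophantine condition $$(\ast)\qquad |(m_1\rho_1+\ldots+m_\tau\rho_\tau)\ln q-\ln a-2\pi m\,\mathrm{i}|>c\,|m_1+\ldots+m_\tau|^{-\gamma}\qquad\text{for all } m_1,\dots,m_\tau\in\mathbb{Z}_+,\ m\in\mathbb{Z},$$ with the exception of $m_1=\ldots=m_\tau=0$, where $c$ and $\gamma$ are some positive constants. Then in each of the following cases the series $\varphi$ uniformly converges in each sector $S$ of sufficiently small radius with the vertex at the origin and of opening less than $2\pi$, defining there a holomorphic function: a) $A_0\ne0$, and all the $q^{\rho_i}$'s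 are located strictly inside the unit circle $\{|z|=1\}$; b) $A_n\ne0$, and all the $q^{\rho_i}$'s are located strictly outside the unit circle; c) all the $q^{\rho_i}$'s are located on the unit circle, and condition $(\ast)$ is fulfilled for those roots $z=a$ of the polynomial $(z-1)L(z)$ that are located on the unit circle; d) $A_0\ne0$, all the $q^{\rho_i}$'s are located inside or on the unit circle, and condition $(\ast)$ is fulfilled for those roots $z=a$ of the polynomial $(z-1)L(z)$ that are located inside or on the unit circle; e) $A_n\ne0$, all the $q^{\rho_i}$'s are located outside or on the unit circle, and condition $(\ast)$ is fulfilled for those roots $z=a$ of the polynomial $(z-1)L(z)$ that are located outside or on the unit circle.
   Context: A generalized power series is a formal series $\varphi=\sum_{k=1}^{\infty}c_kx^{\lambda_k}$ with $c_k\in\mathbb{C}$ and pairwise distinct $\lambda_k\in\mathbb{C}$ such that $0<\mathrm{Re}\,\lambda_1\le\mathrm{Re}\,\lambda_2\le\dots$ and $\mathrm{Re}\,\lambda_k\to+\infty$ (coefficients may vanish, so finite sums are included). $\mathcal{G}$ denotes the ring of all such series, with a constant term also allowed. $F'_{y_j}$ is the partial derivative $\partial F/\partial y_j$. $o(x^\nu)\in\mathcal{G}$ denotes a generalized power series starting with a power exponent whose real part is strictly greater than $\mathrm{Re}\,\nu$. Here $q\in\mathbb{C}$, $q\ne0,1$, with a fixed value of $\ln q$; the operator $\sigma:y(x)\mapsto y(qx)$ acts on $\mathcal{G}$ termwise, $\sigma x^\lambda=q^\lambda x^\lambda$, $q^\lambda=e^{\lambda\ln q}$. Substituting series of positive-real-part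 exponents into the Taylor series of a function holomorphic near $0$ gives an element of $\mathcal{G}$; $\varphi$ formally satisfies the equation if $F(x,\varphi,\sigma\varphi,\dots,\sigma^n\varphi)=0$ in $\mathcal{G}$. For a finitely generated additive semigroup $\Gamma\subset\mathbb{C}$ with generators $\rho_1,\dots,\rho_\tau$, $\mathbb{C}[[x^\Gamma]]\subset\mathcal{G}$ is the ring of generalized power series whose power exponents lie in $\Gamma$, i.e. are of the form $m_1\rho_1+\dots+m_\tau\rho_\tau$, $m_i\in\mathbb{Z}_+=\{0,1,2,\dots\}$. Under the condition on $F'_{y_j}$ in the claim, a semigroup $\Gamma$ with generators linearly independent over $\mathbb{Z}$ and having positive real parts and with $\varphi\in\mathbb{C}[[x^\Gamma]]$ exists (a theorem of the paper); $\rho_1,\dots,\rho_\tau$ denote the generators of this semigroup. The value of $\ln a$ is any fixed one. In a sector with vertex at the origin, $x^{\lambda}$ means $e^{\lambda\ln x}$ for a branch of the logarithm on the sector. *)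

theory Defs
  imports "HOL-Complex_Analysis.Complex_Analysis"
begin

section \<open>Holomorphic functions of several variables and their Taylor coefficients\<close>

text \<open>Complex differentiability on a neighbourhood of the origin: the real Frechet derivative
  is required to be complex-linear.\<close>

definition holomorphic_near_0 :: "(complex ^ 'v::finite \<Rightarrow> complex) \<Rightarrow> bool" where
  "holomorphic_near_0 F \<longleftrightarrow>
     (\<exists>U. open U \<and> 0 \<in> U \<and>
        (\<forall>z\<in>U. \<exists>D. (F has_derivative D) (at z) \<and> (\<forall>a v. D (a *s v) = a * D v)))"

definition cpartial ::
    "'v::finite \<Rightarrow> (complex ^ 'v \<Rightarrow> complex) \<Rightarrow> complex ^ 'v \<Rightarrow> complex" where
  "cpartial i F z = deriv (\<lambda>t. F (\<chi> k. if k = i then t else z $ k)) (z $ i)"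

text \<open>Throughout, \<^term>\<open>coord :: nat \<Rightarrow> 'v\<close> is a bijection from \<^term>\<open>{..<N}\<close> onto the index
  type; it fixes the order of the \<^term>\<open>N\<close> variables. The order in which the partial
  derivatives are iterated is immaterial for holomorphic functions.\<close>

definition taylor_coeff ::
    "nat \<Rightarrow> (nat \<Rightarrow> 'v::finite) \<Rightarrow> (complex ^ 'v \<Rightarrow> complex) \<Rightarrow> ('v \<Rightarrow> nat) \<Rightarrow> complex" where
  "taylor_coeff N coord F \<alpha> =
     foldr (\<lambda>k. cpartial (coord k) ^^ \<alpha> (coord k)) [0..<N] F 0 / (\<Prod>i\<in>UNIV. fact (\<alpha> i))"


section \<open>Generalized power series\<close>

text \<open>A series is represented by its coefficient function: \<^term>\<open>a l\<close> is the coefficient of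
  \<open>x\<^sup>l\<close>. In \<open>gps_ring\<close> the support has only finitely many points in each half-plane
  \<open>Re l \<le> r\<close>, which is the same as being enumerable by a sequence of exponents whose real
  parts are nondecreasing and tend to infinity (after padding with vanishing coefficients).\<close>

type_synonym gps = "complex \<Rightarrow> complex"

definition gps_ring :: "gps set" where
  "gps_ring = {a. (\<forall>r. finite {l. a l \<noteq> 0 \<and> Re l \<le> r}) \<and>
                  (\<forall>l. a l \<noteq> 0 \<longrightarrow> l = 0 \<or> Re l > 0)}"

definition gps_monom :: "complex \<Rightarrow> complex \<Rightarrow> gps" where
  "gps_monom A \<nu> = (\<lambda>l. if l = \<nu> then A else 0)"

definition gps_mult :: "gps \<Rightarrow> gps \<Rightarrow> gps" where
  "gps_mult a b = (\<lambda>l. \<Sum>s | a s \<noteq> 0 \<and> b (l - s) \<noteq> 0. a s * b (l - s))"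

definition gps_power :: "gps \<Rightarrow> nat \<Rightarrow> gps" where
  "gps_power a k = (gps_mult a ^^ k) (gps_monom 1 0)"

text \<open>The operator \<open>\<sigma>\<close>; \<^term>\<open>lq\<close> is the fixed value of \<open>ln q\<close>.\<close>

definition gps_sigma :: "complex \<Rightarrow> gps \<Rightarrow> gps" where
  "gps_sigma lq a = (\<lambda>l. exp (l * lq) * a l)"

text \<open>Substitution of the series \<open>s 0, \<dots>, s (N - 1)\<close> into the Taylor series of \<^term>\<open>F\<close>,
  in the order given by \<^term>\<open>coord\<close>. If all exponents of all \<open>s k\<close> have positive real part,
  then only finitely many multi-indices contribute to each coefficient.\<close>

definition gps_subst ::
    "nat \<Rightarrow> (nat \<Rightarrow> 'v::finite) \<Rightarrow> (complex ^ 'v \<Rightarrow> complex) \<Rightarrow> (nat \<Rightarrow> gps) \<Rightarrow> gps" where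
  "gps_subst N coord F s =
     (let P = (\<lambda>\<alpha>. foldr (\<lambda>k. gps_mult (gps_power (s k) (\<alpha> (coord k)))) [0..<N] (gps_monom 1 0))
      in (\<lambda>l. \<Sum>\<alpha> | taylor_coeff N coord F \<alpha> * P \<alpha> l \<noteq> 0. taylor_coeff N coord F \<alpha> * P \<alpha> l))"

text \<open>\<open>F(x, \<phi>, \<sigma>\<phi>, \<dots>, \<sigma>\<^sup>n\<phi>)\<close>: the variable number \<open>0\<close> is \<open>x\<close>, the variable number
  \<open>j + 1\<close> is \<open>y\<^sub>j\<close>.\<close>

definition q_subst ::
    "nat \<Rightarrow> (nat \<Rightarrow> 'v::finite) \<Rightarrow> complex \<Rightarrow> (complex ^ 'v \<Rightarrow> complex) \<Rightarrow> gps \<Rightarrow> gps" where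
  "q_subst n coord lq F \<phi> =
     gps_subst (n + 2) coord F
       (\<lambda>k. case k of 0 \<Rightarrow> gps_monom 1 1 | Suc j \<Rightarrow> (gps_sigma lq ^^ j) \<phi>)"

definition gps_little_o :: "complex \<Rightarrow> gps set" where
  "gps_little_o \<nu> = {h \<in> gps_ring. \<forall>l. h l \<noteq> 0 \<longrightarrow> Re l > Re \<nu>}"

text \<open>Series given as \<open>\<Sum>k. c k x\<^bsup>lam k\<^esup>\<close>, indexed from \<open>0\<close>; coefficients may vanish.\<close>

definition gps_exponents :: "(nat \<Rightarrow> complex) \<Rightarrow> bool" where
  "gps_exponents lam \<longleftrightarrow> inj lam \<and> 0 < Re (lam 0) \<and> mono (\<lambda>k. Re (lam k)) \<and>
     filterlim (\<lambda>k. Re (lam k)) at_top sequentially"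

text \<open>For injective \<^term>\<open>lam\<close> the sum has at most one summand.\<close>

definition gps_of :: "(nat \<Rightarrow> complex) \<Rightarrow> (nat \<Rightarrow> complex) \<Rightarrow> gps" where
  "gps_of c lam = (\<lambda>l. \<Sum>k | lam k = l. c k)"


section \<open>Semigroups of exponents and the diophantine condition\<close>

definition add_semigroup :: "nat \<Rightarrow> (nat \<Rightarrow> complex) \<Rightarrow> complex set" where
  "add_semigroup \<tau> \<rho> = {(\<Sum>i<\<tau>. of_nat (m i) * \<rho> i) |m :: nat \<Rightarrow> nat. True}"

definition gps_over :: "complex set \<Rightarrow> gps set" where
  "gps_over \<Gamma> = {a \<in> gps_ring. \<forall>l. a l \<noteq> 0 \<longrightarrow> l \<in> \<Gamma>}"

definition Z_independent :: "nat \<Rightarrow> (nat \<Rightarrow> complex) \<Rightarrow> bool" where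
  "Z_independent \<tau> \<rho> \<longleftrightarrow>
     (\<forall>m :: nat \<Rightarrow> int. (\<Sum>i<\<tau>. of_int (m i) * \<rho> i) = 0 \<longrightarrow> (\<forall>i<\<tau>. m i = 0))"

text \<open>The principal value \<^term>\<open>Ln a\<close> serves as the fixed value of the logarithm; since
  \<open>k\<close> ranges over all integers, any other value gives the same condition.\<close>

definition diophantine :: "nat \<Rightarrow> (nat \<Rightarrow> complex) \<Rightarrow> complex \<Rightarrow> complex \<Rightarrow> bool" where
  "diophantine \<tau> \<rho> lq a \<longleftrightarrow>
     (\<exists>c>0. \<exists>\<gamma>>0. \<forall>(m :: nat \<Rightarrow> nat) (k :: int). (\<exists>i<\<tau>. m i \<noteq> 0) \<longrightarrow>
        cmod ((\<Sum>i<\<tau>. of_nat (m i) * \<rho> i) * lq - Ln a - 2 * of_real pi * of_int k * \<i>)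
          > c * real (\<Sum>i<\<tau>. m i) powr (- \<gamma>))"


section \<open>Convergence in sectors\<close>

definition sector :: "real \<Rightarrow> real \<Rightarrow> complex set" where
  "sector \<alpha> \<beta> = {rcis r \<theta> |r \<theta>. 0 < r \<and> \<alpha> < \<theta> \<and> \<theta> < \<beta>}"

text \<open>The admissible radius may depend on the sector and on the branch \<^term>\<open>lg\<close> of the
  logarithm: since \<open>\<bar>x\<^sup>l\<bar> = exp (Re l * ln \<bar>x\<bar> - Im l * arg x)\<close>, no radius can work for all
  branches simultaneously.\<close>

definition converges_in_sectors :: "(nat \<Rightarrow> complex) \<Rightarrow> (nat \<Rightarrow> complex) \<Rightarrow> bool" where
  "converges_in_sectors c lam \<longleftrightarrow>
     (\<forall>\<alpha> \<beta> lg. \<alpha> < \<beta> \<and> \<beta> - \<alpha> < 2 * pi \<and>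
        continuous_on (sector \<alpha> \<beta>) lg \<and> (\<forall>x\<in>sector \<alpha> \<beta>. exp (lg x) = x) \<longrightarrow>
        (\<exists>R>0. \<forall>r. 0 < r \<and> r \<le> R \<longrightarrow>
           (\<exists>f. uniform_limit (sector \<alpha> \<beta> \<inter> ball 0 r)
                  (\<lambda>K x. \<Sum>k<K. c k * exp (lam k * lg x)) f sequentially \<and>
                f holomorphic_on (sector \<alpha> \<beta> \<inter> ball 0 r))))"

end

theory Submission
  imports Defs "HOL-Library.Poly_Mapping"
    "HOL-Computational_Algebra.Fundamental_Theorem_Algebra"
begin

text \<open>
  Split \<open>\<phi> = \<phi>\<^sub>N + x\<^bsup>m\<^esup> u\<close> with a finite sum \<open>\<phi>\<^sub>N\<close> and \<open>m > Re \<nu>\<close>. Dividing the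
  equation by \<open>x\<^bsup>m + \<nu>\<^esup>\<close> gives \<open>L(q\<^sup>m \<sigma>) u = g + \<Sum>\<^sub>j h\<^sub>j \<sigma>\<^sup>j u + Q(u)\<close>, where \<open>g\<close> and \<open>h\<^sub>j\<close>
  converge and have positive order, and \<open>Q\<close> is at least quadratic with a coefficient of positive
  order. In a weighted \<open>\<ell>\<^sup>1\<close> norm with weights \<open>\<epsilon>\<^bsup>Re \<lambda>\<^esup> / \<Omega>(Re \<lambda>)\<close>, \<open>\<Omega>\<close> supermultiplicative, the
  truncations of \<open>u\<close> stay bounded by induction, provided that the divisor \<open>L(q\<^sup>\<lambda>)\<close> is compensated
  by the growth of \<open>\<Omega>\<close> at \<open>\<lambda>\<close>. Everything is done with finite sums, i.e. in the ring of
  polynomials with complex exponents.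

  If no divisor is small, \<open>\<Omega> = 1\<close>. In general the diophantine condition excludes \<open>L(q\<^sup>\<lambda>) = 0\<close>
  for \<open>\<lambda> \<noteq> 0\<close> in the semigroup. If some exponent of \<open>\<phi>\<close> were irrational, a derivation
  \<open>x\<^sup>\<lambda> \<mapsto> \<psi>(\<lambda>) x\<^sup>\<lambda>\<close> with \<open>\<psi>\<close> additive and \<open>\<psi>(1) = 0\<close> would turn \<open>\<phi>\<close> into a nonzero solution of
  the linearized equation, whose leading exponent satisfies \<open>L(q\<^sup>\<lambda>) = 0\<close>. So all exponents are
  rational and, by linear independence of the generators, multiples of one real number. This leaves
  a one-dimensional small divisor problem, in which \<open>\<Omega>\<close> counts, for each dyadic size, the small
  divisors that can occur along a branch of the recursion (Siegel, Bruno).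
\<close>

section \<open>Functions holomorphic in each variable\<close>

text \<open>The diophantine condition bounds |q^\<lambda> - a| only for nonnegative combinations of
  the generators, whereas Siegel's argument compares two small divisors, i.e. involves q^(\<lambda>
  - \<lambda>') for a difference whose coordinates may have both signs. On a single ray this
  obstacle disappears: the difference of two exponents, taken in the right order, lies in the
  semigroup after multiplication by a fixed positive integer, and the condition for the root a = 1
  applies to it. This is why the exponents are shown to be rational before Siegel's argument is
  used, and where the factor z - 1 in (z - 1) L(z) enters. The derivation must kill 1 because F
  depends on x explicitly: x has to be a constant for it. Additive maps with \<psi>(1) = 0 can be
  nonzero at any prescribed exponent outside the rationals. The choice m > Re \<nu> puts the terms
  quadratic in the remainder, of order at least 2m, above the linear ones, of order at least m + Re
  \<nu>.\<close>

definition polydisc :: "real \<Rightarrow> (complex ^ 'v::finite) set" where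
  "polydisc R = {z. \<forall>i. cmod (z $ i) < R}"

definition vupd :: "complex ^ 'v::finite \<Rightarrow> 'v \<Rightarrow> complex \<Rightarrow> complex ^ 'v" where
  "vupd z i t = (\<chi> k. if k = i then t else z $ k)"

text \<open>Joint continuity together with holomorphy in each variable is what Cauchy's formula in
  one slice needs, and this class is again closed under \<open>cpartial\<close>, so that derivatives
  can be iterated.\<close>

definition sep_holomorphic :: "real \<Rightarrow> (complex ^ 'v::finite \<Rightarrow> complex) \<Rightarrow> bool" where
  "sep_holomorphic R F \<longleftrightarrow> continuous_on (polydisc R) F \<and>
     (\<forall>z\<in>polydisc R. \<forall>i. (\<lambda>t. F (vupd z i t)) holomorphic_on ball 0 R)"

lemma cpartial_vupd: "cpartial i F z = deriv (\<lambda>t. F (vupd z i t)) (z $ i)"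
  by (simp add: cpartial_def vupd_def)

lemma vupd_nth [simp]: "vupd z i t $ k = (if k = i then t else z $ k)"
  by (simp add: vupd_def)

lemma vupd_idem [simp]: "vupd (vupd z i s) i t = vupd z i t" "vupd z i (z $ i) = z"
  by (auto simp: vec_eq_iff)

lemma vupd_commute: "i \<noteq> k \<Longrightarrow> vupd (vupd z i s) k t = vupd (vupd z k t) i s"
  by (auto simp: vec_eq_iff)

lemma vupd_in_polydisc: "z \<in> polydisc R \<Longrightarrow> cmod t < R \<Longrightarrow> vupd z i t \<in> polydisc R"
  by (auto simp: polydisc_def)

lemma continuous_on_vupd [continuous_intros]:
  assumes "continuous_on A f" "continuous_on A g"
  shows "continuous_on A (\<lambda>x. vupd (f x) i (g x))"
  unfolding vupd_def
proof (rule continuous_on_vec_lambda)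
  show "continuous_on A (\<lambda>x. if k = i then g x else f x $ k)" for k
    using assms by (cases "k = i") (auto intro: continuous_intros)
qed

text \<open>Identities between iterated derivatives are available only inside the polydisc. It is
  open, so they may still be used underneath a further \<open>cpartial\<close>.\<close>

lemma cpartial_cong_polydisc:
  assumes "\<And>z. z \<in> polydisc R \<Longrightarrow> F z = G z" "z \<in> polydisc R"
  shows "cpartial i F z = cpartial i G z"
  unfolding cpartial_vupd
proof (rule deriv_cong_ev)
  have "z $ i \<in> ball 0 R" using assms(2) by (simp add: polydisc_def)
  thus "\<forall>\<^sub>F t in nhds (z $ i). F (vupd z i t) = G (vupd z i t)"
    using assms by (intro eventually_nhds_in_open[THEN eventually_mono, of "ball 0 R"])
      (auto intro: vupd_in_polydisc)
qed auto

lemma cpartial_funpow_cong_polydisc: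
  assumes "\<And>z. z \<in> polydisc R \<Longrightarrow> F z = G z" "z \<in> polydisc R"
  shows "(cpartial i ^^ m) F z = (cpartial i ^^ m) G z"
  using assms(2) by (induction m arbitrary: z) (auto simp: assms(1) intro: cpartial_cong_polydisc)

lemma holomorphic_near_0_imp_sep_holomorphic:
  fixes F :: "complex ^ 'v::finite \<Rightarrow> complex"
  assumes "holomorphic_near_0 F"
  obtains R where "R > 0" "sep_holomorphic R F"
proof -
  obtain U where U: "open U" "0 \<in> U"
    and D: "\<And>z. z \<in> U \<Longrightarrow> \<exists>D. (F has_derivative D) (at z) \<and> (\<forall>a v. D (a *s v) = a * D v)"
    using assms unfolding holomorphic_near_0_def by blast
  obtain e where e: "e > 0" "ball 0 e \<subseteq> U" using U by (auto elim: openE)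
  \<comment> \<open>The Euclidean norm is at most the sum of the \<open>CARD('v)\<close> coordinate
    moduli; the extra 1 makes that sum strictly smaller than \<open>e\<close>.\<close>
  define R where "R = e / (real CARD('v) + 1)"
  have R: "R > 0" using e by (simp add: R_def add_pos_pos)
  have sub: "polydisc R \<subseteq> U"
  proof
    fix z :: "complex ^ 'v" assume "z \<in> polydisc R"
    hence "norm z \<le> (\<Sum>i\<in>(UNIV::'v set). R)"
      unfolding polydisc_def norm_vec_def
      by (intro order_trans[OF L2_set_le_sum] sum_mono) (auto intro: less_imp_le)
    also have "\<dots> < e" using e by (simp add: R_def divide_simps)
    finally show "z \<in> U" using e by auto
  qed
  have "sep_holomorphic R F" unfolding sep_holomorphic_def
  proof (intro conjI ballI allI)
    show "continuous_on (polydisc R) F"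
      using sub D by (meson continuous_at_imp_continuous_on has_derivative_continuous subsetD)
    fix z :: "complex ^ 'v" and i assume z: "z \<in> polydisc R"
    show "(\<lambda>t. F (vupd z i t)) holomorphic_on ball 0 R"
    proof (rule holomorphic_onI, rule field_differentiable_at_within)
      fix t :: complex assume t: "t \<in> ball 0 R"
      have "vupd z i t \<in> U" using vupd_in_polydisc[OF z, of t i] t sub by auto
      then obtain D' where D': "(F has_derivative D') (at (vupd z i t))" "\<And>a v. D' (a *s v) = a * D' v"
        using D by blast
      \<comment> \<open>The slice is an affine complex line, so complex linearity of
        \<open>D'\<close> turns the Frechet derivative into a complex derivative along it.\<close>
      have vu: "vupd z i = (\<lambda>s. vupd z i 0 + s *s axis i 1)"
        by (auto simp: vec_eq_iff axis_def)
      have bl: "bounded_linear (\<lambda>s. s *s axis i (1::complex))"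
        unfolding linear_conv_bounded_linear[symmetric]
        by (rule linearI) (auto simp: vec_eq_iff axis_def algebra_simps)
      have "(vupd z i has_derivative (\<lambda>s. s *s axis i 1)) (at t)"
        by (subst vu) (auto intro!: derivative_eq_intros bounded_linear.has_derivative[OF bl])
      from diff_chain_at[OF this D'(1)]
      have "((\<lambda>t. F (vupd z i t)) has_field_derivative D' (axis i 1)) (at t)"
        by (simp add: has_field_derivative_def o_def D'(2) mult_commute_abs)
      thus "(\<lambda>t. F (vupd z i t)) field_differentiable at t" by (auto simp: field_differentiable_def)
    qed
  qed
  with R that show ?thesis by blast
qed

section \<open>Cauchy's formula in one variable, with the other variables as parameters\<close>

definition circ :: "real \<Rightarrow> real \<Rightarrow> complex" where
  "circ r t = of_real r * exp (2 * of_real pi * \<i> * of_real t)"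

lemma cmod_circ [simp]: "r > 0 \<Longrightarrow> cmod (circ r t) = r"
  by (simp add: circ_def norm_mult norm_exp)

lemma continuous_on_circ [continuous_intros]:
  "continuous_on A g \<Longrightarrow> continuous_on A (\<lambda>x. circ r (g x))"
  unfolding circ_def by (intro continuous_intros)

text \<open>The circle is centred at 0 and not at \<open>z $ i\<close>: the same contour then serves
  every \<open>z\<close> in the smaller polydisc, and the integrand is jointly continuous in
  \<open>z\<close> and \<open>t\<close>.\<close>

lemma cpartial_integral:
  fixes z :: "complex ^ 'v::finite"
  assumes F: "sep_holomorphic R F" and z: "z \<in> polydisc R" and r: "cmod (z $ i) < r" "r < R"
  shows "cpartial i F z =
    integral (cbox 0 1) (\<lambda>t. F (vupd z i (circ r t)) * (circ r t / (circ r t - z $ i)\<^sup>2))"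
proof -
  have r0: "0 < r" using r(1) by (meson norm_ge_zero order_le_less_trans)
  have hol: "(\<lambda>t. F (vupd z i t)) holomorphic_on ball 0 R"
    using F z by (auto simp: sep_holomorphic_def)
  have "((\<lambda>t. F (vupd z i t)) has_field_derivative
      (1 / (2 * of_real pi * \<i>) * contour_integral (circlepath 0 r)
         (\<lambda>u. F (vupd z i u) / (u - z $ i)^2))) (at (z $ i))"
    using r by (intro Cauchy_derivative_integral_circlepath holomorphic_on_imp_continuous_on
        holomorphic_on_subset[OF hol]) auto
  hence "cpartial i F z = 1 / (2 * of_real pi * \<i>) * contour_integral (circlepath 0 r)
         (\<lambda>u. F (vupd z i u) / (u - z $ i)^2)"
    unfolding cpartial_vupd by (rule DERIV_imp_deriv)
  also have "contour_integral (circlepath 0 r) (\<lambda>u. F (vupd z i u) / (u - z $ i)^2) =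
     integral (cbox 0 1) (\<lambda>t. F (vupd z i (circ r t)) / (circ r t - z $ i)^2 *
       (2 * of_real pi * \<i> * circ r t))"
    unfolding contour_integral_integral cbox_interval vector_derivative_circlepath
    by (simp add: circlepath circ_def mult_ac)
  also have "1 / (2 * of_real pi * \<i>) * \<dots> = integral (cbox 0 1) (\<lambda>t. 1 / (2 * of_real pi * \<i>) *
     (F (vupd z i (circ r t)) / (circ r t - z $ i)^2 * (2 * of_real pi * \<i> * circ r t)))"
    by (rule integral_mult_right[symmetric])
  also have "\<dots> = integral (cbox 0 1)
      (\<lambda>t. F (vupd z i (circ r t)) * (circ r t / (circ r t - z $ i)\<^sup>2))"
    by (rule integral_cong) (simp add: field_simps)
  finally show ?thesis .
qed

lemma polydisc_mono: "r \<le> R \<Longrightarrow> polydisc r \<subseteq> polydisc R"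
  by (auto simp: polydisc_def intro: less_le_trans)

lemma open_polydisc: "open (polydisc R :: (complex ^ 'v::finite) set)"
proof -
  have "polydisc R = (\<Inter>i\<in>UNIV. {z :: complex ^ 'v. cmod (z $ i) < R})"
    by (auto simp: polydisc_def)
  also have "open \<dots>"
    by (intro open_INT ballI open_Collect_less continuous_intros) auto
  finally show ?thesis .
qed

lemma polydisc_exhaust:
  fixes z :: "complex ^ 'v::finite"
  assumes "z \<in> polydisc R"
  obtains r where "0 < r" "r < R" "z \<in> polydisc r"
proof -
  define m where "m = Max (range (\<lambda>i. cmod (z $ i)))"
  have "m < R" "0 \<le> m"
    unfolding m_def using assms by (auto simp: polydisc_def Max_ge_iff)
  moreover have "cmod (z $ i) \<le> m" for i unfolding m_def by (rule Max_ge) auto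
  ultimately have "cmod (z $ i) < (m + R) / 2" for i
  proof -
    have "cmod (z $ i) \<le> m" by fact
    also have "m < (m + R) / 2" using \<open>m < R\<close> by simp
    finally show ?thesis .
  qed
  with \<open>m < R\<close> \<open>0 \<le> m\<close> show ?thesis by (intro that[of "(m + R) / 2"]) (auto simp: polydisc_def)
qed

lemma continuous_on_kernel:
  fixes G :: "complex ^ 'v::finite \<Rightarrow> complex"
  assumes "continuous_on (polydisc R) G" "0 < r" "r < R"
  shows "continuous_on (polydisc r \<times> cbox 0 1)
     (\<lambda>(z, t). G (vupd z i (circ r t)) * (circ r t / (circ r t - z $ i)\<^sup>2))"
  unfolding split_beta
proof (intro continuous_intros continuous_on_compose2[OF assms(1)] ballI)
  show "(\<lambda>x. vupd (fst x) i (circ r (snd x))) ` (polydisc r \<times> cbox 0 1) \<subseteq> polydisc R"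
    using assms polydisc_mono[of r R] by (auto intro!: vupd_in_polydisc)
  fix x :: "(complex ^ 'v) \<times> real" assume x: "x \<in> polydisc r \<times> cbox 0 1"
  hence "cmod (fst x $ i) < r" by (auto simp: polydisc_def)
  hence "circ r (snd x) \<noteq> fst x $ i" using cmod_circ[OF assms(2), of "snd x"] by auto
  thus "(circ r (snd x) - fst x $ i)\<^sup>2 \<noteq> 0" by simp
qed

lemma continuous_on_cpartial:
  fixes F :: "complex ^ 'v::finite \<Rightarrow> complex"
  assumes F: "sep_holomorphic R F"
  shows "continuous_on (polydisc R) (cpartial i F)"
proof (rule continuous_at_imp_continuous_on, rule ballI)
  fix z :: "complex ^ 'v" assume z: "z \<in> polydisc R"
  obtain r where r: "0 < r" "r < R" "z \<in> polydisc r" using polydisc_exhaust[OF z] .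
  have "continuous_on (polydisc r) (\<lambda>z. integral (cbox 0 1)
      (\<lambda>t. F (vupd z i (circ r t)) * (circ r t / (circ r t - z $ i)\<^sup>2)))"
    using F r by (intro integral_continuous_on_param continuous_on_kernel[of R])
      (auto simp: sep_holomorphic_def)
  also have "?this \<longleftrightarrow> continuous_on (polydisc r) (cpartial i F)"
    using r polydisc_mono[of r R]
    by (intro continuous_on_cong refl cpartial_integral[OF F, symmetric]) (auto simp: polydisc_def)
  finally show "isCont (cpartial i F) z"
    using r open_polydisc continuous_on_eq_continuous_at by blast
qed

lemma has_field_derivative_vupd:
  assumes F: "sep_holomorphic R F" and z: "z \<in> polydisc R" and t: "cmod t < R"
  shows "((\<lambda>t. F (vupd z i t)) has_field_derivative cpartial i F (vupd z i t)) (at t)"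
proof -
  have "(\<lambda>t. F (vupd z i t)) holomorphic_on ball 0 R"
    using F z by (auto simp: sep_holomorphic_def)
  from holomorphic_derivI[OF this open_ball, of t] show ?thesis
    using t by (simp add: cpartial_vupd)
qed

text \<open>Cauchy's formula for variable \<open>i\<close> is differentiated under the integral sign
  with respect to another variable \<open>k\<close>. This serves twice: it shows that
  \<open>cpartial i F\<close> is holomorphic in variable \<open>k\<close>, and the value found is
  Cauchy's formula for \<open>cpartial i (cpartial k F)\<close>, which gives the symmetry of mixed
  derivatives.\<close>

lemma cpartial_slice_derivative_integral:
  fixes z :: "complex ^ 'v::finite"
  assumes F: "sep_holomorphic R F" and z: "z \<in> polydisc R" and ik: "i \<noteq> k" and s: "cmod s < R"
  obtains r where "0 < r" "r < R" "vupd z k s \<in> polydisc r"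
    "((\<lambda>s. cpartial i F (vupd z k s)) has_field_derivative
       integral (cbox 0 1) (\<lambda>t. cpartial k F (vupd (vupd z k s) i (circ r t)) *
         (circ r t / (circ r t - z $ i)\<^sup>2))) (at s)"
proof -
  obtain r where r: "0 < r" "r < R" "vupd z k s \<in> polydisc r"
    using polydisc_exhaust[OF vupd_in_polydisc[OF z s]] .
  have zi: "cmod (z $ i) < r" and sr: "s \<in> ball 0 r"
    using r(3) ik by (auto simp: polydisc_def split: if_splits dest: spec[of _ i] spec[of _ k])
  have pd: "vupd z k u \<in> polydisc r" if "cmod u < r" for u
    using vupd_in_polydisc[OF r(3) that, of k] by simp
  have pdR: "vupd z k u \<in> polydisc R" if "cmod u < r" for u
    using pd[OF that] polydisc_mono[of r R] r by auto
  let ?w = "\<lambda>t. circ r t / (circ r t - z $ i)\<^sup>2"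
  have cF: "continuous_on (polydisc R) F" and ck: "continuous_on (polydisc R) (cpartial k F)"
    using F continuous_on_cpartial[OF F] by (auto simp: sep_holomorphic_def)
  \<comment> \<open>Stated for a general \<open>G\<close> because the Leibniz rule uses it both for
    \<open>F\<close> and for \<open>cpartial k F\<close>.\<close>
  have kcont: "continuous_on (ball 0 r \<times> cbox 0 1)
      (\<lambda>(u, t). G (vupd (vupd z k u) i (circ r t)) * ?w t)" if G: "continuous_on (polydisc R) G" for G
  proof -
    have "continuous_on (ball 0 r \<times> cbox 0 1)
      (\<lambda>x. (\<lambda>(z, t). G (vupd z i (circ r t)) * (circ r t / (circ r t - z $ i)\<^sup>2))
         (vupd z k (fst x), snd x))"
      by (rule continuous_on_compose2[OF continuous_on_kernel[OF G r(1,2), of i]])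
         (use ik pd in \<open>auto intro!: continuous_intros\<close>)
    thus ?thesis using ik by (simp add: split_beta)
  qed
  have "((\<lambda>u. integral (cbox 0 1) (\<lambda>t. F (vupd (vupd z k u) i (circ r t)) * ?w t)) has_field_derivative
      integral (cbox 0 1) (\<lambda>t. cpartial k F (vupd (vupd z k s) i (circ r t)) * ?w t)) (at s within ball 0 r)"
  proof (rule leibniz_rule_field_derivative)
    fix u :: complex and t :: real assume u: "u \<in> ball 0 r"
    have "((\<lambda>u. F (vupd (vupd z i (circ r t)) k u)) has_field_derivative
        cpartial k F (vupd (vupd z i (circ r t)) k u)) (at u within ball 0 r)"
      using u r by (intro has_field_derivative_at_within[OF has_field_derivative_vupd[OF F]]
          vupd_in_polydisc z) auto
    thus "((\<lambda>u. F (vupd (vupd z k u) i (circ r t)) * ?w t) has_field_derivative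
        cpartial k F (vupd (vupd z k u) i (circ r t)) * ?w t) (at u within ball 0 r)"
      using ik by (intro DERIV_cmult_right) (simp add: vupd_commute)
  next
    fix u :: complex assume u: "u \<in> ball 0 r"
    have "continuous_on (cbox 0 1) (\<lambda>t. (\<lambda>(u, t). F (vupd (vupd z k u) i (circ r t)) * ?w t) (u, t))"
      by (rule continuous_on_compose2[OF kcont[OF cF]]) (use u in \<open>auto intro!: continuous_intros\<close>)
    thus "(\<lambda>t. F (vupd (vupd z k u) i (circ r t)) * ?w t) integrable_on cbox 0 1"
      by (intro integrable_continuous) simp
  qed (use kcont[OF ck] sr in auto)
  hence *: "((\<lambda>u. integral (cbox 0 1) (\<lambda>t. F (vupd (vupd z k u) i (circ r t)) * ?w t)) has_field_derivative
      integral (cbox 0 1) (\<lambda>t. cpartial k F (vupd (vupd z k s) i (circ r t)) * ?w t)) (at s)"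
    using sr by (simp add: at_within_open[OF sr open_ball])
  show ?thesis
  proof (rule that[OF r], rule has_field_derivative_transform_within_open[OF * open_ball sr])
    fix u :: complex assume "u \<in> ball 0 r"
    thus "integral (cbox 0 1) (\<lambda>t. F (vupd (vupd z k u) i (circ r t)) * ?w t) = cpartial i F (vupd z k u)"
      using cpartial_integral[OF F pdR, of u i r] zi ik r by auto
  qed
qed

lemma sep_holomorphic_cpartial:
  assumes F: "sep_holomorphic R F"
  shows "sep_holomorphic R (cpartial i F)"
  unfolding sep_holomorphic_def
proof (intro conjI ballI allI continuous_on_cpartial[OF F])
  fix z :: "complex ^ 'a" and k assume z: "z \<in> polydisc R"
  show "(\<lambda>t. cpartial i F (vupd z k t)) holomorphic_on ball 0 R"
  proof (cases "k = i")
    case True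
    have "deriv (\<lambda>t. F (vupd z i t)) holomorphic_on ball 0 R"
      using F z by (intro holomorphic_deriv) (auto simp: sep_holomorphic_def)
    thus ?thesis using True by (simp add: cpartial_vupd)
  next
    case False
    show ?thesis
    proof (rule holomorphic_onI, rule field_differentiable_at_within)
      fix s :: complex assume "s \<in> ball 0 R"
      thus "(\<lambda>t. cpartial i F (vupd z k t)) field_differentiable at s"
        using cpartial_slice_derivative_integral[OF F z, of i k s] False
        unfolding field_differentiable_def by (metis mem_ball_0)
    qed
  qed
qed

lemma cpartial_commute:
  assumes F: "sep_holomorphic R F" and z: "z \<in> polydisc R"
  shows "cpartial k (cpartial i F) z = cpartial i (cpartial k F) z"
proof (cases "i = k")
  case False
  have zk: "cmod (z $ k) < R" using z by (simp add: polydisc_def)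
  obtain r where r: "0 < r" "r < R" "vupd z k (z $ k) \<in> polydisc r"
    and d: "((\<lambda>s. cpartial i F (vupd z k s)) has_field_derivative
       integral (cbox 0 1) (\<lambda>t. cpartial k F (vupd (vupd z k (z $ k)) i (circ r t)) *
         (circ r t / (circ r t - z $ i)\<^sup>2))) (at (z $ k))"
    using cpartial_slice_derivative_integral[OF F z False zk] .
  have "cmod (z $ i) < r" using r by (simp add: polydisc_def)
  thus ?thesis
    using DERIV_imp_deriv[OF d] cpartial_integral[OF sep_holomorphic_cpartial[OF F] z _ r(2), of i k]
    by (simp add: cpartial_vupd[of k "cpartial i F"])
qed auto

section \<open>Iterated partial derivatives and Cauchy estimates\<close>

lemma sep_holomorphic_funpow: "sep_holomorphic R F \<Longrightarrow> sep_holomorphic R ((cpartial i ^^ m) F)"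
  by (induction m) (auto intro: sep_holomorphic_cpartial)

abbreviation partials ::
  "('v::finite \<Rightarrow> nat) \<Rightarrow> 'v list \<Rightarrow> (complex ^ 'v \<Rightarrow> complex) \<Rightarrow> complex ^ 'v \<Rightarrow> complex" where
  "partials \<alpha> \<equiv> foldr (\<lambda>i. cpartial i ^^ \<alpha> i)"

lemma sep_holomorphic_foldr:
  "sep_holomorphic R F \<Longrightarrow> sep_holomorphic R (partials \<alpha> xs F)"
  by (induction xs) (auto intro: sep_holomorphic_funpow)

lemma cpartial_funpow_commute:
  assumes F: "sep_holomorphic R F" and z: "z \<in> polydisc R"
  shows "(cpartial k ^^ m) (cpartial i F) z = cpartial i ((cpartial k ^^ m) F) z"
  using z
proof (induction m arbitrary: z)
  case (Suc m)
  have "(cpartial k ^^ Suc m) (cpartial i F) z = cpartial k (cpartial i ((cpartial k ^^ m) F)) z"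
    unfolding funpow.simps o_def by (rule cpartial_cong_polydisc[OF Suc.IH Suc.prems])
  also have "\<dots> = cpartial i (cpartial k ((cpartial k ^^ m) F)) z"
    by (rule cpartial_commute[OF sep_holomorphic_funpow[OF F] Suc.prems])
  finally show ?case by simp
qed auto

lemma foldr_cpartial_commute:
  assumes F: "sep_holomorphic R F" and z: "z \<in> polydisc R"
  shows "partials \<alpha> xs (cpartial i F) z =
         cpartial i (partials \<alpha> xs F) z"
  using z
proof (induction xs arbitrary: z)
  case (Cons k xs)
  have "partials \<alpha> (k # xs) (cpartial i F) z =
      (cpartial k ^^ \<alpha> k) (cpartial i (partials \<alpha> xs F)) z"
    unfolding foldr.simps o_def by (rule cpartial_funpow_cong_polydisc[OF Cons.IH Cons.prems])
  also have "\<dots> = cpartial i ((cpartial k ^^ \<alpha> k) (partials \<alpha> xs F)) z"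
    by (rule cpartial_funpow_commute[OF sep_holomorphic_foldr[OF F] Cons.prems])
  finally show ?case by simp
qed auto

text \<open>The list names each variable once, so the extra derivative is pushed through the other
  blocks by commutation and merges with the block of variable \<open>i\<close>.\<close>

lemma foldr_cpartial_Suc:
  assumes F: "sep_holomorphic R F" and z: "z \<in> polydisc R" and xs: "distinct xs" "i \<in> set xs"
  shows "partials \<alpha> xs (cpartial i F) z =
         partials (\<alpha>(i := Suc (\<alpha> i))) xs F z"
  using z xs
proof (induction xs arbitrary: z)
  case (Cons k xs)
  show ?case
  proof (cases "k = i")
    case True
    hence *: "partials (\<alpha>(i := Suc (\<alpha> i))) xs F =
        partials \<alpha> xs F"
      using Cons.prems by (intro foldr_cong) auto
    have "partials \<alpha> (k # xs) (cpartial i F) z =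
       (cpartial k ^^ \<alpha> k) (cpartial i (partials \<alpha> xs F)) z"
      unfolding foldr.simps o_def
      by (rule cpartial_funpow_cong_polydisc[OF foldr_cpartial_commute[OF F] Cons.prems(1)])
    thus ?thesis using True * by (simp add: funpow_swap1)
  next
    case False
    have "partials \<alpha> (k # xs) (cpartial i F) z =
        (cpartial k ^^ \<alpha> k) (partials (\<alpha>(i := Suc (\<alpha> i))) xs F) z"
      unfolding foldr.simps o_def
      using Cons.prems False by (intro cpartial_funpow_cong_polydisc Cons.IH) auto
    thus ?thesis using False by simp
  qed
qed auto

lemma cpartial_funpow_eq_deriv:
  assumes "z \<in> polydisc R"
  shows "(cpartial i ^^ m) F z = (deriv ^^ m) (\<lambda>t. F (vupd z i t)) (z $ i)"
  using assms
proof (induction m arbitrary: z)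
  case (Suc m)
  have zi: "z $ i \<in> ball 0 R" using Suc.prems by (simp add: polydisc_def)
  have "deriv (\<lambda>t. (cpartial i ^^ m) F (vupd z i t)) (z $ i) =
        deriv (\<lambda>t. (deriv ^^ m) (\<lambda>t. F (vupd z i t)) t) (z $ i)"
  proof (rule deriv_cong_ev)
    show "\<forall>\<^sub>F t in nhds (z $ i). (cpartial i ^^ m) F (vupd z i t) = (deriv ^^ m) (\<lambda>t. F (vupd z i t)) t"
      using Suc.IH[OF vupd_in_polydisc[OF Suc.prems]] zi
      by (intro eventually_nhds_in_open[THEN eventually_mono, of "ball 0 R"]) auto
  qed auto
  thus ?case by (simp add: cpartial_vupd[of i "(cpartial i ^^ m) F"])
qed auto

text \<open>One application of the one-variable Cauchy inequality per list entry. The point is 0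
  only in the variables of the list; the other coordinates stay free in the closed polydisc, because
  the induction moves one of them around the circle of radius \<open>r\<close>.\<close>

lemma foldr_cpartial_bound:
  fixes F :: "complex ^ 'v::finite \<Rightarrow> complex" and z :: "complex ^ 'v"
  assumes F: "sep_holomorphic R F" and r: "0 < r" "r < R"
    and M: "\<And>z :: complex ^ 'v. \<forall>i. cmod (z $ i) \<le> r \<Longrightarrow> cmod (F z) \<le> M"
    and "distinct xs" "\<forall>i. cmod (z $ i) \<le> r" "\<forall>i\<in>set xs. z $ i = 0"
  shows "cmod (partials \<alpha> xs F z) \<le> M * (\<Prod>i\<in>set xs. fact (\<alpha> i) / r ^ \<alpha> i)"
  using assms(5-)
proof (induction xs arbitrary: z)
  case (Cons i xs)
  let ?G = "partials \<alpha> xs F"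
  let ?P = "\<Prod>i\<in>set xs. fact (\<alpha> i) / r ^ \<alpha> i"
  have z: "z \<in> polydisc R" using Cons.prems r by (auto simp: polydisc_def intro: le_less_trans)
  have hol: "(\<lambda>t. ?G (vupd z i t)) holomorphic_on ball 0 R"
    using sep_holomorphic_foldr[OF F] z by (auto simp: sep_holomorphic_def)
  have "cmod ((deriv ^^ \<alpha> i) (\<lambda>t. ?G (vupd z i t)) 0) \<le> fact (\<alpha> i) * (M * ?P) / r ^ \<alpha> i"
  proof (rule Cauchy_inequality)
    show "(\<lambda>t. ?G (vupd z i t)) holomorphic_on ball 0 r"
      using r by (intro holomorphic_on_subset[OF hol]) auto
    show "continuous_on (cball 0 r) (\<lambda>t. ?G (vupd z i t))"
      using r by (intro holomorphic_on_imp_continuous_on holomorphic_on_subset[OF hol]) auto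
    show "cmod (?G (vupd z i t)) \<le> M * ?P" if "cmod (0 - t) = r" for t
      using that Cons.prems by (intro Cons.IH) auto
  qed (use r in auto)
  moreover have "partials \<alpha> (i # xs) F z = (deriv ^^ \<alpha> i) (\<lambda>t. ?G (vupd z i t)) 0"
    using cpartial_funpow_eq_deriv[OF z, where i = i and m = "\<alpha> i" and F = ?G] Cons.prems by simp
  ultimately show ?case using Cons.prems by (simp add: mult_ac)
qed (use M in auto)

lemma taylor_coeff_map:
  "taylor_coeff N coord F \<alpha> =
     partials \<alpha> (map coord [0..<N]) F 0 / (\<Prod>i\<in>UNIV. fact (\<alpha> i))"
  by (simp add: taylor_coeff_def foldr_map o_def)

lemma distinct_coord_list:
  assumes "bij_betw coord {..<N} (UNIV :: 'v::finite set)"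
  shows "distinct (map coord [0..<N])" "set (map coord [0..<N]) = UNIV"
  using assms by (auto simp: distinct_map bij_betw_def atLeast0LessThan)

lemma taylor_coeff_bound:
  fixes F :: "complex ^ 'v::finite \<Rightarrow> complex"
  assumes F: "sep_holomorphic R F" and coord: "bij_betw coord {..<N} (UNIV :: 'v set)"
    and r: "0 < r" "r < R"
  obtains M where "M \<ge> 0" "\<And>\<alpha>. cmod (taylor_coeff N coord F \<alpha>) \<le> M / r ^ (\<Sum>i\<in>UNIV. \<alpha> i)"
proof -
  let ?K = "{z :: complex ^ 'v. \<forall>i. cmod (z $ i) \<le> r}"
  have "?K = (\<Inter>i\<in>UNIV. {z :: complex ^ 'v. cmod (z $ i) \<le> r})" by auto
  moreover have "closed \<dots>" by (intro closed_INT ballI closed_Collect_le continuous_intros)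
  moreover have "bounded ?K"
    unfolding bounded_iff
  proof (intro exI ballI)
    fix z :: "complex ^ 'v" assume "z \<in> ?K"
    thus "norm z \<le> (\<Sum>i\<in>(UNIV::'v set). r)" 
      unfolding norm_vec_def by (intro order_trans[OF L2_set_le_sum] sum_mono) auto
  qed
  ultimately have "compact ?K" by (simp add: compact_eq_bounded_closed)
  moreover have "?K \<subseteq> polydisc R" using r by (auto simp: polydisc_def intro: le_less_trans)
  hence "continuous_on ?K F" using F continuous_on_subset unfolding sep_holomorphic_def by blast
  ultimately have "bounded (F ` ?K)" by (intro compact_imp_bounded compact_continuous_image)
  then obtain M where M: "\<And>z. z \<in> ?K \<Longrightarrow> cmod (F z) \<le> M" by (auto simp: bounded_iff)
  have 0: "0 \<in> ?K" using r by simp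
  have "cmod (taylor_coeff N coord F \<alpha>) \<le> M / r ^ (\<Sum>i\<in>UNIV. \<alpha> i)" for \<alpha>
  proof -
    have "cmod (partials \<alpha> (map coord [0..<N]) F 0) \<le>
        M * (\<Prod>i\<in>set (map coord [0..<N]). fact (\<alpha> i) / r ^ \<alpha> i)"
      by (rule foldr_cpartial_bound[OF F r _ distinct_coord_list(1)[OF coord]]) (use M r in auto)
    also have "\<dots> = M * (\<Prod>i\<in>UNIV. fact (\<alpha> i)) / r ^ (\<Sum>i\<in>UNIV. \<alpha> i)"
      unfolding distinct_coord_list(2)[OF coord] by (simp add: prod_dividef power_sum)
    finally show ?thesis
      unfolding taylor_coeff_map norm_divide prod_norm[symmetric] norm_fact
      by (subst pos_divide_le_eq) (auto intro!: prod_pos simp: mult_ac)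
  qed
  moreover have "M \<ge> 0" using M[OF 0] norm_ge_zero order_trans by blast
  ultimately show ?thesis using that by blast
qed

text \<open>Thereby a single family of Taylor coefficients carries both the equation and its
  linearization.\<close>

lemma taylor_coeff_cpartial:
  fixes F :: "complex ^ 'v::finite \<Rightarrow> complex"
  assumes F: "sep_holomorphic R F" "R > 0" and coord: "bij_betw coord {..<N} (UNIV :: 'v set)"
  shows "taylor_coeff N coord (cpartial i F) \<alpha> =
     of_nat (Suc (\<alpha> i)) * taylor_coeff N coord F (\<alpha>(i := Suc (\<alpha> i)))"
proof -
  have "(\<Prod>k\<in>UNIV. fact ((\<alpha>(i := Suc (\<alpha> i))) k)) =
      (of_nat (Suc (\<alpha> i)) * (\<Prod>k\<in>UNIV. fact (\<alpha> k)) :: complex)"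
  proof -
    have "(\<Prod>k\<in>UNIV - {i}. fact ((\<alpha>(i := Suc (\<alpha> i))) k)) = ((\<Prod>k\<in>UNIV - {i}. fact (\<alpha> k)) :: complex)"
      by (rule prod.cong) auto
    thus ?thesis by (subst (1 2) prod.remove[of _ i]) auto
  qed
  moreover have "0 \<in> polydisc R" using F by (simp add: polydisc_def)
  ultimately show ?thesis
    unfolding taylor_coeff_map
    using foldr_cpartial_Suc[OF F(1) _ distinct_coord_list(1)[OF coord], of 0 i \<alpha>]
      distinct_coord_list(2)[OF coord]
    by (simp del: of_nat_Suc)
qed

section \<open>Weights compensating small divisors\<close>

text \<open>Siegel's bound for an index of at least \<open>K\<close> is
  \<open>2 * k / K - 1\<close>. The base value is one less; the missing unit is what an element of
  \<open>S\<close> may add.\<close>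

definition siegel_base :: "real \<Rightarrow> nat \<Rightarrow> real" where
  "siegel_base K k = max 0 (2 * real k / K - 2)"

text \<open>Let distinct elements of \<open>S\<close> differ by at least \<open>K\<close>. In a recursion whose index \<open>k\<close> is split into
  smaller indices with sum at most \<open>k\<close>, at most \<open>siegel_count S K k\<close> of the indices lie in \<open>S\<close>.\<close>

definition siegel_count :: "nat set \<Rightarrow> real \<Rightarrow> nat \<Rightarrow> real" where
  "siegel_count S K k =
     Max (insert (siegel_base K k) ((\<lambda>s. 1 + siegel_base K s) ` {s \<in> S. s \<le> k}))"

definition separated :: "nat set \<Rightarrow> real \<Rightarrow> bool" where
  "separated S K \<longleftrightarrow> 0 < K \<and> (\<forall>s\<in>S. K \<le> real s) \<and>
     (\<forall>s\<in>S. \<forall>t\<in>S. s < t \<longrightarrow> K \<le> real t - real s)"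

lemma siegel_base_mono: "0 < K \<Longrightarrow> k \<le> l \<Longrightarrow> siegel_base K k \<le> siegel_base K l"
  unfolding siegel_base_def by (intro max.mono order_refl diff_mono divide_right_mono) auto

lemma siegel_count_le_iff:
  "siegel_count S K k \<le> x \<longleftrightarrow>
     siegel_base K k \<le> x \<and> (\<forall>s\<in>S. s \<le> k \<longrightarrow> 1 + siegel_base K s \<le> x)"
  unfolding siegel_count_def by (subst Max_le_iff) auto

lemma siegel_base_le_count: "siegel_base K k \<le> siegel_count S K k"
  unfolding siegel_count_def by (intro Max_ge) auto

lemma siegel_count_ge: "s \<in> S \<Longrightarrow> s \<le> k \<Longrightarrow> 1 + siegel_base K s \<le> siegel_count S K k"
  unfolding siegel_count_def by (intro Max_ge) auto

lemma siegel_count_nonneg: "0 \<le> siegel_count S K k"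
  using siegel_base_le_count[of K k S] by (simp add: siegel_base_def)

lemma siegel_count_mono:
  assumes "0 < K" "k \<le> l"
  shows "siegel_count S K k \<le> siegel_count S K l"
  using assms siegel_base_mono[OF assms] siegel_base_le_count[of K l S]
  by (auto simp: siegel_count_le_iff intro: siegel_count_ge)

lemma siegel_count_eq_0:
  assumes "separated S K" "real k < K"
  shows "siegel_count S K k = 0"
proof -
  have "siegel_count S K k \<le> 0"
    using assms by (auto simp: siegel_count_le_iff separated_def siegel_base_def field_simps)
  with siegel_count_nonneg[of S K k] show ?thesis by linarith
qed

lemma siegel_count_le:
  assumes "separated S K" "K \<le> real k"
  shows "siegel_count S K k \<le> 2 * real k / K - 1"
proof -
  have K: "0 < K" using assms by (simp add: separated_def)
  have "1 \<le> real k / K" using K assms by simp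
  hence b: "siegel_base K k = 2 * real k / K - 2" by (simp add: siegel_base_def)
  have "1 + siegel_base K s \<le> 2 * real k / K - 1" if "s \<le> k" for s
    using siegel_base_mono[OF K that] b by linarith
  thus ?thesis using b by (auto simp: siegel_count_le_iff)
qed

lemma siegel_count_le':
  assumes "separated S K"
  shows "siegel_count S K k \<le> 2 * real k / K"
  using siegel_count_le[OF assms, of k] siegel_count_eq_0[OF assms, of k] assms
  by (cases "K \<le> real k") (auto simp: separated_def)

text \<open>If both indices reach \<open>K\<close>, each count is at least one unit below
  \<open>2 / K\<close> times its index, and the two units together give the base value at the sum.
  Otherwise one count vanishes and monotonicity suffices.\<close>

lemma siegel_count_superadditive:
  assumes "separated S K"
  shows "siegel_count S K i + siegel_count S K j \<le> siegel_count S K (i + j)"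
proof (cases "real i < K \<or> real j < K")
  case True
  thus ?thesis
    using siegel_count_eq_0[OF assms] siegel_count_mono[of K _ "i + j" S] assms
    by (auto simp: separated_def)
next
  case False
  have "siegel_count S K i + siegel_count S K j \<le> 2 * real (i + j) / K - 2"
    using siegel_count_le[OF assms, of i] siegel_count_le[OF assms, of j] False
    by (simp add: add_divide_distrib algebra_simps)
  also have "\<dots> \<le> siegel_base K (i + j)" by (simp add: siegel_base_def)
  also have "\<dots> \<le> siegel_count S K (i + j)" by (rule siegel_base_le_count)
  finally show ?thesis .
qed

text \<open>The elements of \<open>S\<close> up to \<open>l\<close> lie at least \<open>K\<close>
  below \<open>k\<close>, so the base value at \<open>k\<close> already dominates everything counted
  at \<open>l\<close>, and \<open>k\<close> itself adds one unit.\<close>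

lemma siegel_count_jump:
  assumes "separated S K" "k \<in> S" "l < k"
  shows "1 + siegel_count S K l \<le> siegel_count S K k"
proof -
  have K: "0 < K" using assms by (simp add: separated_def)
  have "siegel_count S K l \<le> siegel_base K k"
    unfolding siegel_count_le_iff
  proof safe
    show "siegel_base K l \<le> siegel_base K k" using siegel_base_mono[OF K, of l k] assms by simp
    fix s assume s: "s \<in> S" "s \<le> l"
    hence "K \<le> real s" "K \<le> real k - real s" using assms by (auto simp: separated_def)
    hence "1 \<le> real s / K" "1 \<le> real k / K - real s / K"
      using K by (auto simp: diff_divide_distrib[symmetric])
    thus "1 + siegel_base K s \<le> siegel_base K k" by (simp add: siegel_base_def)
  qed
  thus ?thesis using siegel_count_ge[of k S k K] assms by simp
qed

text \<open>\<open>d k\<close> is the modulus of the divisor at index \<open>k\<close>, and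
  \<open>I\<close> is the set of indices that can occur. A drop from \<open>k\<close> to any smaller
  index gains a factor that pays for dividing by \<open>d k\<close>, while \<open>W\<close> grows at
  most exponentially. The notion is closed under products, so a polynomial in q^\<lambda> can be
  treated factor by factor.\<close>

definition tame :: "nat set \<Rightarrow> (nat \<Rightarrow> real) \<Rightarrow> bool" where
  "tame I d \<longleftrightarrow> (\<exists>W C B. C > 0 \<and> B \<ge> 1 \<and> (\<forall>k. 1 \<le> W k \<and> W k \<le> B ^ k) \<and>
     (\<forall>i j. W i * W j \<le> W (i + j)) \<and> (\<forall>k\<in>I. \<forall>l<k. W l \<le> C * d k * W k))"

lemma tame_mult:
  assumes "tame I d" "tame I e"
  shows "tame I (\<lambda>k. d k * e k)"
proof -
  obtain W C B where W: "C > 0" "B \<ge> 1" "\<And>k. 1 \<le> W k" "\<And>k. W k \<le> B ^ k"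
    "\<And>i j. W i * W j \<le> W (i + j)" "\<And>k l. k \<in> I \<Longrightarrow> l < k \<Longrightarrow> W l \<le> C * d k * W k"
    using assms(1) unfolding tame_def by metis
  obtain V D A where V: "D > 0" "A \<ge> 1" "\<And>k. 1 \<le> V k" "\<And>k. V k \<le> A ^ k"
    "\<And>i j. V i * V j \<le> V (i + j)" "\<And>k l. k \<in> I \<Longrightarrow> l < k \<Longrightarrow> V l \<le> D * e k * V k"
    using assms(2) unfolding tame_def by metis
  have pos: "0 \<le> W k" "0 \<le> V k" for k using W(3)[of k] V(3)[of k] by auto
  show ?thesis unfolding tame_def
  proof (rule exI[of _ "\<lambda>k. W k * V k"], rule exI[of _ "C * D"], rule exI[of _ "B * A"],
      intro conjI allI ballI impI)
    show "0 < C * D" using W V by simp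
    show "1 \<le> B * A" using mult_mono[of 1 B 1 A] W V by simp
    show "1 \<le> W k * V k" for k using mult_mono[of 1 "W k" 1 "V k"] W V pos by simp
    show "W k * V k \<le> (B * A) ^ k" for k
      unfolding power_mult_distrib using W V pos by (intro mult_mono) auto
    show "W i * V i * (W j * V j) \<le> W (i + j) * V (i + j)" for i j
      using mult_mono[OF W(5)[of i j] V(5)[of i j]] pos by (simp add: mult_ac)
    show "W l * V l \<le> C * D * (d k * e k) * (W k * V k)" if "k \<in> I" "l < k" for k l
      using mult_mono[OF W(6)[OF that] V(6)[OF that]] pos[of l]
        order_trans[OF pos(1) W(6)[OF that]] by (simp add: mult_ac)
  qed
qed

lemma tame_lower_bound:
  assumes "0 < c" "\<And>k. k \<in> I \<Longrightarrow> c \<le> d k"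
  shows "tame I d"
  unfolding tame_def
proof (rule exI[of _ "\<lambda>_. 1"], rule exI[of _ "1 / c"], rule exI[of _ 1], intro conjI allI ballI impI)
  show "1 \<le> 1 / c * d k * 1" if "k \<in> I" for k using assms(2)[OF that] assms(1) by simp
qed (use assms in auto)

lemma tame_power: "tame I d \<Longrightarrow> tame I (\<lambda>k. d k ^ m)"
  by (induction m) (auto intro: tame_mult tame_lower_bound[of 1])

lemma tame_prod:
  assumes "finite A" "\<And>a. a \<in> A \<Longrightarrow> tame I (d a)"
  shows "tame I (\<lambda>k. \<Prod>a\<in>A. d a k)"
  using assms by (induction A) (auto intro: tame_mult tame_lower_bound[of 1])

lemma summable_pow_over_geometric:
  assumes "1 < (g::real)" shows "summable (\<lambda>p. x / (\<kappa> * g ^ p))"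
proof -
  have "summable (\<lambda>p. x / \<kappa> * (1 / g) ^ p)"
    using assms by (intro summable_mult summable_geometric) auto
  thus ?thesis by (simp add: field_simps)
qed

text \<open>If |z k - a| and |z l - a| are both below 2^-p, then |z k - z l| < 2 * 2^-p, and
  \<open>sep\<close> forces k and l apart by a distance \<open>K p\<close> that grows geometrically
  in \<open>p\<close>. Each dyadic level thus has its own counting function, at most 2 k / K p at
  index k and hence summable over \<open>p\<close>; \<open>W k\<close> is 2 to the power of the
  total count.\<close>

lemma tame_small_divisors:
  fixes z :: "nat \<Rightarrow> complex"
  assumes c: "c > 0" and \<gamma>: "\<gamma> > 0"
    and root: "\<And>k. k \<in> I \<Longrightarrow> 0 < k \<Longrightarrow> c * real k powr (- \<gamma>) \<le> cmod (z k - a)"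
    and sep: "\<And>k l. k \<in> I \<Longrightarrow> l \<in> I \<Longrightarrow> l < k \<Longrightarrow> c * real (k - l) powr (- \<gamma>) \<le> cmod (z k - z l)"
  shows "tame I (\<lambda>k. cmod (z k - a))"
proof -
  define S where "S p = {k \<in> I. 0 < k \<and> cmod (z k - a) < (1/2) ^ p}" for p
  \<comment> \<open>\<open>\<kappa> * g ^ p\<close> is the solution x of c x^(-\<gamma>) = 2 *
    2^-p.\<close>
  define g where "g = (2::real) powr (1 / \<gamma>)"
  define \<kappa> where "\<kappa> = (c / 2) powr (1 / \<gamma>)"
  define K where "K p = \<kappa> * g ^ p" for p
  have g1: "1 < g" unfolding g_def using \<gamma> by (simp add: gr_one_powr)
  have \<kappa>0: "0 < \<kappa>" unfolding \<kappa>_def using c by simp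
  have K0: "0 < K p" for p unfolding K_def using g1 \<kappa>0 by simp
  have Kroot: "K p \<le> x" if "c * x powr (- \<gamma>) < 2 * (1/2) ^ p" "0 < x" for x p
  proof -
    have "g ^ p = (2 ^ p) powr (1 / \<gamma>)"
      unfolding g_def by (simp add: powr_realpow[symmetric] powr_powr mult.commute)
    hence "K p = (c / 2 * 2 ^ p) powr (1 / \<gamma>)"
      unfolding K_def \<kappa>_def using c by (simp only: powr_mult)
    also have "\<dots> \<le> (x powr \<gamma>) powr (1 / \<gamma>)"
    proof (rule powr_mono2)
      have "c < 2 * (1/2) ^ p * x powr \<gamma>"
        using that by (simp add: powr_minus field_simps)
      thus "c / 2 * 2 ^ p \<le> x powr \<gamma>" by (simp add: field_simps power_one_over)
    qed (use c \<gamma> in auto)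
    also have "\<dots> = x" using that \<gamma> by (simp add: powr_powr)
    finally show ?thesis .
  qed
  have sepS: "separated (S p) (K p)" for p
    unfolding separated_def
  proof (intro conjI ballI impI K0)
    fix s assume s: "s \<in> S p"
    show "K p \<le> real s"
    proof (rule Kroot)
      show "c * real s powr - \<gamma> < 2 * (1 / 2) ^ p"
        using root[of s] s unfolding S_def by (smt (verit) mem_Collect_eq zero_less_power half_gt_zero)
    qed (use s in \<open>auto simp: S_def\<close>)
    fix t assume t: "t \<in> S p" "s < t"
    have "K p \<le> real (t - s)"
    proof (rule Kroot)
      have "cmod (z t - z s) \<le> cmod (z t - a) + cmod (z s - a)"
        by (metis norm_minus_commute norm_triangle_sub norm_diff_triangle_ineq add.commute diff_add_cancel diff_diff_eq2 norm_triangle_ineq4)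
      thus "c * real (t - s) powr - \<gamma> < 2 * (1 / 2) ^ p"
        using sep[of t s] s t unfolding S_def by auto
    qed (use t in auto)
    thus "K p \<le> real t - real s" using t by (simp add: of_nat_diff)
  qed
  define \<nu> where "\<nu> p k = siegel_count (S p) (K p) k" for p k
  have \<nu>0: "0 \<le> \<nu> p k" for p k unfolding \<nu>_def by (rule siegel_count_nonneg)
  have \<nu>le: "\<nu> p k \<le> 2 * real k / K p" for p k
    unfolding \<nu>_def by (rule siegel_count_le'[OF sepS])
  have sumK: "summable (\<lambda>p. 2 * real k / K p)" for k
    unfolding K_def by (rule summable_pow_over_geometric[OF g1])
  have sum\<nu>: "summable (\<lambda>p. \<nu> p k)" for k
    by (rule summable_comparison_test'[OF sumK[of k], of 0]) (use \<nu>le \<nu>0 in auto)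
  define W where "W k = 2 powr (suminf (\<lambda>p. \<nu> p k))" for k
  define b where "b = (suminf (\<lambda>p. 2 / K p))"
  have sumK1: "summable (\<lambda>p. 2 / K p)" using sumK[of 1] by simp
  have b0: "0 \<le> b" unfolding b_def by (intro suminf_nonneg sumK1) (use K0 in \<open>auto intro: less_imp_le\<close>)
  show ?thesis unfolding tame_def
  proof (rule exI[of _ W], rule exI[of _ 1], rule exI[of _ "2 powr b"], intro conjI allI ballI impI)
    show "1 \<le> (2::real) powr b" using b0 by (simp add: ge_one_powr_ge_zero)
    show "1 \<le> W k" for k unfolding W_def
      by (intro ge_one_powr_ge_zero suminf_nonneg sum\<nu> \<nu>0) auto
    show "W k \<le> (2 powr b) ^ k" for k
    proof -
      have "(suminf (\<lambda>p. \<nu> p k)) \<le> (suminf (\<lambda>p. real k * (2 / K p)))"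
        using \<nu>le[of _ k] by (intro suminf_le sum\<nu> summable_mult sumK1) (simp add: mult.commute)
      also have "\<dots> = real k * b" unfolding b_def by (rule suminf_mult[OF sumK1])
      finally show ?thesis unfolding W_def
        by (simp add: powr_realpow[symmetric] powr_powr mult.commute)
    qed
    show "W i * W j \<le> W (i + j)" for i j
    proof -
      have "(suminf (\<lambda>p. \<nu> p i)) + (suminf (\<lambda>p. \<nu> p j)) = (suminf (\<lambda>p. \<nu> p i + \<nu> p j))"
        by (rule suminf_add[OF sum\<nu> sum\<nu>])
      also have "\<dots> \<le> (suminf (\<lambda>p. \<nu> p (i + j)))"
        by (intro suminf_le summable_add sum\<nu>)
          (simp add: \<nu>_def siegel_count_superadditive[OF sepS])
      finally show ?thesis unfolding W_def by (simp add: powr_add[symmetric])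
    qed
    fix k l assume kl: "k \<in> I" "l < k"
    have pos: "0 < cmod (z k - a)"
      using root[of k] kl c by (smt (verit) mult_pos_pos powr_gt_zero of_nat_0_less_iff not_less_zero gr0I)
    have ex: "\<exists>P. (1/2) ^ P \<le> cmod (z k - a)"
      using real_arch_pow_inv[OF pos, of "1/2"] by (auto intro: less_imp_le)
    \<comment> \<open>Every level \<open>p < P\<close> contains \<open>k\<close>, so each of these
      \<open>P\<close> counts jumps by one between \<open>l\<close> and \<open>k\<close>. The
      resulting factor \<open>2 ^ P\<close> pays for a divisor of size at least 2^-P.\<close>
    define P where "P = (LEAST P. (1/2) ^ P \<le> cmod (z k - a))"
    have P: "(1/2) ^ P \<le> cmod (z k - a)" unfolding P_def using ex by (rule LeastI_ex)
    have PS: "k \<in> S p" if "p < P" for p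
      using not_less_Least[OF that[unfolded P_def]] kl by (auto simp: S_def)
    have "real P + (suminf (\<lambda>p. \<nu> p l)) = (suminf (\<lambda>p. if p < P then 1 else 0)) + (suminf (\<lambda>p. \<nu> p l))"
      by (subst suminf_finite[of "{..<P}"]) auto
    also have "\<dots> = (suminf (\<lambda>p. (if p < P then 1 else 0) + \<nu> p l))"
      by (rule suminf_add[OF summable_finite[of "{..<P}"] sum\<nu>]) auto
    also have "\<dots> \<le> (suminf (\<lambda>p. \<nu> p k))"
    proof (intro suminf_le summable_add sum\<nu> summable_finite[of "{..<P}"])
      show "(if p < P then 1 else 0) + \<nu> p l \<le> \<nu> p k" for p
        using siegel_count_jump[OF sepS PS kl(2)] siegel_count_mono[OF K0, of l k] kl
        by (auto simp: \<nu>_def)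
    qed auto
    finally have "2 ^ P * W l \<le> W k"
      unfolding W_def by (simp add: powr_realpow[symmetric] powr_add[symmetric])
    hence "W l \<le> (1/2) ^ P * W k" by (simp add: field_simps power_one_over)
    also have "\<dots> \<le> cmod (z k - a) * W k" by (intro mult_right_mono P) (simp add: W_def)
    finally show "W l \<le> 1 * cmod (z k - a) * W k" by simp
  qed auto
qed

section \<open>Finite generalized power series\<close>

type_synonym fgps = "complex \<Rightarrow>\<^sub>0 complex"

abbreviation "lookup \<equiv> Poly_Mapping.lookup"
abbreviation "keys \<equiv> Poly_Mapping.keys"
abbreviation "single \<equiv> Poly_Mapping.single"

lemma poly_mapping_expand:
  assumes "finite A" "keys p \<subseteq> A"
  shows "p = (\<Sum>s\<in>A. single s (lookup p s))"
proof (rule poly_mapping_eqI)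
  fix k
  have "lookup (\<Sum>s\<in>A. single s (lookup p s)) k = (\<Sum>s\<in>A. if k = s then lookup p k else 0)"
    unfolding lookup_sum by (intro sum.cong refl) (simp add: lookup_single when_def)
  also have "\<dots> = lookup p k" using assms by (auto simp: in_keys_iff)
  finally show "lookup p k = lookup (\<Sum>s\<in>A. single s (lookup p s)) k" by simp
qed

lemma lookup_single_mult: "lookup (single s c * p) l = c * lookup p (l - s)" for p :: fgps
proof -
  have "single s c * p = (\<Sum>t\<in>keys p. single (s + t) (c * lookup p t))"
    by (subst poly_mapping_expand[of "keys p" p])
      (auto simp: sum_distrib_left mult_single simp del: lookup_sum)
  also have "lookup \<dots> l = (\<Sum>t\<in>keys p. if t = l - s then c * lookup p (l - s) else 0)"
    unfolding lookup_sum by (intro sum.cong refl) (auto simp: lookup_single when_def algebra_simps)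
  also have "\<dots> = c * lookup p (l - s)" by (auto simp: in_keys_iff)
  finally show ?thesis .
qed

lemma lookup_mult_sum:
  fixes p r :: fgps
  assumes "finite A" "keys p \<subseteq> A"
  shows "lookup (p * r) l = (\<Sum>s\<in>A. lookup p s * lookup r (l - s))"
proof -
  have "p * r = (\<Sum>s\<in>A. single s (lookup p s) * r)"
    by (subst poly_mapping_expand[OF assms]) (simp add: sum_distrib_right)
  thus ?thesis by (simp add: lookup_sum lookup_single_mult)
qed

definition re_ge :: "real \<Rightarrow> fgps \<Rightarrow> bool" where
  "re_ge v p \<longleftrightarrow> (\<forall>l\<in>keys p. v \<le> Re l)"

lemma re_geD: "re_ge v p \<Longrightarrow> Re l < v \<Longrightarrow> lookup p l = 0"
  by (force simp: re_ge_def in_keys_iff)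

lemma re_ge_mult: "re_ge v p \<Longrightarrow> re_ge w r \<Longrightarrow> re_ge (v + w) (p * r)"
  unfolding re_ge_def using keys_mult[of p r] by (force intro: add_mono)

lemma re_ge_add: "re_ge v p \<Longrightarrow> re_ge v r \<Longrightarrow> re_ge v (p + r)"
  unfolding re_ge_def using keys_add[of p r] by blast

lemma re_ge_uminus: "re_ge v p \<Longrightarrow> re_ge v (- p)"
  by (auto simp: re_ge_def in_keys_iff)

lemma re_ge_zero: "re_ge v 0"
  by (simp add: re_ge_def)

lemma re_ge_one: "re_ge 0 1"
  by (auto simp: re_ge_def in_keys_iff lookup_one when_def)

lemma re_ge_single: "v \<le> Re s \<Longrightarrow> re_ge v (single s c)"
  by (auto simp: re_ge_def)

lemma re_ge_sum: "(\<And>i. i \<in> A \<Longrightarrow> re_ge v (f i)) \<Longrightarrow> re_ge v (sum f A)"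
  by (induction A rule: infinite_finite_induct) (auto intro: re_ge_zero re_ge_add)

lemma re_ge_mult0: "re_ge 0 p \<Longrightarrow> re_ge v r \<Longrightarrow> re_ge v (p * r)"
  using re_ge_mult[of 0 p v r] by simp

lemma re_ge_power: "re_ge v p \<Longrightarrow> re_ge (real m * v) (p ^ m)"
  by (induction m) (auto simp: algebra_simps intro: re_ge_one re_ge_mult)

lemma re_ge_prod: "(\<And>i. i \<in> A \<Longrightarrow> re_ge (v i) (f i)) \<Longrightarrow> re_ge (sum v A) (prod f A)"
  by (induction A rule: infinite_finite_induct) (auto intro: re_ge_one re_ge_mult)

section \<open>Weighted l1 norms\<close>

definition wnorm :: "(complex \<Rightarrow> real) \<Rightarrow> fgps \<Rightarrow> real" where
  "wnorm \<theta> p = (\<Sum>l\<in>keys p. cmod (lookup p l) * \<theta> l)"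

lemma wnorm_superset:
  assumes "finite A" "keys p \<subseteq> A"
  shows "wnorm \<theta> p = (\<Sum>l\<in>A. cmod (lookup p l) * \<theta> l)"
  unfolding wnorm_def using assms by (intro sum.mono_neutral_left) (auto simp: in_keys_iff)

lemma wnorm_nonneg: "(\<And>l. 0 \<le> \<theta> l) \<Longrightarrow> 0 \<le> wnorm \<theta> p"
  by (auto simp: wnorm_def intro!: sum_nonneg)

lemma wnorm_sum_ge:
  assumes "\<And>l. 0 \<le> \<theta> l" "finite A"
  shows "(\<Sum>l\<in>A. cmod (lookup p l) * \<theta> l) \<le> wnorm \<theta> p"
proof -
  have "(\<Sum>l\<in>A. cmod (lookup p l) * \<theta> l) \<le> (\<Sum>l\<in>A \<union> keys p. cmod (lookup p l) * \<theta> l)"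
    using assms by (intro sum_mono2) auto
  thus ?thesis using wnorm_superset[of "A \<union> keys p" p] assms by simp
qed

lemma wnorm_zero [simp]: "wnorm \<theta> 0 = 0"
  by (simp add: wnorm_def)

lemma wnorm_single: "wnorm \<theta> (single s c) = cmod c * \<theta> s"
  by (subst wnorm_superset[of "{s}"]) auto

lemma wnorm_add_le:
  assumes "\<And>l. 0 \<le> \<theta> l"
  shows "wnorm \<theta> (p + r) \<le> wnorm \<theta> p + wnorm \<theta> r"
proof -
  let ?A = "keys p \<union> keys r"
  have "wnorm \<theta> (p + r) = (\<Sum>l\<in>?A. cmod (lookup p l + lookup r l) * \<theta> l)"
    using keys_add[of p r] by (subst wnorm_superset[of ?A]) (auto simp: lookup_add)
  also have "\<dots> \<le> (\<Sum>l\<in>?A. cmod (lookup p l) * \<theta> l + cmod (lookup r l) * \<theta> l)"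
    using assms by (intro sum_mono) (metis distrib_right mult_right_mono norm_triangle_ineq)
  also have "\<dots> = wnorm \<theta> p + wnorm \<theta> r"
    by (simp add: sum.distrib wnorm_superset[of ?A])
  finally show ?thesis .
qed

lemma wnorm_uminus [simp]: "wnorm \<theta> (- p) = wnorm \<theta> p"
  by (simp add: wnorm_def keys.rep_eq)

lemma wnorm_sum_le:
  assumes "\<And>l. 0 \<le> \<theta> l"
  shows "wnorm \<theta> (sum f A) \<le> (\<Sum>i\<in>A. wnorm \<theta> (f i))"
  by (induction A rule: infinite_finite_induct)
    (auto intro: order_trans[OF wnorm_add_le] assms)

lemma wnorm_mono:
  assumes "\<And>l. l \<in> keys p \<Longrightarrow> \<theta> l \<le> \<eta> l"
  shows "wnorm \<theta> p \<le> wnorm \<eta> p"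
  unfolding wnorm_def by (intro sum_mono mult_left_mono assms) auto

text \<open>Three different weights, because in the majorant estimate the product is measured with
  the small divisor already divided out, the factor of positive order without
  \<open>\<Omega>\<close>, and the other factor with it.\<close>

lemma wnorm_mult_le:
  assumes nn: "\<And>l. 0 \<le> \<theta> l"
    and le: "\<And>s t. s \<in> keys p \<Longrightarrow> t \<in> keys r \<Longrightarrow> \<theta> (s + t) \<le> \<theta>1 s * \<theta>2 t"
  shows "wnorm \<theta> (p * r) \<le> wnorm \<theta>1 p * wnorm \<theta>2 r"
proof -
  have "p * r = (\<Sum>s\<in>keys p. single s (lookup p s)) * (\<Sum>t\<in>keys r. single t (lookup r t))"
    using poly_mapping_expand[of "keys p" p] poly_mapping_expand[of "keys r" r] by simp
  also have "\<dots> = (\<Sum>s\<in>keys p. \<Sum>t\<in>keys r. single (s + t) (lookup p s * lookup r t))"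
    by (simp add: sum_product mult_single)
  also have "wnorm \<theta> \<dots> \<le> (\<Sum>s\<in>keys p. \<Sum>t\<in>keys r. cmod (lookup p s * lookup r t) * \<theta> (s + t))"
    by (intro order_trans[OF wnorm_sum_le[OF nn]] sum_mono) (simp add: wnorm_single)
  also have "\<dots> \<le> (\<Sum>s\<in>keys p. \<Sum>t\<in>keys r. (cmod (lookup p s) * \<theta>1 s) * (cmod (lookup r t) * \<theta>2 t))"
  proof (intro sum_mono)
    fix s t assume "s \<in> keys p" "t \<in> keys r"
    from mult_left_mono[OF le[OF this], of "cmod (lookup p s * lookup r t)"]
    show "cmod (lookup p s * lookup r t) * \<theta> (s + t) \<le>
       (cmod (lookup p s) * \<theta>1 s) * (cmod (lookup r t) * \<theta>2 t)"
      by (simp add: norm_mult mult_ac)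
  qed
  also have "\<dots> = wnorm \<theta>1 p * wnorm \<theta>2 r" by (simp add: wnorm_def sum_product)
  finally show ?thesis .
qed

text \<open>Submultiplicativity is demanded in the closed right half-plane only, where
  \<open>\<Omega>\<close> will be supermultiplicative. The value 0 is allowed, so that even the zero
  function is a weight.\<close>

definition weight :: "(complex \<Rightarrow> real) \<Rightarrow> bool" where
  "weight \<theta> \<longleftrightarrow> (\<forall>l. 0 \<le> \<theta> l) \<and> \<theta> 0 \<le> 1 \<and>
     (\<forall>s t. 0 \<le> Re s \<longrightarrow> 0 \<le> Re t \<longrightarrow> \<theta> (s + t) \<le> \<theta> s * \<theta> t)"

lemma weight_mult_le:
  assumes "weight \<theta>" "re_ge 0 p" "re_ge 0 r"
  shows "wnorm \<theta> (p * r) \<le> wnorm \<theta> p * wnorm \<theta> r"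
  using assms by (intro wnorm_mult_le) (auto simp: weight_def re_ge_def)

lemma weight_nonneg: "weight \<theta> \<Longrightarrow> 0 \<le> wnorm \<theta> p"
  by (intro wnorm_nonneg) (auto simp: weight_def)

lemma weight_add_le: "weight \<theta> \<Longrightarrow> wnorm \<theta> (p + r) \<le> wnorm \<theta> p + wnorm \<theta> r"
  by (intro wnorm_add_le) (auto simp: weight_def)

lemma weight_sum_le: "weight \<theta> \<Longrightarrow> wnorm \<theta> (sum f A) \<le> (\<Sum>i\<in>A. wnorm \<theta> (f i))"
  by (intro wnorm_sum_le) (auto simp: weight_def)

lemma weight_one: "weight \<theta> \<Longrightarrow> wnorm \<theta> 1 \<le> 1"
  unfolding single_one[symmetric] wnorm_single by (simp add: weight_def)

section \<open>Monomials, truncated Taylor series and their second-order expansion\<close>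

definition mon :: "('v::finite \<Rightarrow> fgps) \<Rightarrow> ('v \<Rightarrow> nat) \<Rightarrow> fgps" where
  "mon z \<alpha> = (\<Prod>i\<in>UNIV. z i ^ \<alpha> i)"

definition mdeg :: "('v::finite \<Rightarrow> nat) \<Rightarrow> nat" where
  "mdeg \<alpha> = sum \<alpha> UNIV"

definition incr :: "'v \<Rightarrow> ('v \<Rightarrow> nat) \<Rightarrow> 'v \<Rightarrow> nat" where
  "incr i \<alpha> = \<alpha>(i := Suc (\<alpha> i))"

text \<open>Derivative of the monomial z^\<alpha> in direction \<open>b\<close>. The truncated
  subtraction at \<open>\<alpha> i = 0\<close> is harmless, as the factor
  \<open>of_nat (\<alpha> i)\<close> vanishes there.\<close>

definition dmon :: "('v::finite \<Rightarrow> fgps) \<Rightarrow> ('v \<Rightarrow> fgps) \<Rightarrow> ('v \<Rightarrow> nat) \<Rightarrow> fgps" where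
  "dmon z b \<alpha> = (\<Sum>i\<in>UNIV. of_nat (\<alpha> i) * mon z (\<alpha>(i := \<alpha> i - 1)) * b i)"

text \<open>The cut at total degree \<open>M\<close> keeps all sums finite; \<open>M\<close> is
  chosen so large that the coefficients under consideration are exact.\<close>

definition peval :: "(('v::finite \<Rightarrow> nat) \<Rightarrow> complex) \<Rightarrow> nat \<Rightarrow> ('v \<Rightarrow> fgps) \<Rightarrow> fgps" where
  "peval f M z = (\<Sum>\<alpha> | mdeg \<alpha> \<le> M. single 0 (f \<alpha>) * mon z \<alpha>)"

definition dcoeff :: "'v \<Rightarrow> (('v \<Rightarrow> nat) \<Rightarrow> complex) \<Rightarrow> ('v \<Rightarrow> nat) \<Rightarrow> complex" where
  "dcoeff i f \<alpha> = of_nat (Suc (\<alpha> i)) * f (incr i \<alpha>)"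

lemma mdeg_le_subset: "{\<alpha> :: 'v::finite \<Rightarrow> nat. mdeg \<alpha> \<le> M} \<subseteq> PiE UNIV (\<lambda>_. {..M})"
proof
  fix \<alpha> :: "'v \<Rightarrow> nat" assume "\<alpha> \<in> {\<alpha>. mdeg \<alpha> \<le> M}"
  moreover have "\<alpha> i \<le> mdeg \<alpha>" for i unfolding mdeg_def by (rule member_le_sum) auto
  ultimately show "\<alpha> \<in> PiE UNIV (\<lambda>_. {..M})" by (auto intro: order_trans)
qed

lemma finite_mdeg_le [simp]: "finite {\<alpha> :: 'v::finite \<Rightarrow> nat. mdeg \<alpha> \<le> M}"
  by (rule finite_subset[OF mdeg_le_subset]) (auto intro: finite_PiE)

lemma mdeg_incr [simp]: "mdeg (incr i \<alpha>) = Suc (mdeg \<alpha>)"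
proof -
  have "sum (incr i \<alpha>) (UNIV - {i}) = sum \<alpha> (UNIV - {i})"
    by (rule sum.cong) (auto simp: incr_def)
  thus ?thesis unfolding mdeg_def by (subst (1 2) sum.remove[of _ i]) (auto simp: incr_def)
qed

lemma mon_incr [simp]: "mon z (incr i \<alpha>) = mon z \<alpha> * z i"
proof -
  have "(\<Prod>k\<in>UNIV - {i}. z k ^ incr i \<alpha> k) = (\<Prod>k\<in>UNIV - {i}. z k ^ \<alpha> k)"
    by (rule prod.cong) (auto simp: incr_def)
  thus ?thesis unfolding mon_def
    by (subst (1 2) prod.remove[of _ i]) (auto simp: incr_def mult_ac)
qed

lemma mon_0 [simp]: "mon z (\<lambda>_. 0) = 1"
  by (simp add: mon_def)

lemma mdeg_induct [case_names zero incr]: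
  fixes \<alpha> :: "'v::finite \<Rightarrow> nat"
  assumes "P (\<lambda>_. 0)" "\<And>i \<alpha>. P \<alpha> \<Longrightarrow> P (incr i \<alpha>)"
  shows "P \<alpha>"
proof (induction "mdeg \<alpha>" arbitrary: \<alpha>)
  case 0
  hence "\<alpha> = (\<lambda>_. 0)" by (auto simp: mdeg_def)
  thus ?case using assms by simp
next
  case (Suc d)
  then obtain i where i: "\<alpha> i > 0"
    unfolding mdeg_def by (metis not_gr_zero sum.neutral nat.distinct(1))
  define \<beta> where "\<beta> = \<alpha>(i := \<alpha> i - 1)"
  have \<alpha>: "\<alpha> = incr i \<beta>" using i by (auto simp: \<beta>_def incr_def)
  have "d = mdeg \<beta>" using Suc(2) \<alpha> by simp
  thus ?case using Suc(1) assms(2) \<alpha> by simp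
qed

lemma incr_decr: "i \<noteq> k \<Longrightarrow> (incr k \<alpha>)(i := incr k \<alpha> i - 1) = incr k (\<alpha>(i := \<alpha> i - 1))"
  "(incr k \<alpha>)(k := incr k \<alpha> k - 1) = \<alpha>" "0 < \<alpha> k \<Longrightarrow> incr k (\<alpha>(k := \<alpha> k - 1)) = \<alpha>"
  by (auto simp: incr_def)

lemma dmon_0 [simp]: "dmon z b (\<lambda>_. 0) = 0"
  by (simp add: dmon_def)

text \<open>Product rule; with it, facts on derivatives of monomials are proved by adding one
  variable at a time.\<close>

lemma dmon_incr: "dmon z b (incr k \<alpha>) = dmon z b \<alpha> * z k + mon z \<alpha> * b k"
proof -
  have eq: "of_nat (incr k \<alpha> i) * mon z ((incr k \<alpha>)(i := incr k \<alpha> i - 1)) * b i =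
     of_nat (\<alpha> i) * mon z (\<alpha>(i := \<alpha> i - 1)) * b i * z k + (if i = k then mon z \<alpha> * b k else 0)" for i
  proof (cases "i = k")
    case True
    have "of_nat (\<alpha> k) * mon z (\<alpha>(k := \<alpha> k - 1)) * z k = of_nat (\<alpha> k) * mon z \<alpha>"
      using incr_decr(3)[of \<alpha> k] mon_incr[of z k "\<alpha>(k := \<alpha> k - 1)"] by (cases "\<alpha> k") (auto simp: mult_ac)
    thus ?thesis using True by (simp add: incr_decr incr_def algebra_simps)
  next
    case False
    have "mon z ((incr k \<alpha>)(i := incr k \<alpha> i - 1)) = mon z (\<alpha>(i := \<alpha> i - 1)) * z k"
      by (simp only: incr_decr(1)[OF False] mon_incr)
    moreover have "incr k \<alpha> i = \<alpha> i" using False by (simp add: incr_def)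
    ultimately show ?thesis using False by (simp only: mult_ac if_False add_0_right)
  qed
  show ?thesis unfolding dmon_def eq sum.distrib by (simp add: sum_distrib_right)
qed

text \<open>Chain rule. Differentiation lowers the degree by one, hence \<open>Suc M\<close> on the
  left and \<open>M\<close> on the right.\<close>

lemma peval_dmon_sum:
  fixes f :: "('v::finite \<Rightarrow> nat) \<Rightarrow> complex"
  shows "(\<Sum>\<alpha> | mdeg \<alpha> \<le> Suc M. single 0 (f \<alpha>) * dmon z b \<alpha>) =
     (\<Sum>i\<in>UNIV. peval (dcoeff i f) M z * b i)"
proof -
  have "(\<Sum>\<alpha> | mdeg \<alpha> \<le> Suc M. single 0 (f \<alpha>) * (of_nat (\<alpha> i) * mon z (\<alpha>(i := \<alpha> i - 1)) * b i))
      = peval (dcoeff i f) M z * b i" for i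
  proof -
    have "(\<Sum>\<alpha> | mdeg \<alpha> \<le> Suc M. single 0 (f \<alpha>) * (of_nat (\<alpha> i) * mon z (\<alpha>(i := \<alpha> i - 1)) * b i))
      = (\<Sum>\<alpha> | mdeg \<alpha> \<le> Suc M \<and> 0 < \<alpha> i. single 0 (f \<alpha>) * (of_nat (\<alpha> i) * mon z (\<alpha>(i := \<alpha> i - 1)) * b i))"
      by (intro sum.mono_neutral_right) auto
    also have "\<dots> = (\<Sum>\<beta> | mdeg \<beta> \<le> M. single 0 (dcoeff i f \<beta>) * mon z \<beta> * b i)"
    proof (rule sum.reindex_bij_witness[of _ "incr i" "\<lambda>\<alpha>. \<alpha>(i := \<alpha> i - 1)"])
      fix \<alpha> :: "'v \<Rightarrow> nat" assume \<alpha>: "\<alpha> \<in> {\<alpha>. mdeg \<alpha> \<le> Suc M \<and> 0 < \<alpha> i}"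
      hence *: "incr i (\<alpha>(i := \<alpha> i - 1)) = \<alpha>" by (auto simp: incr_def fun_eq_iff)
      show "incr i (\<alpha>(i := \<alpha> i - 1)) = \<alpha>" by fact
      have "mdeg \<alpha> = Suc (mdeg (\<alpha>(i := \<alpha> i - 1)))" by (metis * mdeg_incr)
      thus "\<alpha>(i := \<alpha> i - 1) \<in> {\<beta>. mdeg \<beta> \<le> M}" using \<alpha> by simp
      have eq: "single 0 (dcoeff i f (\<alpha>(i := \<alpha> i - 1))) = single 0 (f \<alpha>) * of_nat (\<alpha> i)"
        using \<alpha> unfolding single_of_nat[symmetric] mult_single dcoeff_def * by (simp add: mult.commute)
      show "single 0 (dcoeff i f (\<alpha>(i := \<alpha> i - 1))) * mon z (\<alpha>(i := \<alpha> i - 1)) * b i =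
        single 0 (f \<alpha>) * (of_nat (\<alpha> i) * mon z (\<alpha>(i := \<alpha> i - 1)) * b i)"
        unfolding eq by (simp only: mult_ac)
    next
      fix \<beta> :: "'v \<Rightarrow> nat" assume "\<beta> \<in> {\<beta>. mdeg \<beta> \<le> M}"
      thus "incr i \<beta> \<in> {\<alpha>. mdeg \<alpha> \<le> Suc M \<and> 0 < \<alpha> i}" by (simp) (simp add: incr_def)
      show "(incr i \<beta>)(i := incr i \<beta> i - 1) = \<beta>" by (rule incr_decr)
    qed
    finally show ?thesis by (simp add: peval_def sum_distrib_right)
  qed
  thus ?thesis unfolding dmon_def sum_distrib_left by (subst sum.swap) simp
qed

lemma re_ge_mon:
  assumes "\<And>i. re_ge \<delta> (z i)"
  shows "re_ge (\<delta> * real (mdeg \<alpha>)) (mon z \<alpha>)"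
proof -
  have "re_ge (\<Sum>i\<in>UNIV. real (\<alpha> i) * \<delta>) (mon z \<alpha>)"
    unfolding mon_def by (intro re_ge_prod re_ge_power assms)
  thus ?thesis by (simp add: mdeg_def sum_distrib_left mult.commute)
qed

lemma re_ge_peval:
  assumes "\<And>i. re_ge 0 (z i)"
  shows "re_ge 0 (peval f M z)"
  unfolding peval_def using re_ge_mon[OF assms]
  by (intro re_ge_sum re_ge_mult0 re_ge_single) auto

lemma wnorm_mon_le:
  assumes w: "weight \<theta>" and "\<And>i. re_ge 0 (z i)" "\<And>i. wnorm \<theta> (z i) \<le> s"
  shows "wnorm \<theta> (mon z \<alpha>) \<le> s ^ mdeg \<alpha>"
proof (induction \<alpha> rule: mdeg_induct)
  case zero
  show ?case using weight_one[OF w] by (simp add: mdeg_def)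
next
  case (incr i \<alpha>)
  have "re_ge 0 (mon z \<alpha>)" using re_ge_mon[OF assms(2)] by simp
  hence "wnorm \<theta> (mon z \<alpha> * z i) \<le> wnorm \<theta> (mon z \<alpha>) * wnorm \<theta> (z i)"
    by (intro weight_mult_le w assms)
  also have "\<dots> \<le> s ^ mdeg \<alpha> * s"
    using incr assms(3) weight_nonneg[OF w] by (intro mult_mono) (auto intro: order_trans)
  finally show ?case by (simp add: mult.commute)
qed

text \<open>Multiplication by one more variable z k = a k + x b k turns the remainder Q into Q z k +
  D b k, where D is the first derivative; with d the degree, the bounds survive since d^2 + d \<le>
  (d + 1)^2. The powers of \<open>s\<close> stand on the left-hand sides so that
  \<open>s = 0\<close> is allowed.\<close>

lemma mon_taylor:
  assumes w: "weight \<theta>" and a: "\<And>i. re_ge 0 (a i)" "\<And>i. wnorm \<theta> (a i) \<le> s"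
    and b: "\<And>i. re_ge 0 (b i)" "\<And>i. wnorm \<theta> (b i) \<le> B"
    and z: "\<And>i. z i = a i + x * b i" "\<And>i. wnorm \<theta> (z i) \<le> s" and x: "re_ge 0 x"
  shows "\<exists>Q. mon z \<alpha> = mon a \<alpha> + x * dmon a b \<alpha> + x\<^sup>2 * Q \<and> re_ge 0 Q \<and> re_ge 0 (dmon a b \<alpha>) \<and>
     s * wnorm \<theta> (dmon a b \<alpha>) \<le> real (mdeg \<alpha>) * s ^ mdeg \<alpha> * B \<and>
     s\<^sup>2 * wnorm \<theta> Q \<le> (real (mdeg \<alpha>))\<^sup>2 * s ^ mdeg \<alpha> * B\<^sup>2"
proof (induction \<alpha> rule: mdeg_induct)
  case zero
  show ?case by (intro exI[of _ 0]) (auto simp: mdeg_def re_ge_zero)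
next
  case (incr k \<alpha>)
  then obtain Q where Q: "mon z \<alpha> = mon a \<alpha> + x * dmon a b \<alpha> + x\<^sup>2 * Q" "re_ge 0 Q" "re_ge 0 (dmon a b \<alpha>)"
    "s * wnorm \<theta> (dmon a b \<alpha>) \<le> real (mdeg \<alpha>) * s ^ mdeg \<alpha> * B"
    "s\<^sup>2 * wnorm \<theta> Q \<le> (real (mdeg \<alpha>))\<^sup>2 * s ^ mdeg \<alpha> * B\<^sup>2"
    by blast
  note nn = weight_nonneg[OF w]
  have s0: "0 \<le> s" and B0: "0 \<le> B" using nn a(2) b(2) by (meson order_trans)+
  let ?d = "real (mdeg \<alpha>)" and ?D = "dmon a b \<alpha>"
  have zk: "re_ge 0 (z k)" unfolding z(1) by (intro re_ge_add re_ge_mult0 a b x)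
  have ma: "re_ge 0 (mon a \<alpha>)" using re_ge_mon[OF a(1)] by simp
  define Q' where "Q' = Q * z k + ?D * b k"
  have "mon z (incr k \<alpha>) = mon a (incr k \<alpha>) + x * dmon a b (incr k \<alpha>) + x\<^sup>2 * Q'"
    by (simp add: Q(1) z(1) dmon_incr Q'_def algebra_simps power2_eq_square)
  moreover have "re_ge 0 Q'" "re_ge 0 (dmon a b (incr k \<alpha>))"
    unfolding Q'_def dmon_incr by (intro re_ge_add re_ge_mult0 Q a b zk ma)+
  moreover have "s * wnorm \<theta> (dmon a b (incr k \<alpha>)) \<le> real (mdeg (incr k \<alpha>)) * s ^ mdeg (incr k \<alpha>) * B"
  proof -
    have "wnorm \<theta> (dmon a b (incr k \<alpha>)) \<le> wnorm \<theta> ?D * wnorm \<theta> (a k) + wnorm \<theta> (mon a \<alpha>) * wnorm \<theta> (b k)"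
      unfolding dmon_incr
      by (intro order_trans[OF weight_add_le[OF w]] add_mono weight_mult_le w Q a b ma)
    also have "\<dots> \<le> wnorm \<theta> ?D * s + s ^ mdeg \<alpha> * B"
      using s0 by (intro add_mono mult_mono order_refl a b wnorm_mon_le w nn) auto
    finally have "s * wnorm \<theta> (dmon a b (incr k \<alpha>)) \<le> s * (wnorm \<theta> ?D * s + s ^ mdeg \<alpha> * B)"
      using s0 by (rule mult_left_mono)
    also have "\<dots> = (s * wnorm \<theta> ?D) * s + s ^ Suc (mdeg \<alpha>) * B" by (simp add: algebra_simps)
    also have "\<dots> \<le> (?d * s ^ mdeg \<alpha> * B) * s + s ^ Suc (mdeg \<alpha>) * B"
      by (intro add_mono mult_right_mono Q s0 order_refl)
    finally show ?thesis by (simp add: algebra_simps)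
  qed
  moreover have "s\<^sup>2 * wnorm \<theta> Q' \<le> (real (mdeg (incr k \<alpha>)))\<^sup>2 * s ^ mdeg (incr k \<alpha>) * B\<^sup>2"
  proof -
    have "wnorm \<theta> Q' \<le> wnorm \<theta> Q * wnorm \<theta> (z k) + wnorm \<theta> ?D * wnorm \<theta> (b k)"
      unfolding Q'_def
      by (intro order_trans[OF weight_add_le[OF w]] add_mono weight_mult_le w Q b zk)
    also have "\<dots> \<le> wnorm \<theta> Q * s + wnorm \<theta> ?D * B"
      by (intro add_mono mult_left_mono z b nn)
    finally have "s\<^sup>2 * wnorm \<theta> Q' \<le> s\<^sup>2 * (wnorm \<theta> Q * s + wnorm \<theta> ?D * B)"
      by (rule mult_left_mono) simp
    also have "\<dots> = (s\<^sup>2 * wnorm \<theta> Q) * s + (s * wnorm \<theta> ?D) * (s * B)"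
      by (simp add: algebra_simps power2_eq_square)
    also have "\<dots> \<le> (?d\<^sup>2 * s ^ mdeg \<alpha> * B\<^sup>2) * s + (?d * s ^ mdeg \<alpha> * B) * (s * B)"
      using s0 B0 by (intro add_mono mult_right_mono Q) auto
    also have "\<dots> = (?d\<^sup>2 + ?d) * (s ^ Suc (mdeg \<alpha>) * B\<^sup>2)"
      by (simp add: algebra_simps power2_eq_square)
    also have "\<dots> \<le> (?d + 1)\<^sup>2 * (s ^ Suc (mdeg \<alpha>) * B\<^sup>2)"
      using s0 B0 by (intro mult_right_mono) (auto simp: power2_eq_square algebra_simps)
    finally show ?thesis by (simp add: mult_ac add.commute)
  qed
  ultimately show ?case by blast
qed

text \<open>Enlarging the simplex to a cube factors the sum into \<open>CARD('v)\<close> geometric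
  series, each at most 2.\<close>

lemma sum_geometric_mdeg_le:
  "(\<Sum>\<alpha> | mdeg (\<alpha> :: 'v::finite \<Rightarrow> nat) \<le> M. (1/2::real) ^ mdeg \<alpha>) \<le> 2 ^ CARD('v)"
proof -
  have "(\<Sum>\<alpha> | mdeg (\<alpha> :: 'v \<Rightarrow> nat) \<le> M. (1/2::real) ^ mdeg \<alpha>) \<le>
      (\<Sum>\<alpha>\<in>PiE UNIV (\<lambda>_::'v. {..M}). (1/2::real) ^ mdeg \<alpha>)"
    by (intro sum_mono2 mdeg_le_subset) (auto intro: finite_PiE)
  also have "\<dots> = (\<Sum>\<alpha>\<in>PiE UNIV (\<lambda>_::'v. {..M}). \<Prod>i\<in>UNIV. (1/2::real) ^ \<alpha> i)"
    by (simp add: mdeg_def power_sum)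
  also have "\<dots> = (\<Prod>i\<in>(UNIV::'v set). \<Sum>k\<le>M. (1/2::real) ^ k)"
    by (rule prod_sum_PiE[symmetric]) auto
  also have "\<dots> \<le> (\<Prod>i\<in>(UNIV::'v set). 2)"
  proof (intro prod_mono conjI sum_nonneg)
    have "(\<Sum>k\<le>M. (1/2::real) ^ k) = 2 - (1/2) ^ M"
      by (induction M) (auto simp: field_simps)
    thus "(\<Sum>k\<le>M. (1/2::real) ^ k) \<le> 2" by simp
  qed auto
  finally show ?thesis by simp
qed

lemma square_le_4_power: "(real d)\<^sup>2 \<le> 4 ^ d"
proof -
  have "real d \<le> 2 ^ d" using less_exp[of d] by (metis less_imp_le of_nat_le_iff of_nat_numeral of_nat_power)
  hence "(real d)\<^sup>2 \<le> (2 ^ d)\<^sup>2" by (intro power_mono) auto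
  also have "\<dots> = ((2::real)\<^sup>2) ^ d" unfolding power_mult[symmetric] by (simp only: mult.commute)
  also have "\<dots> = 4 ^ d" by simp
  finally show ?thesis .
qed

lemma wnorm_peval_le:
  fixes z :: "'v::finite \<Rightarrow> fgps"
  assumes w: "weight \<theta>" and f: "\<And>\<alpha>. cmod (f \<alpha>) \<le> C / r ^ mdeg \<alpha>" and r: "0 < r" and C: "0 \<le> C"
    and z: "\<And>i. re_ge 0 (z i)" "\<And>i. wnorm \<theta> (z i) \<le> r / 8"
  shows "wnorm \<theta> (peval f M z) \<le> C * 2 ^ CARD('v)"
proof -
  have "wnorm \<theta> (single 0 (f \<alpha>) * mon z \<alpha>) \<le> C * (1/2) ^ mdeg \<alpha>" for \<alpha>
  proof -
    have "re_ge 0 (mon z \<alpha>)" using re_ge_mon[OF z(1)] by simp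
    hence "wnorm \<theta> (single 0 (f \<alpha>) * mon z \<alpha>) \<le> wnorm \<theta> (single 0 (f \<alpha>)) * wnorm \<theta> (mon z \<alpha>)"
      by (intro weight_mult_le w re_ge_single) auto
    also have "\<dots> \<le> (cmod (f \<alpha>) * 1) * (r / 8) ^ mdeg \<alpha>"
      unfolding wnorm_single using w weight_nonneg[OF w]
      by (intro mult_mono order_refl wnorm_mon_le z) (auto simp: weight_def)
    also have "\<dots> \<le> (C / r ^ mdeg \<alpha>) * (r / 8) ^ mdeg \<alpha>"
      using f[of \<alpha>] r by (intro mult_right_mono) auto
    also have "\<dots> = C * (1/8) ^ mdeg \<alpha>" using r by (simp add: power_divide)
    also have "\<dots> \<le> C * (1/2) ^ mdeg \<alpha>" using C by (intro mult_left_mono power_mono) auto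
    finally show ?thesis .
  qed
  hence "wnorm \<theta> (peval f M z) \<le> (\<Sum>\<alpha> | mdeg (\<alpha> :: 'v \<Rightarrow> nat) \<le> M. C * (1/2) ^ mdeg \<alpha>)"
    unfolding peval_def by (intro order_trans[OF weight_sum_le[OF w]] sum_mono)
  also have "\<dots> \<le> C * 2 ^ CARD('v)"
    unfolding sum_distrib_left[symmetric] by (intro mult_left_mono C sum_geometric_mdeg_le)
  finally show ?thesis .
qed

text \<open>The radius \<open>r / 8\<close> leaves a factor 8^-d in degree d against the Cauchy
  bound \<open>C / r ^ d\<close>. The remainder costs d^2 \<le> 4^d, and the 2^-d that is left is
  summable over all multi-indices. The factor \<open>64 / r\<^sup>2\<close> undoes the
  \<open>s\<^sup>2\<close> of the monomial estimate.\<close>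

lemma peval_taylor:
  fixes z :: "'v::finite \<Rightarrow> fgps"
  assumes w: "weight \<theta>" and f: "\<And>\<alpha>. cmod (f \<alpha>) \<le> C / r ^ mdeg \<alpha>" and r: "0 < r" and C: "0 \<le> C"
    and a: "\<And>i. re_ge 0 (a i)" "\<And>i. wnorm \<theta> (a i) \<le> r / 8"
    and b: "\<And>i. re_ge 0 (b i)" "\<And>i. wnorm \<theta> (b i) \<le> B"
    and z: "\<And>i. z i = a i + x * b i" "\<And>i. wnorm \<theta> (z i) \<le> r / 8" and x: "re_ge 0 x"
  obtains Q where "peval f (Suc M) z = peval f (Suc M) a +
      x * (\<Sum>i\<in>UNIV. peval (dcoeff i f) M a * b i) + x\<^sup>2 * Q"
    "re_ge 0 Q" "wnorm \<theta> Q \<le> 64 / r\<^sup>2 * C * 2 ^ CARD('v) * B\<^sup>2"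
proof -
  let ?s = "r / 8"
  have "\<forall>\<alpha>. \<exists>q. mon z \<alpha> = mon a \<alpha> + x * dmon a b \<alpha> + x\<^sup>2 * q \<and> re_ge 0 q \<and>
     ?s\<^sup>2 * wnorm \<theta> q \<le> (real (mdeg \<alpha>))\<^sup>2 * ?s ^ mdeg \<alpha> * B\<^sup>2"
  proof
    fix \<alpha>
    show "\<exists>q. mon z \<alpha> = mon a \<alpha> + x * dmon a b \<alpha> + x\<^sup>2 * q \<and> re_ge 0 q \<and>
     ?s\<^sup>2 * wnorm \<theta> q \<le> (real (mdeg \<alpha>))\<^sup>2 * ?s ^ mdeg \<alpha> * B\<^sup>2"
      using mon_taylor[where z = z and a = a and b = b and \<alpha> = \<alpha>, OF w a b z x] by (elim exE conjE) (intro exI conjI, assumption+)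
  qed
  from choice[OF this] obtain q where "\<forall>\<alpha>. mon z \<alpha> = mon a \<alpha> + x * dmon a b \<alpha> + x\<^sup>2 * q \<alpha> \<and>
     re_ge 0 (q \<alpha>) \<and> ?s\<^sup>2 * wnorm \<theta> (q \<alpha>) \<le> (real (mdeg \<alpha>))\<^sup>2 * ?s ^ mdeg \<alpha> * B\<^sup>2"
    ..
  hence q: "mon z \<alpha> = mon a \<alpha> + x * dmon a b \<alpha> + x\<^sup>2 * q \<alpha>" "re_ge 0 (q \<alpha>)"
     "?s\<^sup>2 * wnorm \<theta> (q \<alpha>) \<le> (real (mdeg \<alpha>))\<^sup>2 * ?s ^ mdeg \<alpha> * B\<^sup>2" for \<alpha>
    by blast+
  define Q where "Q = (\<Sum>\<alpha> | mdeg \<alpha> \<le> Suc M. single 0 (f \<alpha>) * q \<alpha>)"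
  have 1: "peval f (Suc M) z = peval f (Suc M) a +
      x * (\<Sum>i\<in>UNIV. peval (dcoeff i f) M a * b i) + x\<^sup>2 * Q"
    unfolding peval_dmon_sum[symmetric] unfolding peval_def Q_def sum_distrib_left sum.distrib[symmetric]
    by (intro sum.cong refl) (simp add: q(1) algebra_simps)
  have 2: "re_ge 0 Q" unfolding Q_def by (intro re_ge_sum re_ge_mult0 re_ge_single q) auto
  have "wnorm \<theta> (single 0 (f \<alpha>) * q \<alpha>) \<le> 64 / r\<^sup>2 * C * B\<^sup>2 * (1/2) ^ mdeg \<alpha>" for \<alpha>
  proof -
    have "wnorm \<theta> (single 0 (f \<alpha>) * q \<alpha>) \<le> wnorm \<theta> (single 0 (f \<alpha>)) * wnorm \<theta> (q \<alpha>)"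
      by (intro weight_mult_le w re_ge_single q) auto
    also have "\<dots> \<le> (cmod (f \<alpha>) * 1) * wnorm \<theta> (q \<alpha>)"
      unfolding wnorm_single using w weight_nonneg[OF w]
      by (intro mult_mono order_refl) (auto simp: weight_def)
    also have "\<dots> = cmod (f \<alpha>) * (64 / r\<^sup>2) * (?s\<^sup>2 * wnorm \<theta> (q \<alpha>))"
      using r by (simp add: power_divide)
    also have "\<dots> \<le> cmod (f \<alpha>) * (64 / r\<^sup>2) * (4 ^ mdeg \<alpha> * ?s ^ mdeg \<alpha> * B\<^sup>2)"
    proof (intro mult_left_mono)
      have "(real (mdeg \<alpha>))\<^sup>2 * ?s ^ mdeg \<alpha> * B\<^sup>2 \<le> 4 ^ mdeg \<alpha> * ?s ^ mdeg \<alpha> * B\<^sup>2"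
        using r by (intro mult_right_mono square_le_4_power) auto
      with q(3)[of \<alpha>] show "?s\<^sup>2 * wnorm \<theta> (q \<alpha>) \<le> 4 ^ mdeg \<alpha> * ?s ^ mdeg \<alpha> * B\<^sup>2"
        by (rule order_trans)
    qed (use r in auto)
    also have "\<dots> \<le> C / r ^ mdeg \<alpha> * (64 / r\<^sup>2) * (4 ^ mdeg \<alpha> * ?s ^ mdeg \<alpha> * B\<^sup>2)"
      using r by (intro mult_right_mono f) auto
    also have "\<dots> = 64 / r\<^sup>2 * C * B\<^sup>2 * (4 ^ mdeg \<alpha> * (1/8) ^ mdeg \<alpha>)"
      using r by (simp add: power_divide)
    also have "(4::real) ^ mdeg \<alpha> * (1/8) ^ mdeg \<alpha> = (1/2) ^ mdeg \<alpha>"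
      unfolding power_mult_distrib[symmetric] by simp
    finally show ?thesis .
  qed
  hence "wnorm \<theta> Q \<le> (\<Sum>\<alpha> | mdeg (\<alpha> :: 'v \<Rightarrow> nat) \<le> Suc M. 64 / r\<^sup>2 * C * B\<^sup>2 * (1/2) ^ mdeg \<alpha>)"
    unfolding Q_def by (intro order_trans[OF weight_sum_le[OF w]] sum_mono)
  also have "\<dots> \<le> 64 / r\<^sup>2 * C * B\<^sup>2 * 2 ^ CARD('v)"
    unfolding sum_distrib_left[symmetric] using C by (intro mult_left_mono sum_geometric_mdeg_le) auto
  finally show ?thesis using 1 2 that by (simp add: mult_ac)
qed

section \<open>Substitution into generalized power series\<close>

declare add_2_eq_Suc' [simp del] \<comment> \<open>keeps \<open>n + 2\<close> as in the assumption on \<open>coord\<close>\<close>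

text \<open>Exactness up to real part \<open>T\<close>. Both supports lie in the closed right
  half-plane, so a coefficient of a product up to \<open>T\<close> involves only coefficients of the
  factors up to \<open>T\<close>; this makes the relation compatible with products.\<close>

definition approx :: "real \<Rightarrow> gps \<Rightarrow> fgps \<Rightarrow> bool" where
  "approx T a p \<longleftrightarrow> (\<forall>l. Re l \<le> T \<longrightarrow> a l = lookup p l) \<and> (\<forall>l. a l \<noteq> 0 \<longrightarrow> 0 \<le> Re l) \<and> re_ge 0 p"

lemma approx_mult:
  assumes "approx T a p" "approx T b r"
  shows "approx T (gps_mult a b) (p * r)"
proof -
  have a: "a l = lookup p l" "a l \<noteq> 0 \<Longrightarrow> 0 \<le> Re l" and b: "b l = lookup r l" "b l \<noteq> 0 \<Longrightarrow> 0 \<le> Re l"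
    if "Re l \<le> T" for l using assms that by (auto simp: approx_def)
  have a0: "a l \<noteq> 0 \<Longrightarrow> 0 \<le> Re l" and b0: "b l \<noteq> 0 \<Longrightarrow> 0 \<le> Re l" for l
    using assms by (auto simp: approx_def)
  have p0: "re_ge 0 p" "re_ge 0 r" using assms by (auto simp: approx_def)
  have "gps_mult a b l = lookup (p * r) l" if l: "Re l \<le> T" for l
  proof -
    have "gps_mult a b l = (\<Sum>s | a s \<noteq> 0 \<and> b (l - s) \<noteq> 0. lookup p s * lookup r (l - s))"
      unfolding gps_mult_def
    proof (rule sum.cong)
      fix s assume "s \<in> {s. a s \<noteq> 0 \<and> b (l - s) \<noteq> 0}"
      hence "0 \<le> Re s" "0 \<le> Re (l - s)" using a0[of s] b0[of "l - s"] by auto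
      hence "Re s \<le> T" "Re (l - s) \<le> T" using l by auto
      thus "a s * b (l - s) = lookup p s * lookup r (l - s)" using a b by simp
    qed simp
    also have "\<dots> = (\<Sum>s\<in>keys p. lookup p s * lookup r (l - s))"
    proof (rule sum.mono_neutral_left)
      show "{s. a s \<noteq> 0 \<and> b (l - s) \<noteq> 0} \<subseteq> keys p"
      proof safe
        fix s assume s: "a s \<noteq> 0" "b (l - s) \<noteq> 0"
        hence "Re s \<le> T" using b0[of "l - s"] l by simp
        thus "s \<in> keys p" using a s by (simp add: in_keys_iff)
      qed
      show "\<forall>s\<in>keys p - {s. a s \<noteq> 0 \<and> b (l - s) \<noteq> 0}. lookup p s * lookup r (l - s) = 0"
      proof
        fix s assume s: "s \<in> keys p - {s. a s \<noteq> 0 \<and> b (l - s) \<noteq> 0}"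
        have s0: "0 \<le> Re s" using s p0 by (auto simp: re_ge_def)
        show "lookup p s * lookup r (l - s) = 0"
        proof (cases "Re (l - s) < 0")
          case True
          thus ?thesis using re_geD[OF p0(2)] by simp
        next
          case False
          thus ?thesis using s s0 l a(1)[of s] b(1)[of "l - s"] by (auto simp: in_keys_iff)
        qed
      qed
    qed auto
    also have "\<dots> = lookup (p * r) l" by (rule lookup_mult_sum[symmetric]) auto
    finally show ?thesis .
  qed
  moreover have "0 \<le> Re l" if "gps_mult a b l \<noteq> 0" for l
  proof -
    have "{s. a s \<noteq> 0 \<and> b (l - s) \<noteq> 0} \<noteq> {}"
      using that unfolding gps_mult_def by (intro notI) (simp only: sum.empty)
    then obtain s where "a s \<noteq> 0" "b (l - s) \<noteq> 0" by blast
    thus ?thesis using a0[of s] b0[of "l - s"] by simp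
  qed
  ultimately show ?thesis using re_ge_mult[OF p0] by (simp add: approx_def)
qed

lemma approx_one: "approx T (gps_monom 1 0) 1"
  by (auto simp: approx_def gps_monom_def lookup_one when_def re_ge_one)

lemma approx_power: "approx T a p \<Longrightarrow> approx T (gps_power a m) (p ^ m)"
  unfolding gps_power_def by (induction m) (auto intro: approx_mult approx_one)

lemma approx_foldr:
  assumes "\<And>k. k \<in> set ks \<Longrightarrow> approx T (s k) (z k)"
  shows "approx T (foldr (\<lambda>k. gps_mult (gps_power (s k) (m k))) ks (gps_monom 1 0))
           (\<Prod>k\<leftarrow>ks. z k ^ m k)"
  using assms by (induction ks) (auto intro: approx_mult approx_one approx_power)

text \<open>A monomial of degree above \<open>M\<close> starts at real part \<delta> (M + 1) > T or
  later, so the finitely many terms of degree at most \<open>M\<close> give the coefficient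
  exactly.\<close>

lemma gps_subst_approx:
  fixes coord :: "nat \<Rightarrow> 'v::finite"
  assumes coord: "bij_betw coord {..<N} UNIV"
    and ap: "\<And>k. k < N \<Longrightarrow> approx T (s k) (z (coord k))"
    and z: "\<And>i. re_ge \<delta> (z i)" and M: "T < \<delta> * real (Suc M)" and \<delta>: "0 \<le> \<delta>" and l: "Re l \<le> T"
  shows "gps_subst N coord F s l = lookup (peval (taylor_coeff N coord F) M z) l"
proof -
  define P where "P = (\<lambda>\<alpha>. foldr (\<lambda>k. gps_mult (gps_power (s k) (\<alpha> (coord k)))) [0..<N] (gps_monom 1 0))"
  let ?t = "taylor_coeff N coord F"
  have P: "P \<alpha> l = lookup (mon z \<alpha>) l" for \<alpha>
  proof -
    have "approx T (P \<alpha>) (\<Prod>k\<leftarrow>[0..<N]. z (coord k) ^ \<alpha> (coord k))"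
      unfolding P_def using ap by (intro approx_foldr) auto
    also have "(\<Prod>k\<leftarrow>[0..<N]. z (coord k) ^ \<alpha> (coord k)) = (\<Prod>k\<in>{..<N}. z (coord k) ^ \<alpha> (coord k))"
      by (simp add: interv_sum_list_conv_sum_set_nat prod.distinct_set_conv_list[symmetric] atLeast0LessThan)
    also have "\<dots> = mon z \<alpha>" unfolding mon_def by (rule prod.reindex_bij_betw[OF coord])
    finally show ?thesis using l by (simp add: approx_def)
  qed
  have big: "lookup (mon z \<alpha>) l = 0" if "M < mdeg \<alpha>" for \<alpha>
  proof (rule re_geD[OF re_ge_mon[OF z]])
    have "\<delta> * real (Suc M) \<le> \<delta> * real (mdeg \<alpha>)" using that \<delta> by (intro mult_left_mono) auto
    thus "Re l < \<delta> * real (mdeg \<alpha>)" using M l by linarith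
  qed
  have "gps_subst N coord F s l = (\<Sum>\<alpha> | ?t \<alpha> * P \<alpha> l \<noteq> 0. ?t \<alpha> * P \<alpha> l)"
    by (simp add: gps_subst_def P_def Let_def)
  also have "\<dots> = (\<Sum>\<alpha> | mdeg \<alpha> \<le> M. ?t \<alpha> * P \<alpha> l)"
    using big by (intro sum.mono_neutral_left) (auto simp: P not_le[symmetric])
  also have "\<dots> = lookup (peval ?t M z) l"
    by (simp add: peval_def lookup_sum lookup_single_mult P)
  finally show ?thesis .
qed

text \<open>\<sigma>^j applied to the partial sum of the series over the indices in
  \<open>A\<close>.\<close>

definition ser :: "complex \<Rightarrow> (nat \<Rightarrow> complex) \<Rightarrow> (nat \<Rightarrow> complex) \<Rightarrow> nat \<Rightarrow> nat set \<Rightarrow> fgps" where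
  "ser lq c lam j A = (\<Sum>k\<in>A. single (lam k) (exp (of_nat j * lam k * lq) * c k))"

text \<open>The argument tuple (x, y_0, y_1, ...) placed at the positions prescribed by
  \<open>coord\<close>, with the same shift by one as in \<open>q_subst\<close>.\<close>

definition qvars :: "nat \<Rightarrow> (nat \<Rightarrow> 'v) \<Rightarrow> fgps \<Rightarrow> (nat \<Rightarrow> fgps) \<Rightarrow> 'v \<Rightarrow> fgps" where
  "qvars N coord x y i = (case inv_into {..<N} coord i of 0 \<Rightarrow> x | Suc j \<Rightarrow> y j)"

lemma qvars_coord:
  assumes "bij_betw coord {..<N} (UNIV :: 'v set)" "k < N"
  shows "qvars N coord x y (coord k) = (case k of 0 \<Rightarrow> x | Suc j \<Rightarrow> y j)"
  using assms by (simp add: qvars_def bij_betw_def inv_into_f_f)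

lemma coord_cases:
  assumes "bij_betw coord {..<n + 2} (UNIV :: 'v set)"
  obtains "i = coord 0" | j where "j \<le> n" "i = coord (Suc j)"
proof -
  have "i \<in> coord ` {..<n + 2}" using assms by (simp add: bij_betw_def)
  then obtain k where "k < n + 2" "i = coord k" by auto
  thus ?thesis using that by (cases k) (auto simp: less_Suc_eq_le)
qed

lemma qvars_all:
  assumes "bij_betw coord {..<n + 2} (UNIV :: 'v set)" "P x" "\<And>j. j \<le> n \<Longrightarrow> P (y j)"
  shows "P (qvars (n + 2) coord x y i)"
  using coord_cases[OF assms(1), of i] assms(2,3) by cases (auto simp: qvars_coord[OF assms(1)])

text \<open>A perturbation of the series leaves the variable x fixed, hence the 0 in its slot, and
  only the derivatives with respect to the y_j remain.\<close>

lemma sum_qvars: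
  fixes coord :: "nat \<Rightarrow> 'v::finite"
  assumes "bij_betw coord {..<n + 2} (UNIV :: 'v set)"
  shows "(\<Sum>i\<in>UNIV. g i * qvars (n + 2) coord 0 y i) = (\<Sum>j\<le>n. g (coord (Suc j)) * y j :: fgps)"
proof -
  have "(\<Sum>i\<in>UNIV. g i * qvars (n + 2) coord 0 y i) =
      (\<Sum>k<n + 2. g (coord k) * qvars (n + 2) coord 0 y (coord k))"
    by (rule sum.reindex_bij_betw[OF assms, symmetric])
  also have "\<dots> = (\<Sum>k<n + 2. g (coord k) * (case k of 0 \<Rightarrow> 0 | Suc j \<Rightarrow> y j))"
    by (intro sum.cong) (auto simp: qvars_coord[OF assms])
  also have "\<dots> = (\<Sum>k<Suc (Suc n). g (coord k) * (case k of 0 \<Rightarrow> 0 | Suc j \<Rightarrow> y j))"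
    by (simp add: add_2_eq_Suc')
  also have "\<dots> = (\<Sum>j<Suc n. g (coord (Suc j)) * y j)"
    by (subst sum.lessThan_Suc_shift) simp
  finally show ?thesis by (simp only: lessThan_Suc_atMost)
qed

lemma lookup_ser:
  assumes "inj lam" "finite A"
  shows "lookup (ser lq c lam j A) (lam k) = (if k \<in> A then exp (of_nat j * lam k * lq) * c k else 0)"
proof -
  have "lookup (ser lq c lam j A) (lam k) =
     (\<Sum>i\<in>A. if k = i then exp (of_nat j * lam k * lq) * c k else 0)"
    unfolding ser_def lookup_sum using assms(1)
    by (intro sum.cong refl) (auto simp: lookup_single when_def inj_eq)
  thus ?thesis using assms by simp
qed

lemma keys_ser: "keys (ser lq c lam j A) \<subseteq> lam ` A"
proof
  fix l assume "l \<in> keys (ser lq c lam j A)"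
  hence "(\<Sum>k\<in>A. lookup (single (lam k) (exp (of_nat j * lam k * lq) * c k)) l) \<noteq> 0"
    by (simp add: ser_def in_keys_iff lookup_sum)
  then obtain k where "k \<in> A" "lookup (single (lam k) (exp (of_nat j * lam k * lq) * c k)) l \<noteq> 0"
    by (meson sum.neutral)
  thus "l \<in> lam ` A" by (auto simp: lookup_single when_def split: if_splits)
qed

lemma re_ge_ser: "(\<And>k. k \<in> A \<Longrightarrow> v \<le> Re (lam k)) \<Longrightarrow> re_ge v (ser lq c lam j A)"
  using keys_ser[of lq c lam j A] by (auto simp: re_ge_def)

lemma gps_sigma_funpow: "(gps_sigma lq ^^ j) a l = exp (of_nat j * l * lq) * a l"
proof (induction j)
  case (Suc j)
  have "exp (of_nat (Suc j) * l * lq) = exp (l * lq) * exp (of_nat j * l * lq)"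
    by (simp add: exp_add[symmetric] distrib_right)
  thus ?case using Suc by (simp add: gps_sigma_def)
qed simp

lemma gps_of_lam: "inj lam \<Longrightarrow> gps_of c lam (lam k) = c k"
proof -
  assume "inj lam"
  hence "{i. lam i = lam k} = {k}" by (auto simp: inj_eq)
  thus ?thesis by (simp add: gps_of_def)
qed

lemma gps_of_not_range: "l \<notin> range lam \<Longrightarrow> gps_of c lam l = 0"
  by (auto simp: gps_of_def intro!: sum.neutral)

lemma gps_exponents_ge: "gps_exponents lam \<Longrightarrow> Re (lam 0) \<le> Re (lam k)"
  by (auto simp: gps_exponents_def mono_def)

lemma approx_ser:
  assumes lam: "gps_exponents lam" and m: "\<And>k. m \<le> k \<Longrightarrow> T < Re (lam k)"
  shows "approx T ((gps_sigma lq ^^ j) (gps_of c lam)) (ser lq c lam j {..<m})"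
proof -
  have inj: "inj lam" and pos: "0 < Re (lam k)" for k
    using lam gps_exponents_ge[OF lam, of k] by (auto simp: gps_exponents_def)
  have "(gps_sigma lq ^^ j) (gps_of c lam) l = lookup (ser lq c lam j {..<m}) l" if l: "Re l \<le> T" for l
  proof (cases "l \<in> range lam")
    case True
    then obtain k where k: "l = lam k" by auto
    have "k < m" using m[of k] l k by (meson leD not_le_imp_less)
    thus ?thesis using k by (simp add: gps_sigma_funpow gps_of_lam[OF inj] lookup_ser[OF inj])
  next
    case False
    hence "l \<notin> keys (ser lq c lam j {..<m})" using keys_ser[of lq c lam j "{..<m}"] by auto
    thus ?thesis using False by (simp add: gps_sigma_funpow gps_of_not_range in_keys_iff)
  qed
  moreover have "0 \<le> Re l" if "(gps_sigma lq ^^ j) (gps_of c lam) l \<noteq> 0" for l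
    using that pos gps_of_not_range[of l lam c] by (force simp: gps_sigma_funpow intro: less_imp_le)
  moreover have "re_ge 0 (ser lq c lam j {..<m})"
    using pos by (intro re_ge_ser) (auto intro: less_imp_le)
  ultimately show ?thesis by (simp add: approx_def)
qed

text \<open>The order \<open>min 1 (Re (lam 0))\<close> is common to the variable x and to the
  series.\<close>

lemma q_subst_approx:
  fixes coord :: "nat \<Rightarrow> 'v::finite"
  assumes coord: "bij_betw coord {..<n + 2} UNIV" and lam: "gps_exponents lam"
    and m: "\<And>k. m \<le> k \<Longrightarrow> T < Re (lam k)" and M: "T < min 1 (Re (lam 0)) * real (Suc M)"
    and l: "Re l \<le> T"
  shows "q_subst n coord lq F (gps_of c lam) l =
    lookup (peval (taylor_coeff (n + 2) coord F) M
      (qvars (n + 2) coord (single 1 1) (\<lambda>j. ser lq c lam j {..<m}))) l"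
  unfolding q_subst_def
proof (rule gps_subst_approx[OF coord _ _ M _ l])
  fix k assume k: "k < n + 2"
  show "approx T (case k of 0 \<Rightarrow> gps_monom 1 1 | Suc j \<Rightarrow> (gps_sigma lq ^^ j) (gps_of c lam))
      (qvars (n + 2) coord (single 1 1) (\<lambda>j. ser lq c lam j {..<m}) (coord k))"
  proof (cases k)
    case 0
    thus ?thesis
      by (auto simp: qvars_coord[OF coord] approx_def gps_monom_def lookup_single when_def
          intro: re_ge_single)
  next
    case (Suc j)
    thus ?thesis using k by (simp add: qvars_coord[OF coord] approx_ser[OF lam m])
  qed
next
  show "re_ge (min 1 (Re (lam 0))) (qvars (n + 2) coord (single 1 1) (\<lambda>j. ser lq c lam j {..<m}) i)" for i
  proof (rule qvars_all[OF coord])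
    show "re_ge (min 1 (Re (lam 0))) (ser lq c lam j {..<m})" for j
      using gps_exponents_ge[OF lam] by (intro re_ge_ser) (auto intro: min.coboundedI2)
  qed (auto intro: re_ge_single)
  show "0 \<le> min 1 (Re (lam 0))" using lam by (auto simp: gps_exponents_def)
qed

section \<open>Derivations given by additive functions of the exponent\<close>

definition pder :: "(complex \<Rightarrow> complex) \<Rightarrow> fgps \<Rightarrow> fgps" where
  "pder \<psi> p = (\<Sum>l\<in>keys p. single l (\<psi> l * lookup p l))"

lemma lookup_pder: "lookup (pder \<psi> p) l = \<psi> l * lookup p l"
proof -
  have "lookup (pder \<psi> p) l = (\<Sum>s\<in>keys p. if l = s then \<psi> l * lookup p l else 0)"
    unfolding pder_def lookup_sum by (intro sum.cong refl) (auto simp: lookup_single when_def)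
  thus ?thesis by (auto simp: in_keys_iff)
qed

lemma pder_add: "pder \<psi> (p + r) = pder \<psi> p + pder \<psi> r"
  by (rule poly_mapping_eqI) (simp add: lookup_pder lookup_add algebra_simps)

lemma pder_zero [simp]: "pder \<psi> 0 = 0"
  by (rule poly_mapping_eqI) (simp add: lookup_pder)

lemma pder_sum: "pder \<psi> (sum f A) = (\<Sum>i\<in>A. pder \<psi> (f i))"
  by (induction A rule: infinite_finite_induct) (auto simp: pder_add)

lemma pder_single: "pder \<psi> (single s c) = single s (\<psi> s * c)"
  by (rule poly_mapping_eqI) (simp add: lookup_pder lookup_single when_def)

lemma pder_mult:
  assumes "\<And>s t. \<psi> (s + t) = \<psi> s + \<psi> t"
  shows "pder \<psi> (p * r) = pder \<psi> p * r + p * pder \<psi> r"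
proof (rule poly_mapping_eqI)
  fix l
  have k: "keys (pder \<psi> p) \<subseteq> keys p" by (auto simp: in_keys_iff lookup_pder)
  have *: "\<psi> l = \<psi> s + \<psi> (l - s)" for s using assms[of s "l - s"] by simp
  have "\<psi> l * (lookup p s * lookup r (l - s)) =
     \<psi> s * lookup p s * lookup r (l - s) + lookup p s * (\<psi> (l - s) * lookup r (l - s))" for s
    by (subst *[of s]) (simp add: algebra_simps)
  thus "lookup (pder \<psi> (p * r)) l = lookup (pder \<psi> p * r + p * pder \<psi> r) l"
    by (simp add: lookup_pder lookup_add lookup_mult_sum[OF finite_keys k]
        lookup_mult_sum[of "keys p" p] sum_distrib_left sum.distrib)
qed

lemma pder_mon:
  assumes add: "\<And>s t. \<psi> (s + t) = \<psi> s + \<psi> t"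
  shows "pder \<psi> (mon z \<alpha>) = dmon z (\<lambda>i. pder \<psi> (z i)) \<alpha>"
proof (induction \<alpha> rule: mdeg_induct)
  case zero
  have "\<psi> 0 = 0" using add[of 0 0] by simp
  hence "pder \<psi> 1 = 0" unfolding single_one[symmetric] pder_single by simp
  thus ?case by simp
qed (simp add: pder_mult[OF add] dmon_incr)

lemma pder_peval:
  assumes add: "\<And>s t. \<psi> (s + t) = \<psi> s + \<psi> t"
  shows "pder \<psi> (peval f (Suc M) z) = (\<Sum>i\<in>UNIV. peval (dcoeff i f) M z * pder \<psi> (z i))"
proof -
  have "\<psi> 0 = 0" using add[of 0 0] by simp
  hence "pder \<psi> (single 0 a * p) = single 0 a * pder \<psi> p" for a p
    by (simp add: pder_mult[OF add] pder_single)
  thus ?thesis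
    unfolding peval_dmon_sum[symmetric] by (simp add: peval_def pder_sum pder_mon[OF add])
qed

section \<open>The majorant estimate\<close>

text \<open>With the zero weight the norm conditions in the Taylor lemmas hold trivially, and only their
  algebraic content remains.\<close>

lemma weight_zero: "weight (\<lambda>_. 0)"
  by (simp add: weight_def)

definition rweight :: "real \<Rightarrow> complex \<Rightarrow> real" where
  "rweight \<epsilon> l = \<epsilon> powr Re l"

lemma weight_rweight: "0 < \<epsilon> \<Longrightarrow> weight (rweight \<epsilon>)"
  by (simp add: weight_def rweight_def powr_add)

lemma rweight_nonneg [simp]: "0 \<le> rweight \<epsilon> l"
  by (simp add: rweight_def)

text \<open>Lets one fix a radius \<open>\<epsilon>0\<close> at which the data are bounded and then
  make those of positive order small by shrinking \<open>\<epsilon>\<close>.\<close>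

lemma wnorm_rweight_scale:
  assumes "re_ge d p" "0 < \<epsilon>" "\<epsilon> \<le> \<epsilon>0"
  shows "wnorm (rweight \<epsilon>) p \<le> (\<epsilon> / \<epsilon>0) powr d * wnorm (rweight \<epsilon>0) p"
proof -
  have "wnorm (rweight \<epsilon>) p \<le> wnorm (\<lambda>l. (\<epsilon> / \<epsilon>0) powr d * rweight \<epsilon>0 l) p"
  proof (rule wnorm_mono)
    fix l assume "l \<in> keys p"
    hence d: "d \<le> Re l" using assms by (simp add: re_ge_def)
    have "rweight \<epsilon> l = (\<epsilon> / \<epsilon>0) powr Re l * rweight \<epsilon>0 l"
      using assms by (simp add: rweight_def powr_divide)
    also have "\<dots> \<le> (\<epsilon> / \<epsilon>0) powr d * rweight \<epsilon>0 l"
      using assms d by (intro mult_right_mono powr_mono') auto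
    finally show "rweight \<epsilon> l \<le> (\<epsilon> / \<epsilon>0) powr d * rweight \<epsilon>0 l" .
  qed
  also have "\<dots> = (\<epsilon> / \<epsilon>0) powr d * wnorm (rweight \<epsilon>0) p"
    by (simp add: wnorm_def sum_distrib_left mult_ac)
  finally show ?thesis .
qed

lemma wnorm_rweight_single_mult:
  assumes "0 < \<epsilon>"
  shows "wnorm (rweight \<epsilon>) (single s c * p) \<le> cmod c * \<epsilon> powr Re s * wnorm (rweight \<epsilon>) p"
proof -
  have "wnorm (rweight \<epsilon>) (single s c * p) \<le> wnorm (rweight \<epsilon>) (single s c) * wnorm (rweight \<epsilon>) p"
    by (rule wnorm_mult_le) (simp_all add: rweight_def powr_add)
  thus ?thesis by (simp add: wnorm_single rweight_def)
qed

abbreviation "rnorm \<epsilon> \<equiv> wnorm (rweight \<epsilon>)"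

section \<open>The equation evaluated on partial sums of the series\<close>

locale q_equation =
  fixes n :: nat and coord :: "nat \<Rightarrow> 'v::finite" and F :: "complex ^ 'v \<Rightarrow> complex"
    and lq \<nu> :: complex and c lam A :: "nat \<Rightarrow> complex"
  assumes coord: "bij_betw coord {..<n + 2} UNIV"
    and holo: "holomorphic_near_0 F"
    and lam: "gps_exponents lam"
    and eq0: "q_subst n coord lq F (gps_of c lam) = (\<lambda>l. 0)"
    and deriv: "\<forall>j\<le>n. \<exists>h\<in>gps_little_o \<nu>.
           q_subst n coord lq (cpartial (coord (Suc j)) F) (gps_of c lam)
             = (\<lambda>l. gps_monom (A j) \<nu> l + h l)"
    and A_nonzero: "\<exists>j\<le>n. A j \<noteq> 0"
begin

definition tc :: "('v \<Rightarrow> nat) \<Rightarrow> complex" where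
  "tc = taylor_coeff (n + 2) coord F"

definition dtc :: "nat \<Rightarrow> ('v \<Rightarrow> nat) \<Rightarrow> complex" where
  "dtc j = dcoeff (coord (Suc j)) tc"

abbreviation Fy :: "nat \<Rightarrow> gps" where
  "Fy j \<equiv> q_subst n coord lq (cpartial (coord (Suc j)) F) (gps_of c lam)"

text \<open>The divisor L(q^\<lambda>) at \<lambda> = \<open>lam k\<close>.\<close>

definition Lq :: "nat \<Rightarrow> complex" where
  "Lq k = (\<Sum>j\<le>n. A j * exp (of_nat j * lam k * lq))"

text \<open>The point (x, \<phi>_K, \<sigma> \<phi>_K, ...), where \<phi>_K consists of the terms
  with index below \<open>K\<close>.\<close>

definition V :: "nat \<Rightarrow> 'v \<Rightarrow> fgps" where
  "V K = qvars (n + 2) coord (single 1 1) (\<lambda>j. ser lq c lam j {..<K})"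

abbreviation qv :: "fgps \<Rightarrow> (nat \<Rightarrow> fgps) \<Rightarrow> 'v \<Rightarrow> fgps" where
  "qv \<equiv> qvars (n + 2) coord"

lemma inj_lam: "inj lam"
  using lam by (simp add: gps_exponents_def)

lemma Re_lam_mono: "i \<le> k \<Longrightarrow> Re (lam i) \<le> Re (lam k)"
  using lam by (auto simp: gps_exponents_def mono_def)

lemma Re_lam_pos: "0 < Re (lam k)"
  using lam Re_lam_mono[of 0 k] by (auto simp: gps_exponents_def)

lemma Re_lam_large: "\<exists>m. \<forall>k\<ge>m. T < Re (lam k)"
  using lam by (auto simp: gps_exponents_def filterlim_at_top_dense eventually_sequentially)

lemma dtc_taylor: "dtc j = taylor_coeff (n + 2) coord (cpartial (coord (Suc j)) F)"
proof -
  obtain R where R: "R > 0" "sep_holomorphic R F"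
    using holomorphic_near_0_imp_sep_holomorphic[OF holo] .
  show ?thesis
    by (rule ext) (simp add: dtc_def dcoeff_def tc_def incr_def taylor_coeff_cpartial[OF R(2,1) coord] del: of_nat_Suc)
qed

lemma coeff_bounds:
  obtains C r where "0 \<le> C" "0 < r" "\<And>\<alpha>. cmod (tc \<alpha>) \<le> C / r ^ mdeg \<alpha>"
    "\<And>j \<alpha>. j \<le> n \<Longrightarrow> cmod (dtc j \<alpha>) \<le> C / r ^ mdeg \<alpha>"
proof -
  obtain R where R: "R > 0" "sep_holomorphic R F"
    using holomorphic_near_0_imp_sep_holomorphic[OF holo] .
  have r: "0 < R / 2" "R / 2 < R" using R by auto
  have "\<exists>M\<ge>0. \<forall>\<alpha>. cmod (taylor_coeff (n + 2) coord G \<alpha>) \<le> M / (R / 2) ^ mdeg \<alpha>"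
    if "sep_holomorphic R G" for G :: "complex ^ 'v \<Rightarrow> complex"
    using taylor_coeff_bound[OF that coord r] unfolding mdeg_def by metis
  note bound = this
  obtain M where M: "M \<ge> 0" "\<And>\<alpha>. cmod (tc \<alpha>) \<le> M / (R / 2) ^ mdeg \<alpha>"
    using bound[OF R(2)] unfolding tc_def by blast
  have "\<forall>j. \<exists>M. M \<ge> 0 \<and> (\<forall>\<alpha>. cmod (dtc j \<alpha>) \<le> M / (R / 2) ^ mdeg \<alpha>)"
    using bound[OF sep_holomorphic_cpartial[OF R(2)]] unfolding dtc_taylor by blast
  then obtain M' where M': "\<And>j. M' j \<ge> 0" "\<And>j \<alpha>. cmod (dtc j \<alpha>) \<le> M' j / (R / 2) ^ mdeg \<alpha>"
    by metis
  define C where "C = M + (\<Sum>j\<le>n. M' j)"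
  have "0 \<le> (\<Sum>j\<le>n. M' j)" using M' by (intro sum_nonneg) auto
  hence "M \<le> C" "0 \<le> C" using M by (auto simp: C_def)
  moreover have "M' j \<le> C" if "j \<le> n" for j
    using member_le_sum[of j "{..n}" M'] M' M that by (simp add: C_def)
  ultimately show ?thesis
    using r M M' by (intro that[of C "R / 2"] order_trans[OF M(2)] order_trans[OF M'(2)] divide_right_mono) auto
qed

text \<open>Bridge from the formal substitution to finite sums: up to a fixed real part, all
  sufficiently long truncations, in the degree and in the series, already give the exact
  coefficients.\<close>

lemma eval_V:
  "\<exists>M0. \<exists>m0. \<forall>m\<ge>m0. \<forall>M\<ge>M0. \<forall>l. Re l \<le> T \<longrightarrow> lookup (peval tc M (V m)) l = 0 \<and>
     (\<forall>j. lookup (peval (dtc j) M (V m)) l =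
        Fy j l)"
proof -
  obtain m0 where m0: "\<And>k. m0 \<le> k \<Longrightarrow> T < Re (lam k)" using Re_lam_large[of T] by blast
  define \<delta> where "\<delta> = min 1 (Re (lam 0))"
  have \<delta>: "\<delta> > 0" using Re_lam_pos[of 0] by (simp add: \<delta>_def)
  obtain M0 where M0: "T / \<delta> < real M0" using reals_Archimedean2 by blast
  have M: "T < \<delta> * real (Suc M)" if "M0 \<le> M" for M
  proof -
    have "T < \<delta> * real M0" using M0 \<delta> by (simp add: field_simps)
    also have "\<dots> \<le> \<delta> * real (Suc M)" using that \<delta> by (intro mult_left_mono) auto
    finally show ?thesis .
  qed
  show ?thesis
  proof (rule exI[of _ M0], rule exI[of _ m0], intro allI impI conjI)
    fix m M l assume a: "m0 \<le> m" "M0 \<le> M" "Re l \<le> T"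
    have mm: "\<And>k. m \<le> k \<Longrightarrow> T < Re (lam k)" using m0 a by simp
    note q = q_subst_approx[OF coord lam mm M[OF a(2), unfolded \<delta>_def] a(3), where lq = lq and c = c]
    show "lookup (peval tc M (V m)) l = 0"
      using q[where F = F] by (simp add: eq0 tc_def V_def)
    show "lookup (peval (dtc j) M (V m)) l =
        Fy j l" for j
      using q[where F = "cpartial (coord (Suc j)) F"] by (simp add: dtc_taylor V_def)
  qed
qed

lemma re_ge_V: "re_ge 0 (V K i)"
  unfolding V_def
  by (rule qvars_all[OF coord]) (auto intro!: re_ge_single re_ge_ser less_imp_le Re_lam_pos)

text \<open>\<nu> occurs as an exponent in some F'_{y_j}(x, \<phi>, ...), and substitution produces
  only exponents in the closed right half-plane.\<close>

lemma Re_\<nu>_nonneg: "0 \<le> Re \<nu>"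
proof -
  obtain j where j: "j \<le> n" "A j \<noteq> 0" using A_nonzero by blast
  obtain h where h: "h \<in> gps_little_o \<nu>" and
    q: "Fy j = (\<lambda>l. gps_monom (A j) \<nu> l + h l)"
    using deriv j by blast
  obtain m M where "lookup (peval (dtc j) M (V m)) \<nu> =
        Fy j \<nu>"
    using eval_V[of "Re \<nu>"] by blast
  also have "\<dots> = A j" using h by (auto simp: q gps_monom_def gps_little_o_def)
  finally have "lookup (peval (dtc j) M (V m)) \<nu> \<noteq> 0" using j by simp
  thus ?thesis using re_ge_peval[of "V m" "dtc j" M, OF re_ge_V]
    by (auto simp: re_ge_def in_keys_iff)
qed

text \<open>Only finitely many exponents of the remainders have real part at most Re \<nu> + 1, so
  their least distance from Re \<nu> is positive.\<close>

lemma leading_gap: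
  obtains \<delta> where "0 < \<delta>" "\<And>j l. j \<le> n \<Longrightarrow> Re l < Re \<nu> + \<delta> \<Longrightarrow>
    Fy j l = (if l = \<nu> then A j else 0)"
proof -
  obtain h where h: "\<And>j. j \<le> n \<Longrightarrow> h j \<in> gps_little_o \<nu>"
    and q: "\<And>j. j \<le> n \<Longrightarrow> Fy j = (\<lambda>l. gps_monom (A j) \<nu> l + h j l)"
    using deriv by metis
  define X where "X = (\<Union>j\<le>n. {l. h j l \<noteq> 0 \<and> Re l \<le> Re \<nu> + 1})"
  have fin: "finite X" using h by (auto simp: X_def gps_little_o_def gps_ring_def)
  have X: "Re \<nu> < Re l" if "l \<in> X" for l using that h by (auto simp: X_def gps_little_o_def)
  define \<delta> where "\<delta> = Min (insert 1 ((\<lambda>l. Re l - Re \<nu>) ` X))"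
  have "0 < \<delta>" unfolding \<delta>_def using fin X by (subst Min_gr_iff) auto
  moreover have "h j l = 0" if "j \<le> n" "Re l < Re \<nu> + \<delta>" for j l
  proof (rule ccontr)
    assume "h j l \<noteq> 0"
    moreover have "\<delta> \<le> 1" unfolding \<delta>_def using fin by (intro Min_le) auto
    ultimately have "l \<in> X" using that by (auto simp: X_def)
    hence "\<delta> \<le> Re l - Re \<nu>" unfolding \<delta>_def using fin by (intro Min_le) auto
    thus False using that by simp
  qed
  ultimately show ?thesis using q by (intro that[of \<delta>]) (auto simp: gps_monom_def)
qed

lemma ser_split:
  assumes "N \<le> K"
  shows "ser lq c lam j {..<K} = ser lq c lam j {..<N} + ser lq c lam j {N..<K}"
proof -
  have "{..<K} = {..<N} \<union> {N..<K}" using assms by auto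
  hence "ser lq c lam j {..<K} = ser lq c lam j ({..<N} \<union> {N..<K})" by simp
  also have "\<dots> = ser lq c lam j {..<N} + ser lq c lam j {N..<K}"
    unfolding ser_def by (rule sum.union_disjoint) auto
  finally show ?thesis .
qed

lemma V_split:
  assumes "N \<le> K"
  shows "V K i = V N i + single v 1 * qv 0 (\<lambda>j. single (- v) 1 * ser lq c lam j {N..<K}) i"
proof -
  have *: "single v 1 * (single (- v) 1 * p) = p" for p :: fgps
    unfolding mult.assoc[symmetric] mult_single by simp
  show ?thesis using coord_cases[OF coord, of i]
    by cases (simp_all add: V_def qvars_coord[OF coord] ser_split[OF assms] *)
qed

lemma re_ge_shifted_ser:
  assumes "\<And>k. N \<le> k \<Longrightarrow> Re v \<le> Re (lam k)"
  shows "re_ge 0 (single (- v) 1 * ser lq c lam j {N..<K})"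
proof -
  have "re_ge (Re (- v) + Re v) (single (- v) 1 * ser lq c lam j {N..<K})"
    using assms by (intro re_ge_mult re_ge_single re_ge_ser) auto
  thus ?thesis by simp
qed

text \<open>The exponents of the tail have real part at least that of \<open>lam k\<close>, and up
  to real part Re \<nu> the only term of \<open>G\<close> is a x^\<nu>. Hence the exponent lam k +
  \<nu> can arise only from the term of the tail at \<open>lam k\<close>.\<close>

lemma lookup_ser_mult_leading:
  assumes G: "\<And>l. Re l \<le> Re \<nu> \<Longrightarrow> lookup G l = (if l = \<nu> then a else 0)" and k: "k \<le> K" "K < m"
  shows "lookup (ser lq d lam j {K..<m} * G) (lam k + \<nu>) =
     (if k = K then exp (of_nat j * lam k * lq) * d k * a else 0)"
proof -
  let ?l = "lam k + \<nu>"
  have "lookup (ser lq d lam j {K..<m} * G) ?l =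
     (\<Sum>s\<in>lam ` {K..<m}. lookup (ser lq d lam j {K..<m}) s * lookup G (?l - s))"
    by (rule lookup_mult_sum[OF _ keys_ser]) simp
  also have "\<dots> = (\<Sum>i\<in>{K..<m}. lookup (ser lq d lam j {K..<m}) (lam i) * lookup G (?l - lam i))"
    using inj_lam by (subst sum.reindex) (auto intro: inj_on_subset)
  also have "\<dots> = (\<Sum>i\<in>{K..<m}. if i = k then exp (of_nat j * lam k * lq) * d k * a else 0)"
  proof (intro sum.cong refl)
    fix i assume i: "i \<in> {K..<m}"
    have "Re (lam k) \<le> Re (lam i)" using i k Re_lam_mono by auto
    hence "lookup G (?l - lam i) = (if ?l - lam i = \<nu> then a else 0)" by (intro G) simp
    also have "?l - lam i = \<nu> \<longleftrightarrow> i = k" using inj_lam by (auto simp: inj_eq)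
    finally show "lookup (ser lq d lam j {K..<m}) (lam i) * lookup G (?l - lam i) =
        (if i = k then exp (of_nat j * lam k * lq) * d k * a else 0)"
      using i by (simp add: lookup_ser[OF inj_lam])
  qed
  also have "\<dots> = (if k = K then exp (of_nat j * lam k * lq) * d k * a else 0)" using k by auto
  finally show ?thesis .
qed

text \<open>The recursion for the coefficients: \<open>V K\<close> contains no coefficient from
  \<open>c K\<close> on, so the case k = K expresses Lq K c K through earlier ones. A long
  truncation \<open>V m\<close> gives 0, and going back from \<open>V m\<close> to
  \<open>V K\<close> contributes the linear term -L(q^\<lambda>) c. The quadratic remainder has
  order at least 2 Re (lam K), which lies beyond Re (lam K) + Re \<nu>.\<close>

lemma eval_truncation:
  assumes K: "Re \<nu> < Re (lam K)"
  shows "\<exists>M0. \<forall>M\<ge>M0. \<forall>k\<le>K. lookup (peval tc (Suc M) (V K)) (lam k + \<nu>) =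
           (if k = K then - Lq k * c k else 0)"
proof -
  obtain \<delta> where \<delta>: "0 < \<delta>" "\<And>j l. j \<le> n \<Longrightarrow> Re l < Re \<nu> + \<delta> \<Longrightarrow>
    Fy j l = (if l = \<nu> then A j else 0)"
    using leading_gap by blast
  obtain M0 m0 where Mm: "\<And>m M l. m0 \<le> m \<Longrightarrow> M0 \<le> M \<Longrightarrow> Re l \<le> Re (lam K) + Re \<nu> \<Longrightarrow>
      lookup (peval tc M (V m)) l = 0"
    "\<And>m M l j. m0 \<le> m \<Longrightarrow> M0 \<le> M \<Longrightarrow> Re l \<le> Re (lam K) + Re \<nu> \<Longrightarrow>
      lookup (peval (dtc j) M (V m)) l =
        Fy j l"
    using eval_V[of "Re (lam K) + Re \<nu>"] by blast
  define m where "m = max m0 (Suc K)"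
  \<comment> \<open>Factoring x^v out of the tail leaves exponents with nonnegative real part, as
    the Taylor formula requires.\<close>
  define v where "v = complex_of_real (Re (lam K))"
  have m: "m0 \<le> m" "K < m" by (auto simp: m_def)
  obtain C r where Cr: "0 \<le> C" "0 < r" "\<And>\<alpha>. cmod (tc \<alpha>) \<le> C / r ^ mdeg \<alpha>"
    using coeff_bounds by metis
  have "lookup (peval tc (Suc M) (V K)) (lam k + \<nu>) = (if k = K then - Lq k * c k else 0)"
    if M: "M0 \<le> M" and k: "k \<le> K" for M k
  proof -
    define b where "b j = - (single (- v) 1 * ser lq c lam j {K..<m})" for j
    have bge: "re_ge 0 (b j)" for j
      unfolding b_def using Re_lam_mono by (intro re_ge_uminus re_ge_shifted_ser) (auto simp: v_def)
    have VK: "V K i = V m i + single v 1 * qv 0 b i" for i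
    proof -
      have "qv 0 b i =
          - qv 0 (\<lambda>j. single (- v) 1 * ser lq c lam j {K..<m}) i"
        using coord_cases[OF coord, of i] by cases (auto simp: qvars_coord[OF coord] b_def)
      thus ?thesis using V_split[of K m i v] m by simp
    qed
    obtain Q where Q: "peval tc (Suc M) (V K) = peval tc (Suc M) (V m) +
        single v 1 * (\<Sum>i\<in>UNIV. peval (dcoeff i tc) M (V m) * qv 0 b i) +
        (single v 1)\<^sup>2 * Q" "re_ge 0 Q"
    proof (rule peval_taylor[OF weight_zero Cr(3,2,1), where a = "V m" and b = "qv 0 b"
          and z = "V K" and x = "single v 1" and B = 0 and M = M])
      show "re_ge 0 (qv 0 b i)" for i
        by (rule qvars_all[OF coord]) (auto intro: bge re_ge_zero)
      show "re_ge 0 (single v 1)" using Re_lam_pos[of K] by (intro re_ge_single) (simp add: v_def)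
    qed (use Cr VK in \<open>auto simp: wnorm_def intro: re_ge_V\<close>)
    let ?l = "lam k + \<nu>"
    have l: "Re ?l \<le> Re (lam K) + Re \<nu>" using Re_lam_mono[OF k] by simp
    have "single v 1 * (\<Sum>i\<in>UNIV. peval (dcoeff i tc) M (V m) * qv 0 b i) =
        (\<Sum>j\<le>n. - (ser lq c lam j {K..<m} * peval (dtc j) M (V m)))"
    proof -
      have "single v 1 * (p * b j) = - (ser lq c lam j {K..<m} * p)" for p j
      proof -
        have "single v 1 * (p * b j) = - (single v 1 * single (- v) 1) * ser lq c lam j {K..<m} * p"
          by (simp only: b_def mult_ac mult_minus_left mult_minus_right)
        thus ?thesis by (simp add: mult_single)
      qed
      thus ?thesis unfolding sum_qvars[OF coord] dtc_def by (simp add: sum_distrib_left)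
    qed
    hence "lookup (single v 1 * (\<Sum>i\<in>UNIV. peval (dcoeff i tc) M (V m) * qv 0 b i)) ?l =
        - (\<Sum>j\<le>n. lookup (ser lq c lam j {K..<m} * peval (dtc j) M (V m)) ?l)"
      by (simp add: lookup_sum sum_negf)
    also have "(\<Sum>j\<le>n. lookup (ser lq c lam j {K..<m} * peval (dtc j) M (V m)) ?l) =
        (\<Sum>j\<le>n. if k = K then exp (of_nat j * lam k * lq) * c k * A j else 0)"
    proof (intro sum.cong refl)
      fix j assume j: "j \<in> {..n}"
      show "lookup (ser lq c lam j {K..<m} * peval (dtc j) M (V m)) ?l =
         (if k = K then exp (of_nat j * lam k * lq) * c k * A j else 0)"
      proof (rule lookup_ser_mult_leading[OF _ k m(2)])
        fix l assume Re: "Re l \<le> Re \<nu>"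
        hence "Re l \<le> Re (lam K) + Re \<nu>" using Re_lam_pos[of K] by linarith
        hence "lookup (peval (dtc j) M (V m)) l =
          Fy j l"
          using Mm(2)[OF m(1) M] by blast
        thus "lookup (peval (dtc j) M (V m)) l = (if l = \<nu> then A j else 0)" using \<delta> j Re by auto
      qed
    qed
    also have "\<dots> = (if k = K then Lq k * c k else 0)"
      by (simp add: Lq_def sum_distrib_left mult_ac)
    finally have lin: "lookup (single v 1 * (\<Sum>i\<in>UNIV. peval (dcoeff i tc) M (V m) * qv 0 b i)) ?l
       = - (if k = K then Lq k * c k else 0)" .
    have "re_ge (2 * Re (lam K)) ((single v 1)\<^sup>2 * Q)"
    proof -
      have "re_ge (real 2 * Re v + 0) ((single v 1)\<^sup>2 * Q)"
        by (intro re_ge_mult re_ge_power re_ge_single Q) simp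
      thus ?thesis by (simp add: v_def)
    qed
    hence "lookup ((single v 1)\<^sup>2 * Q) ?l = 0"
      by (rule re_geD) (use l K in simp)
    thus ?thesis unfolding Q(1) lookup_add lin using Mm(1)[OF m(1) _ l, of "Suc M"] M by simp
  qed
  thus ?thesis by blast
qed


text \<open>Terms from index \<open>N\<close> on change every monomial by x^(Re (lam N)) times a
  series of nonnegative order, which cannot reach lower coefficients.\<close>

lemma eval_V_agree:
  assumes "N \<le> m" "Re l < Re (lam N)"
  shows "lookup (peval f M (V N)) l = lookup (peval f M (V m)) l"
proof -
  define v where "v = complex_of_real (Re (lam N))"
  let ?b = "qv 0 (\<lambda>j. single (- v) 1 * ser lq c lam j {N..<m})"
  have b: "re_ge 0 (?b i)" for i
    by (rule qvars_all[OF coord])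
      (use Re_lam_mono in \<open>auto intro!: re_ge_zero re_ge_shifted_ser simp: v_def\<close>)
  have x: "re_ge 0 (single v 1)" using Re_lam_pos[of N] by (intro re_ge_single) (simp add: v_def)
  have "\<exists>R. mon (V m) \<alpha> = mon (V N) \<alpha> + single v 1 * R \<and> re_ge 0 R" for \<alpha>
  proof -
    obtain Q where "mon (V m) \<alpha> = mon (V N) \<alpha> + single v 1 * dmon (V N) ?b \<alpha> + (single v 1)\<^sup>2 * Q"
      "re_ge 0 Q" "re_ge 0 (dmon (V N) ?b \<alpha>)"
      using mon_taylor[OF weight_zero, where a = "V N" and b = ?b and z = "V m" and x = "single v 1"
          and s = 0 and B = 0 and \<alpha> = \<alpha>] re_ge_V b V_split[OF assms(1)] x
      by (auto simp: wnorm_def)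
    thus ?thesis
      by (intro exI[of _ "dmon (V N) ?b \<alpha> + single v 1 * Q"])
        (auto simp: power2_eq_square algebra_simps intro!: re_ge_add re_ge_mult0 x)
  qed
  then obtain R where R: "\<And>\<alpha>. mon (V m) \<alpha> = mon (V N) \<alpha> + single v 1 * R \<alpha>" "\<And>\<alpha>. re_ge 0 (R \<alpha>)"
    by metis
  have "peval f M (V m) = peval f M (V N) + single v 1 * (\<Sum>\<alpha> | mdeg \<alpha> \<le> M. single 0 (f \<alpha>) * R \<alpha>)"
    unfolding peval_def sum_distrib_left sum.distrib[symmetric]
    by (intro sum.cong refl) (simp add: R algebra_simps)
  moreover have "re_ge (Re v + 0) (single v 1 * (\<Sum>\<alpha> | mdeg \<alpha> \<le> M. single 0 (f \<alpha>) * R \<alpha>))"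
    by (intro re_ge_mult re_ge_single re_ge_sum re_ge_mult0 R) auto
  ultimately show ?thesis
    using assms re_geD[of "Re v" "single v 1 * (\<Sum>\<alpha> | mdeg \<alpha> \<le> M. single 0 (f \<alpha>) * R \<alpha>)" l]
    by (simp add: lookup_add v_def)
qed

text \<open>Coefficientwise form of the equation
  \<open>L(\<sigma>) u = - x\<^bsup>- m0 - \<nu>\<^esup> F(\<phi>\<^sub>N) - \<Sum>\<^sub>j H\<^sub>j \<sigma>\<^sup>j u - x\<^bsup>m0 - \<nu>\<^esup> Q\<close> for the rescaled
  remainder \<open>u\<close> in \<open>\<phi> = \<phi>\<^sub>N + x\<^bsup>m0\<^esup> u\<close>, where \<open>Q\<close> is quadratic in \<open>u\<close>.\<close>

lemma normal_form:
  fixes m0 :: real and N :: nat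
  defines "\<mu> \<equiv> complex_of_real m0"
  defines "U \<equiv> \<lambda>K j. single (- \<mu>) 1 * ser lq c lam j {N..<K}"
  assumes m0: "Re \<nu> < m0" and N: "\<And>k. N \<le> k \<Longrightarrow> m0 < Re (lam k)" and NK: "N \<le> K"
    and Cr: "0 \<le> C" "0 < r" "\<And>\<alpha>. cmod (tc \<alpha>) \<le> C / r ^ mdeg \<alpha>"
    and gap: "0 < \<delta>" "\<delta> \<le> Re (lam N) - Re \<nu>" "\<And>j l. j \<le> n \<Longrightarrow> Re l < Re \<nu> + \<delta> \<Longrightarrow>
    Fy j l = (if l = \<nu> then A j else 0)"
    and \<theta>: "weight \<theta>" "\<And>i. wnorm \<theta> (V N i) \<le> r / 8" "\<And>i. wnorm \<theta> (V K i) \<le> r / 8"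
    and U: "\<And>j. j \<le> n \<Longrightarrow> wnorm \<theta> (U K j) \<le> 1"
  obtains M Q H where
    "\<And>k. k \<in> {N..K} \<Longrightarrow> Lq k * c k = - (lookup (peval tc (Suc M) (V N)) (lam k + \<nu>) +
        (\<Sum>j\<le>n. lookup (H j * U K j) (lam k - \<mu>)) + lookup (single (\<mu> - \<nu>) 1 * Q) (lam k - \<mu>))"
    "re_ge 0 Q" "wnorm \<theta> Q \<le> 64 / r\<^sup>2 * C * 2 ^ CARD('v)"
    "\<And>j. j \<le> n \<Longrightarrow> re_ge \<delta> (H j)"
    "\<And>j. H j = single (- \<nu>) 1 * peval (dtc j) M (V N) - single 0 (A j)"
    "\<And>j. re_ge 0 (U K j)"
proof -
  have Uge: "re_ge 0 (U K j)" for j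
    unfolding U_def using N by (intro re_ge_shifted_ser) (auto simp: \<mu>_def intro: less_imp_le)
  have "Re \<nu> < Re (lam K)" using m0 N[OF NK] by linarith
  from eval_truncation[OF this] obtain M1 where
    M1: "\<And>M k. M1 \<le> M \<Longrightarrow> k \<le> K \<Longrightarrow> lookup (peval tc (Suc M) (V K)) (lam k + \<nu>) =
           (if k = K then - Lq k * c k else 0)" by blast
  obtain M2 m2 where M2: "\<And>m M l j. m2 \<le> m \<Longrightarrow> M2 \<le> M \<Longrightarrow> Re l \<le> Re \<nu> + \<delta> \<Longrightarrow>
      lookup (peval (dtc j) M (V m)) l =
        Fy j l"
    using eval_V[of "Re \<nu> + \<delta>"] by blast
  define M where "M = max M1 M2"
  define m where "m = max m2 N"
  have M: "M1 \<le> M" "M2 \<le> M" and m: "m2 \<le> m" "N \<le> m" by (auto simp: M_def m_def)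
  define G where "G j = peval (dtc j) M (V N)" for j
  \<comment> \<open>Dividing the truncated F'_{y_j} by x^\<nu> and removing the leading coefficient
    \<open>A j\<close> leaves a part of order at least \<open>\<delta>\<close>; the removed parts
    add up to the divisor. The bound \<open>\<delta> \<le> Re (lam N) - Re \<nu>\<close> guarantees
    that \<open>V N\<close> already determines the coefficients below this order.\<close>
  define H where "H j = single (- \<nu>) 1 * G j - single 0 (A j)" for j
  have H: "re_ge \<delta> (H j)" if j: "j \<le> n" for j
    unfolding re_ge_def
  proof (intro ballI, rule ccontr)
    fix l assume l: "l \<in> keys (H j)" "\<not> \<delta> \<le> Re l"
    have "lookup (G j) (l + \<nu>) = lookup (peval (dtc j) M (V m)) (l + \<nu>)"
      unfolding G_def using l gap by (intro eval_V_agree m) auto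
    also have "\<dots> = Fy j (l + \<nu>)"
      using l by (intro M2 m M) auto
    also have "\<dots> = (if l + \<nu> = \<nu> then A j else 0)" using l by (intro gap(3) j) auto
    finally have "lookup (H j) l = 0"
      by (simp add: H_def lookup_minus lookup_single_mult lookup_single when_def)
    thus False using l by (simp add: in_keys_iff)
  qed
  let ?U = "qv 0 (U K)"
  obtain Q where Q: "peval tc (Suc M) (V K) = peval tc (Suc M) (V N) +
        single \<mu> 1 * (\<Sum>i\<in>UNIV. peval (dcoeff i tc) M (V N) * ?U i) + (single \<mu> 1)\<^sup>2 * Q"
     "re_ge 0 Q" "wnorm \<theta> Q \<le> 64 / r\<^sup>2 * C * 2 ^ CARD('v) * 1\<^sup>2"
  proof (rule peval_taylor[OF \<theta>(1) Cr(3,2,1), where a = "V N" and b = "?U"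
        and z = "V K" and x = "single \<mu> 1" and B = 1 and M = M])
    show "re_ge 0 (?U i)" for i by (rule qvars_all[OF coord]) (auto intro: Uge re_ge_zero)
    show "wnorm \<theta> (?U i) \<le> 1" for i by (rule qvars_all[OF coord]) (auto intro: U)
    show "re_ge 0 (single \<mu> 1)" using m0 Re_\<nu>_nonneg by (intro re_ge_single) (simp add: \<mu>_def)
    show "V K i = V N i + single \<mu> 1 * ?U i" for i using V_split[OF NK] by (simp add: U_def)
  qed (use \<theta> in \<open>auto intro: re_ge_V\<close>)
  show ?thesis
  proof (rule that[where H = H and Q = Q and M = M])
    fix k assume k: "k \<in> {N..K}"
    have G: "G j = single \<nu> 1 * H j + single \<nu> (A j)" for j
    proof -
      have "single \<nu> 1 * H j = (single \<nu> 1 * single (- \<nu>) 1) * G j - single \<nu> 1 * single 0 (A j)"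
        by (simp only: H_def right_diff_distrib mult.assoc)
      thus ?thesis by (simp add: mult_single)
    qed
    have "single \<mu> 1 * (G j * U K j) = single (\<mu> + \<nu>) 1 * (H j * U K j) + single (\<mu> + \<nu>) (A j) * U K j" for j
    proof -
      have "single \<mu> 1 * (G j * U K j) = (single \<mu> 1 * single \<nu> 1) * (H j * U K j) +
          (single \<mu> 1 * single \<nu> (A j)) * U K j"
        by (simp only: G algebra_simps)
      thus ?thesis by (simp add: mult_single)
    qed
    hence "lookup (single \<mu> 1 * (\<Sum>i\<in>UNIV. peval (dcoeff i tc) M (V N) * ?U i)) (lam k + \<nu>) =
        (\<Sum>j\<le>n. lookup (H j * U K j) (lam k - \<mu>) + A j * lookup (U K j) (lam k - \<mu>))"
      unfolding sum_qvars[OF coord] dtc_def[symmetric] G_def[symmetric] sum_distrib_left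
      by (simp add: lookup_sum lookup_add lookup_single_mult)
    \<comment> \<open>\<open>U K\<close> stops before index \<open>K\<close>, so at k = K the linear
      part contains no term Lq k c k; there this term comes from \<open>eval_truncation\<close>,
      with the opposite sign on the other side. One formula thus covers k < K and k = K.\<close>
    also have "\<dots> = (\<Sum>j\<le>n. lookup (H j * U K j) (lam k - \<mu>)) + (if k < K then Lq k * c k else 0)"
      using k by (auto simp: sum.distrib Lq_def U_def lookup_single_mult lookup_ser[OF inj_lam]
          sum_distrib_left mult_ac)
    finally have lin: "lookup (single \<mu> 1 * (\<Sum>i\<in>UNIV. peval (dcoeff i tc) M (V N) * ?U i)) (lam k + \<nu>) = \<dots>" .
    have quad: "lookup ((single \<mu> 1)\<^sup>2 * Q) (lam k + \<nu>) = lookup (single (\<mu> - \<nu>) 1 * Q) (lam k - \<mu>)"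
      unfolding power2_eq_square mult_single lookup_single_mult
      by (simp add: diff_diff_eq2 diff_diff_eq add.commute)
    have *: "(if k = K then - Lq k * c k else 0) = lookup (peval tc (Suc M) (V N)) (lam k + \<nu>) +
        ((\<Sum>j\<le>n. lookup (H j * U K j) (lam k - \<mu>)) + (if k < K then Lq k * c k else 0)) +
        lookup (single (\<mu> - \<nu>) 1 * Q) (lam k - \<mu>)"
      using M1[OF M(1), of k] k unfolding Q(1) lookup_add lin quad by simp
    show "Lq k * c k = - (lookup (peval tc (Suc M) (V N)) (lam k + \<nu>) +
        (\<Sum>j\<le>n. lookup (H j * U K j) (lam k - \<mu>)) + lookup (single (\<mu> - \<nu>) 1 * Q) (lam k - \<mu>))"
    proof (cases "k = K")
      case True
      with * have "- (Lq k * c k) = lookup (peval tc (Suc M) (V N)) (lam k + \<nu>) +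
        (\<Sum>j\<le>n. lookup (H j * U K j) (lam k - \<mu>)) + lookup (single (\<mu> - \<nu>) 1 * Q) (lam k - \<mu>)" by simp
      thus ?thesis by (metis minus_minus)
    next
      case False
      thus ?thesis using * k by (simp add: eq_neg_iff_add_eq_0 algebra_simps)
    qed
  qed (use Q H Uge in \<open>auto simp: H_def G_def\<close>)
qed

end

section \<open>Supermultiplicative weights and the inductive bound\<close>

definition super_weight :: "(real \<Rightarrow> real) \<Rightarrow> bool" where
  "super_weight \<Omega> \<longleftrightarrow> (\<forall>t. 1 \<le> \<Omega> t) \<and> (\<forall>s\<ge>0. \<forall>t\<ge>0. \<Omega> s * \<Omega> t \<le> \<Omega> (s + t))"

lemma weight_super:
  assumes "super_weight \<Omega>" "0 < \<epsilon>"
  shows "weight (\<lambda>l. \<epsilon> powr Re l / \<Omega> (Re l))"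
proof -
  have \<Omega>: "1 \<le> \<Omega> t" for t using assms by (simp add: super_weight_def)
  hence \<Omega>0: "0 < \<Omega> t" for t by (meson less_le_trans zero_less_one)
  show ?thesis unfolding weight_def
  proof (intro conjI allI impI)
    fix s t :: complex assume st: "0 \<le> Re s" "0 \<le> Re t"
    have "\<epsilon> powr Re (s + t) / \<Omega> (Re (s + t)) \<le> (\<epsilon> powr Re s * \<epsilon> powr Re t) / (\<Omega> (Re s) * \<Omega> (Re t))"
      using assms st \<Omega>0 by (intro frac_le) (auto simp: powr_add super_weight_def)
    thus "\<epsilon> powr Re (s + t) / \<Omega> (Re (s + t)) \<le> \<epsilon> powr Re s / \<Omega> (Re s) * (\<epsilon> powr Re t / \<Omega> (Re t))"
      by simp
  qed (use \<Omega> \<Omega>0 assms in \<open>auto simp: less_imp_le\<close>)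
qed

context q_equation
begin

text \<open>Summand of the weighted norm of the rescaled remainder u. \<open>B k\<close> is to bound
  |q^(j \<lambda>)| for all j \<le> n, so that one sum controls every \<sigma>^j u.\<close>

definition majorant :: "(nat \<Rightarrow> real) \<Rightarrow> (real \<Rightarrow> real) \<Rightarrow> real \<Rightarrow> real \<Rightarrow> nat \<Rightarrow> real" where
  "majorant B \<Omega> m0 \<epsilon> k = cmod (c k) * B k * (\<epsilon> powr (Re (lam k) - m0) / \<Omega> (Re (lam k) - m0))"

text \<open>By induction the truncation of u below index \<open>K\<close> has norm at most 1, and
  the right-hand side of the normal form up to index \<open>K\<close> depends on nothing else. The
  linear and the quadratic part carry factors of positive order, so they lead from an exponent to a
  strictly smaller one; this drop is what \<open>D\<close> needs to absorb the divisor. The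
  inhomogeneous part is treated with the drop to s = 0. Small \<open>\<epsilon>\<close> then
  restores the bound 1.\<close>

lemma majorant_step:
  fixes m0 :: real and N :: nat
  assumes m0: "Re \<nu> < m0" and N: "\<And>k. N \<le> k \<Longrightarrow> m0 < Re (lam k)" and NK: "N \<le> K"
    and \<Omega>: "super_weight \<Omega>"
    and B: "\<And>k j. N \<le> k \<Longrightarrow> c k \<noteq> 0 \<Longrightarrow> j \<le> n \<Longrightarrow> cmod (exp (of_nat j * lam k * lq)) \<le> B k"
    and D: "0 < D" "\<And>k s. N \<le> k \<Longrightarrow> c k \<noteq> 0 \<Longrightarrow> 0 \<le> s \<Longrightarrow> s < Re (lam k) - m0 \<Longrightarrow>
       B k * \<Omega> s \<le> D * cmod (Lq k) * \<Omega> (Re (lam k) - m0)"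
    and Cr: "0 \<le> C" "0 < r" "\<And>\<alpha>. cmod (tc \<alpha>) \<le> C / r ^ mdeg \<alpha>"
      "\<And>j \<alpha>. j \<le> n \<Longrightarrow> cmod (dtc j \<alpha>) \<le> C / r ^ mdeg \<alpha>"
    and gap: "0 < \<delta>" "\<delta> \<le> Re (lam N) - Re \<nu>" "\<And>j l. j \<le> n \<Longrightarrow> Re l < Re \<nu> + \<delta> \<Longrightarrow>
    Fy j l = (if l = \<nu> then A j else 0)"
    and \<epsilon>: "0 < \<epsilon>" "\<epsilon> \<le> \<epsilon>0" and VN: "\<And>i. rnorm \<epsilon>0 (V N i) \<le> r / 16" and \<epsilon>m: "\<epsilon> powr m0 \<le> r / 16"
    and small: "D * ((\<epsilon> / \<epsilon>0) powr (Re (lam N) - m0) * (\<epsilon>0 powr (- m0 - Re \<nu>) * (C * 2 ^ CARD('v))) +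
       (\<Sum>j\<le>n. (\<epsilon> / \<epsilon>0) powr \<delta> * (\<epsilon>0 powr (- Re \<nu>) * (C * 2 ^ CARD('v)) + cmod (A j))) +
       \<epsilon> powr (m0 - Re \<nu>) * (64 / r\<^sup>2 * C * 2 ^ CARD('v))) \<le> 1"
    and IH: "(\<Sum>k\<in>{N..<K}. majorant B \<Omega> m0 \<epsilon> k) \<le> 1"
  shows "(\<Sum>k\<in>{N..<Suc K}. majorant B \<Omega> m0 \<epsilon> k) \<le> 1"
proof -
  define \<mu> where "\<mu> = complex_of_real m0"
  define U where "U = (\<lambda>K j. single (- \<mu>) 1 * ser lq c lam j {N..<K})"
  define \<theta> where "\<theta> = (\<lambda>l. \<epsilon> powr Re l / \<Omega> (Re l))"
  have \<epsilon>0: "0 < \<epsilon>0" using \<epsilon> by linarith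
  have \<Omega>1: "1 \<le> \<Omega> t" for t using \<Omega> by (simp add: super_weight_def)
  hence \<Omega>0: "0 < \<Omega> t" for t by (meson less_le_trans zero_less_one)
  have w: "weight \<theta>" unfolding \<theta>_def by (rule weight_super[OF \<Omega> \<epsilon>(1)])
  have \<theta>_le: "\<theta> l \<le> rweight \<epsilon> l" for l
    using mult_left_mono[OF \<Omega>1[of "Re l"], of "\<epsilon> powr Re l"] \<Omega>0[of "Re l"]
    by (simp add: \<theta>_def rweight_def divide_le_eq)
  have \<theta>0: "0 \<le> \<theta> l" for l using w by (simp add: weight_def)
  have B1: "1 \<le> B k" if "N \<le> k" "c k \<noteq> 0" for k using B[OF that, of 0] by simp
  have maj: "majorant B \<Omega> m0 \<epsilon> k = cmod (c k) * B k * \<theta> (lam k - \<mu>)" for k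
    by (simp add: majorant_def \<theta>_def \<mu>_def)
  have U1: "wnorm \<theta> (U K j) \<le> 1" if j: "j \<le> n" for j
  proof -
    have "U K j = (\<Sum>k\<in>{N..<K}. single (lam k - \<mu>) (exp (of_nat j * lam k * lq) * c k))"
      by (simp add: U_def ser_def sum_distrib_left mult_single)
    hence "wnorm \<theta> (U K j) \<le> (\<Sum>k\<in>{N..<K}. cmod (exp (of_nat j * lam k * lq) * c k) * \<theta> (lam k - \<mu>))"
      using weight_sum_le[OF w] by (simp only: wnorm_single[symmetric])
    also have "\<dots> \<le> (\<Sum>k\<in>{N..<K}. majorant B \<Omega> m0 \<epsilon> k)"
    proof (rule sum_mono)
      fix k assume k: "k \<in> {N..<K}"
      show "cmod (exp (of_nat j * lam k * lq) * c k) * \<theta> (lam k - \<mu>) \<le> majorant B \<Omega> m0 \<epsilon> k"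
      proof (cases "c k = 0")
        case False
        hence "cmod (exp (of_nat j * lam k * lq)) * cmod (c k) * \<theta> (lam k - \<mu>) \<le>
            B k * cmod (c k) * \<theta> (lam k - \<mu>)"
          using B[of k j] k j \<theta>0 by (intro mult_right_mono) auto
        thus ?thesis unfolding maj norm_mult by (simp only: mult_ac)
      qed (simp add: maj)
    qed
    finally show ?thesis using IH by linarith
  qed
  have VN\<theta>: "wnorm \<theta> (V N i) \<le> r / 16" for i
  proof -
    have "wnorm \<theta> (V N i) \<le> rnorm \<epsilon> (V N i)" by (intro wnorm_mono \<theta>_le)
    also have "\<dots> \<le> (\<epsilon> / \<epsilon>0) powr 0 * rnorm \<epsilon>0 (V N i)"
      by (rule wnorm_rweight_scale[OF re_ge_V \<epsilon>])
    also have "\<dots> \<le> r / 16" using VN[of i] \<epsilon> \<epsilon>0 by simp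
    finally show ?thesis .
  qed
  have Uge0: "re_ge 0 (U K j)" for j
    unfolding U_def using N by (intro re_ge_shifted_ser) (auto simp: \<mu>_def intro: less_imp_le)
  have VK\<theta>: "wnorm \<theta> (V K i) \<le> r / 8" for i
  proof -
    let ?U = "qv 0 (U K) i"
    have u: "wnorm \<theta> ?U \<le> 1" "re_ge 0 ?U"
      by (rule qvars_all[OF coord], simp, rule U1, assumption)
        (rule qvars_all[OF coord], rule re_ge_zero, rule Uge0)
    have "re_ge 0 (single \<mu> 1)" using m0 Re_\<nu>_nonneg by (intro re_ge_single) (simp add: \<mu>_def)
    hence "wnorm \<theta> (single \<mu> 1 * ?U) \<le> wnorm \<theta> (single \<mu> 1) * wnorm \<theta> ?U"
      by (intro weight_mult_le w u)
    also have "\<dots> \<le> wnorm \<theta> (single \<mu> 1) * 1" by (intro mult_left_mono u weight_nonneg w)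
    also have "\<dots> \<le> \<epsilon> powr m0" using \<theta>_le[of \<mu>] by (simp add: wnorm_single rweight_def \<mu>_def)
    finally have "wnorm \<theta> (single \<mu> 1 * ?U) \<le> r / 16" using \<epsilon>m by linarith
    moreover have "V K i = V N i + single \<mu> 1 * ?U" using V_split[OF NK, of i \<mu>] by (simp add: U_def)
    ultimately show ?thesis
      using weight_add_le[OF w, of "V N i" "single \<mu> 1 * ?U"] VN\<theta>[of i] by simp
  qed
  obtain M Q H where nf:
    "\<And>k. k \<in> {N..K} \<Longrightarrow> Lq k * c k = - (lookup (peval tc (Suc M) (V N)) (lam k + \<nu>) +
        (\<Sum>j\<le>n. lookup (H j * U K j) (lam k - \<mu>)) + lookup (single (\<mu> - \<nu>) 1 * Q) (lam k - \<mu>))"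
    and Q: "re_ge 0 Q" "wnorm \<theta> Q \<le> 64 / r\<^sup>2 * C * 2 ^ CARD('v)"
    and Hge: "\<And>j. j \<le> n \<Longrightarrow> re_ge \<delta> (H j)"
    and H: "\<And>j. H j = single (- \<nu>) 1 * peval (dtc j) M (V N) - single 0 (A j)"
    and Uge: "\<And>j. re_ge 0 (U K j)"
  proof (rule normal_form[where N = N and K = K and \<theta> = \<theta> and C = C and r = r and \<delta> = \<delta>,
        OF m0 N NK Cr(1,2,3) gap w _ VK\<theta>])
    show "wnorm \<theta> (V N i) \<le> r / 8" for i using VN\<theta>[of i] Cr by simp
  qed (use U1 in \<open>auto simp: U_def \<mu>_def\<close>)
  \<comment> \<open>Chosen so that the majorant at \<open>k\<close> equals
    \<open>D * (cmod (Lq k * c k) * \<kappa> k)\<close> when \<open>c k\<close> is nonzero: this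
    weights the right-hand side of the normal form after division by the divisor.\<close>
  define \<kappa> where "\<kappa> k = B k * \<theta> (lam k - \<mu>) / (D * cmod (Lq k))" for k
  have pos: "0 < D * cmod (Lq k)" and \<kappa>_le: "\<And>s. 0 \<le> s \<Longrightarrow> s < Re (lam k) - m0 \<Longrightarrow>
      \<kappa> k \<le> \<epsilon> powr (Re (lam k) - m0) / \<Omega> s" if k: "N \<le> k" "c k \<noteq> 0" for k
  proof -
    \<comment> \<open>Taking s = 0 in \<open>D\<close> shows that the divisor does not
      vanish.\<close>
    have "1 \<le> B k * \<Omega> 0" using mult_mono[of 1 "B k" 1 "\<Omega> 0"] B1[OF k] \<Omega>1[of 0] by simp
    also have "\<dots> \<le> D * cmod (Lq k) * \<Omega> (Re (lam k) - m0)" using N[OF k(1)] by (intro D k) auto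
    finally have "0 < D * cmod (Lq k) * \<Omega> (Re (lam k) - m0)" by linarith
    thus p: "0 < D * cmod (Lq k)" 
      using \<Omega>0[of "Re (lam k) - m0"] by (rule zero_less_mult_pos2)
    fix s assume s: "0 \<le> s" "s < Re (lam k) - m0"
    have "B k * \<Omega> s / (D * cmod (Lq k) * \<Omega> (Re (lam k) - m0)) \<le> 1"
      using D(2)[OF k s] p \<Omega>0[of "Re (lam k) - m0"] by (simp add: divide_le_eq)
    hence "\<epsilon> powr (Re (lam k) - m0) / \<Omega> s * (B k * \<Omega> s / (D * cmod (Lq k) * \<Omega> (Re (lam k) - m0)))
       \<le> \<epsilon> powr (Re (lam k) - m0) / \<Omega> s * 1"
      using \<Omega>0[of s] by (intro mult_left_mono) auto
    thus "\<kappa> k \<le> \<epsilon> powr (Re (lam k) - m0) / \<Omega> s"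
      using \<Omega>0[of s] by (simp add: \<kappa>_def \<theta>_def \<mu>_def mult_ac)
  qed
  \<comment> \<open>\<open>\<kappa>\<close> is transported from indices to exponents and extended by
    0, so that it can serve as a weight in \<open>wnorm\<close>.\<close>
  define ind where "ind l = (\<exists>k. N \<le> k \<and> c k \<noteq> 0 \<and> l = lam k - \<mu>)" for l
  define \<eta> where "\<eta> l = (if ind l then \<kappa> (inv lam (l + \<mu>)) else 0)" for l
  have inv: "inv lam (lam k - \<mu> + \<mu>) = k" for k using inj_lam by simp
  have \<eta>_lam: "\<eta> (lam k - \<mu>) = \<kappa> k" if "N \<le> k" "c k \<noteq> 0" for k
    using that inv by (auto simp: \<eta>_def ind_def)
  have \<eta>_le: "\<eta> l \<le> \<epsilon> powr Re l / \<Omega> s" if "0 \<le> s" "s < Re l" for l s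
  proof (cases "ind l")
    case True
    then obtain k where k: "N \<le> k" "c k \<noteq> 0" "l = lam k - \<mu>" by (auto simp: ind_def)
    thus ?thesis using \<kappa>_le[OF k(1,2), of s] \<eta>_lam[OF k(1,2)] that by (simp add: \<mu>_def)
  next
    case False
    thus ?thesis using \<Omega>0[of s] by (simp add: \<eta>_def)
  qed
  have \<eta>0: "0 \<le> \<eta> l" for l
  proof (cases "ind l")
    case True
    then obtain k where k: "N \<le> k" "c k \<noteq> 0" "l = lam k - \<mu>" by (auto simp: ind_def)
    thus ?thesis using \<eta>_lam[OF k(1,2)] pos[OF k(1,2)] B1[OF k(1,2)] \<theta>0[of "lam k - \<mu>"]
      by (simp add: \<kappa>_def)
  qed (simp add: \<eta>_def)
  \<comment> \<open>The strict drop: an exponent of the product is s + t with Re s > 0, so the bound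
    for \<open>\<eta>\<close> applies with Re t < Re (s + t), and \<open>\<Omega>\<close> at Re t is
    just the one in \<open>\<theta>\<close>.\<close>
  have \<eta>_mult: "wnorm \<eta> (E * W) \<le> rnorm \<epsilon> E * wnorm \<theta> W"
    if "re_ge d E" "0 < d" "re_ge 0 W" for E W d
  proof (rule wnorm_mult_le[OF \<eta>0])
    fix s t assume "s \<in> keys E" "t \<in> keys W"
    hence "0 < Re s" "0 \<le> Re t" using that by (force simp: re_ge_def)+
    hence "\<eta> (s + t) \<le> \<epsilon> powr Re (s + t) / \<Omega> (Re t)" by (intro \<eta>_le) auto
    thus "\<eta> (s + t) \<le> rweight \<epsilon> s * \<theta> t" by (simp add: rweight_def \<theta>_def powr_add)
  qed
  have sum_\<eta>: "(\<Sum>k\<in>{N..K}. cmod (lookup p (lam k - \<mu>)) * \<eta> (lam k - \<mu>)) \<le> wnorm \<eta> p" for p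
  proof -
    have "inj_on (\<lambda>k. lam k - \<mu>) {N..K}" using inj_lam by (auto simp: inj_on_def)
    hence "(\<Sum>k\<in>{N..K}. cmod (lookup p (lam k - \<mu>)) * \<eta> (lam k - \<mu>)) =
        (\<Sum>l\<in>(\<lambda>k. lam k - \<mu>) ` {N..K}. cmod (lookup p l) * \<eta> l)"
      by (subst sum.reindex) auto
    also have "\<dots> \<le> wnorm \<eta> p" by (rule wnorm_sum_ge[OF \<eta>0]) simp
    finally show ?thesis .
  qed
  let ?g = "peval tc (Suc M) (V N)"
  let ?C = "C * 2 ^ CARD('v)"
  have w0: "weight (rweight \<epsilon>0)" by (rule weight_rweight[OF \<epsilon>0])
  have VN8: "rnorm \<epsilon>0 (V N i) \<le> r / 8" for i using VN[of i] Cr by simp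
  have T1: "(\<Sum>k\<in>{N..K}. cmod (lookup ?g (lam k + \<nu>)) * \<eta> (lam k - \<mu>)) \<le>
     (\<epsilon> / \<epsilon>0) powr (Re (lam N) - m0) * (\<epsilon>0 powr (- m0 - Re \<nu>) * ?C)"
  proof -
    \<comment> \<open>\<open>\<eta>\<close> lives at lam k - \<mu>, the coefficients of
      \<open>?g\<close> at lam k + \<nu>; this shift produces the factor
      \<open>\<epsilon>0 powr (- m0 - Re \<nu>)\<close>.\<close>
    let ?e = "(\<epsilon> / \<epsilon>0) powr (Re (lam N) - m0) * \<epsilon>0 powr (- m0 - Re \<nu>)"
    have "(\<Sum>k\<in>{N..K}. cmod (lookup ?g (lam k + \<nu>)) * \<eta> (lam k - \<mu>)) \<le>
        (\<Sum>k\<in>{N..K}. cmod (lookup ?g (lam k + \<nu>)) * (?e * rweight \<epsilon>0 (lam k + \<nu>)))"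
    proof (intro sum_mono mult_left_mono)
      fix k assume k: "k \<in> {N..K}"
      let ?t = "Re (lam k) - m0"
      have "\<eta> (lam k - \<mu>) \<le> \<epsilon> powr ?t / \<Omega> 0"
        using \<eta>_le[of 0 "lam k - \<mu>"] N[of k] k by (simp add: \<mu>_def)
      also have "\<dots> \<le> \<epsilon> powr ?t" using mult_left_mono[OF \<Omega>1[of 0], of "\<epsilon> powr ?t"] \<Omega>0[of 0]
        by (simp add: divide_le_eq)
      also have "\<dots> = (\<epsilon> / \<epsilon>0) powr ?t * \<epsilon>0 powr ?t" using \<epsilon> \<epsilon>0 by (simp add: powr_divide)
      also have "\<dots> \<le> (\<epsilon> / \<epsilon>0) powr (Re (lam N) - m0) * \<epsilon>0 powr ?t"
        using \<epsilon> \<epsilon>0 k Re_lam_mono[of N k] by (intro mult_right_mono powr_mono') auto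
      also have "\<epsilon>0 powr ?t = \<epsilon>0 powr (- m0 - Re \<nu>) * rweight \<epsilon>0 (lam k + \<nu>)"
        by (simp add: rweight_def powr_add[symmetric])
      finally show "\<eta> (lam k - \<mu>) \<le> ?e * rweight \<epsilon>0 (lam k + \<nu>)" by (simp add: mult_ac)
    qed auto
    also have "\<dots> = ?e * (\<Sum>k\<in>{N..K}. cmod (lookup ?g (lam k + \<nu>)) * rweight \<epsilon>0 (lam k + \<nu>))"
      by (simp add: sum_distrib_left mult_ac)
    also have "(\<Sum>k\<in>{N..K}. cmod (lookup ?g (lam k + \<nu>)) * rweight \<epsilon>0 (lam k + \<nu>)) =
        (\<Sum>l\<in>(\<lambda>k. lam k + \<nu>) ` {N..K}. cmod (lookup ?g l) * rweight \<epsilon>0 l)"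
      using inj_lam by (subst sum.reindex) (auto simp: inj_on_def)
    also have "?e * \<dots> \<le> ?e * rnorm \<epsilon>0 ?g"
      by (intro mult_left_mono wnorm_sum_ge) auto
    also have "\<dots> \<le> ?e * ?C"
      by (intro mult_left_mono wnorm_peval_le[OF w0 Cr(3,2,1)] re_ge_V VN8) auto
    finally show ?thesis by (simp add: mult_ac)
  qed
  have T2: "wnorm \<eta> (H j * U K j) \<le> (\<epsilon> / \<epsilon>0) powr \<delta> * (\<epsilon>0 powr (- Re \<nu>) * ?C + cmod (A j))"
    if j: "j \<le> n" for j
  proof -
    have "rnorm \<epsilon>0 (H j) \<le> rnorm \<epsilon>0 (single (- \<nu>) 1 * peval (dtc j) M (V N)) +
        rnorm \<epsilon>0 (single 0 (A j))"
      using wnorm_add_le[of "rweight \<epsilon>0" "single (- \<nu>) 1 * peval (dtc j) M (V N)" "- single 0 (A j)"]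
      unfolding H by simp
    also have "\<dots> \<le> \<epsilon>0 powr (- Re \<nu>) * ?C + cmod (A j)"
    proof (rule add_mono)
      have "rnorm \<epsilon>0 (single (- \<nu>) 1 * peval (dtc j) M (V N)) \<le>
          \<epsilon>0 powr (- Re \<nu>) * rnorm \<epsilon>0 (peval (dtc j) M (V N))"
        using wnorm_rweight_single_mult[OF \<epsilon>0, of "- \<nu>" 1] by simp
      also have "\<dots> \<le> \<epsilon>0 powr (- Re \<nu>) * ?C"
        by (intro mult_left_mono wnorm_peval_le[OF w0 Cr(4)[OF j] Cr(2,1)] re_ge_V VN8) auto
      finally show "rnorm \<epsilon>0 (single (- \<nu>) 1 * peval (dtc j) M (V N)) \<le> \<epsilon>0 powr (- Re \<nu>) * ?C" .
    qed (use \<epsilon>0 in \<open>simp add: wnorm_single rweight_def\<close>)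
    finally have h: "rnorm \<epsilon>0 (H j) \<le> \<epsilon>0 powr (- Re \<nu>) * ?C + cmod (A j)" .
    have "wnorm \<eta> (H j * U K j) \<le> rnorm \<epsilon> (H j) * wnorm \<theta> (U K j)"
      by (rule \<eta>_mult[OF Hge[OF j] gap(1) Uge])
    also have "\<dots> \<le> rnorm \<epsilon> (H j) * 1"
      by (intro mult_left_mono U1 j wnorm_nonneg) simp
    also have "\<dots> \<le> (\<epsilon> / \<epsilon>0) powr \<delta> * rnorm \<epsilon>0 (H j)"
      using wnorm_rweight_scale[OF Hge[OF j] \<epsilon>] by simp
    also have "\<dots> \<le> (\<epsilon> / \<epsilon>0) powr \<delta> * (\<epsilon>0 powr (- Re \<nu>) * ?C + cmod (A j))"
      by (intro mult_left_mono h) auto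
    finally show ?thesis .
  qed
  have T3: "wnorm \<eta> (single (\<mu> - \<nu>) 1 * Q) \<le> \<epsilon> powr (m0 - Re \<nu>) * (64 / r\<^sup>2 * C * 2 ^ CARD('v))"
  proof -
    have "wnorm \<eta> (single (\<mu> - \<nu>) 1 * Q) \<le> rnorm \<epsilon> (single (\<mu> - \<nu>) 1) * wnorm \<theta> Q"
      using m0 by (intro \<eta>_mult[of "m0 - Re \<nu>"] Q re_ge_single) (auto simp: \<mu>_def)
    also have "\<dots> = \<epsilon> powr (m0 - Re \<nu>) * wnorm \<theta> Q" by (simp add: wnorm_single rweight_def \<mu>_def)
    also have "\<dots> \<le> \<epsilon> powr (m0 - Re \<nu>) * (64 / r\<^sup>2 * C * 2 ^ CARD('v))"
      by (intro mult_left_mono Q) auto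
    finally show ?thesis .
  qed
  have "(\<Sum>k\<in>{N..<Suc K}. majorant B \<Omega> m0 \<epsilon> k) \<le>
     (\<Sum>k\<in>{N..K}. D * (cmod (lookup ?g (lam k + \<nu>)) * \<eta> (lam k - \<mu>) +
        (\<Sum>j\<le>n. cmod (lookup (H j * U K j) (lam k - \<mu>)) * \<eta> (lam k - \<mu>)) +
        cmod (lookup (single (\<mu> - \<nu>) 1 * Q) (lam k - \<mu>)) * \<eta> (lam k - \<mu>)))"
    unfolding atLeastLessThanSuc_atLeastAtMost
  proof (rule sum_mono)
    fix k assume k: "k \<in> {N..K}"
    let ?a = "cmod (lookup ?g (lam k + \<nu>))"
      and ?b = "\<lambda>j. cmod (lookup (H j * U K j) (lam k - \<mu>))"
      and ?q = "cmod (lookup (single (\<mu> - \<nu>) 1 * Q) (lam k - \<mu>))"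
    show "majorant B \<Omega> m0 \<epsilon> k \<le> D * (?a * \<eta> (lam k - \<mu>) + (\<Sum>j\<le>n. ?b j * \<eta> (lam k - \<mu>)) +
        ?q * \<eta> (lam k - \<mu>))"
    proof (cases "c k = 0")
      case True
      thus ?thesis using D(1) \<eta>0 by (auto simp: maj intro!: mult_nonneg_nonneg add_nonneg_nonneg sum_nonneg)
    next
      case False
      have nk: "N \<le> k" using k by simp
      have "majorant B \<Omega> m0 \<epsilon> k = D * (cmod (Lq k * c k) * \<eta> (lam k - \<mu>))"
      proof -
        have "D \<noteq> 0" "Lq k \<noteq> 0" using pos[OF nk False] by auto
        thus ?thesis by (simp add: maj \<eta>_lam[OF nk False] \<kappa>_def norm_mult)
      qed
      also have "cmod (Lq k * c k) \<le> ?a + (\<Sum>j\<le>n. ?b j) + ?q"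
        unfolding nf[OF k] norm_minus_cancel by (intro norm_triangle_mono order_refl norm_sum)
      finally show ?thesis using D(1) \<eta>0[of "lam k - \<mu>"]
        by (simp add: mult_left_mono mult_right_mono distrib_right sum_distrib_right)
    qed
  qed
  also have "\<dots> = D * ((\<Sum>k\<in>{N..K}. cmod (lookup ?g (lam k + \<nu>)) * \<eta> (lam k - \<mu>)) +
      (\<Sum>j\<le>n. \<Sum>k\<in>{N..K}. cmod (lookup (H j * U K j) (lam k - \<mu>)) * \<eta> (lam k - \<mu>)) +
      (\<Sum>k\<in>{N..K}. cmod (lookup (single (\<mu> - \<nu>) 1 * Q) (lam k - \<mu>)) * \<eta> (lam k - \<mu>)))"
    unfolding sum_distrib_left[symmetric] sum.distrib
    by (subst sum.swap[of _ "{..n}" "{N..K}"]) simp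
  also have "\<dots> \<le> D * ((\<epsilon> / \<epsilon>0) powr (Re (lam N) - m0) * (\<epsilon>0 powr (- m0 - Re \<nu>) * ?C) +
       (\<Sum>j\<le>n. (\<epsilon> / \<epsilon>0) powr \<delta> * (\<epsilon>0 powr (- Re \<nu>) * ?C + cmod (A j))) +
       \<epsilon> powr (m0 - Re \<nu>) * (64 / r\<^sup>2 * C * 2 ^ CARD('v)))"
    using D(1) T2 by (intro mult_left_mono add_mono T1 sum_mono order_trans[OF sum_\<eta>] T3) auto
  also have "\<dots> \<le> 1" by (rule small)
  finally show ?thesis .
qed


text \<open>\<open>\<epsilon>0\<close> is a radius at which the arguments \<open>V N\<close>, being
  of positive order, are small enough for the Taylor estimates. Every term of the smallness
  condition carries a positive power of \<open>\<epsilon>\<close>, so a small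
  \<open>\<epsilon>\<close> satisfies it.\<close>

lemma majorant_bounded:
  fixes m0 :: real and N :: nat
  assumes m0: "Re \<nu> < m0" and N: "\<And>k. N \<le> k \<Longrightarrow> m0 < Re (lam k)"
    and \<Omega>: "super_weight \<Omega>"
    and B: "\<And>k j. N \<le> k \<Longrightarrow> c k \<noteq> 0 \<Longrightarrow> j \<le> n \<Longrightarrow> cmod (exp (of_nat j * lam k * lq)) \<le> B k"
    and D: "0 < D" "\<And>k s. N \<le> k \<Longrightarrow> c k \<noteq> 0 \<Longrightarrow> 0 \<le> s \<Longrightarrow> s < Re (lam k) - m0 \<Longrightarrow>
       B k * \<Omega> s \<le> D * cmod (Lq k) * \<Omega> (Re (lam k) - m0)"
  obtains \<epsilon> where "0 < \<epsilon>" "\<And>K. (\<Sum>k\<in>{N..<K}. majorant B \<Omega> m0 \<epsilon> k) \<le> 1"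
proof -
  obtain C r where Cr: "0 \<le> C" "0 < r" "\<And>\<alpha>. cmod (tc \<alpha>) \<le> C / r ^ mdeg \<alpha>"
      "\<And>j \<alpha>. j \<le> n \<Longrightarrow> cmod (dtc j \<alpha>) \<le> C / r ^ mdeg \<alpha>"
    by (rule coeff_bounds) blast
  obtain \<delta>' where gap': "0 < \<delta>'" "\<And>j l. j \<le> n \<Longrightarrow> Re l < Re \<nu> + \<delta>' \<Longrightarrow>
    Fy j l = (if l = \<nu> then A j else 0)"
    by (rule leading_gap) blast
  define \<delta> where "\<delta> = min \<delta>' (Re (lam N) - Re \<nu>)"
  have m0N: "m0 < Re (lam N)" using N by simp
  have gap: "0 < \<delta>" "\<delta> \<le> Re (lam N) - Re \<nu>" "\<And>j l. j \<le> n \<Longrightarrow> Re l < Re \<nu> + \<delta> \<Longrightarrow>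
    Fy j l = (if l = \<nu> then A j else 0)"
    using gap' m0 m0N by (auto simp: \<delta>_def)
  have pw: "((\<lambda>\<epsilon>. (\<epsilon> / e) powr d) \<longlongrightarrow> 0) (at_right 0)" if "0 < d" "0 < e" for d e :: real
  proof (rule tendsto_zero_powrI[OF _ tendsto_const _ that(1)])
    show "((\<lambda>\<epsilon>. \<epsilon> / e) \<longlongrightarrow> 0) (at_right 0)"
      using tendsto_divide[OF tendsto_ident_at tendsto_const, of e 0 "{0<..}"] that by simp
    show "\<forall>\<^sub>F \<epsilon> in at_right 0. 0 \<le> \<epsilon> / e"
      using that by (intro eventually_at_right_less[THEN eventually_mono]) (simp add: less_imp_le)
  qed
  have pw1: "((\<lambda>\<epsilon>. \<epsilon> powr d) \<longlongrightarrow> 0) (at_right 0)" if "0 < d" for d :: real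
    using pw[OF that, of 1] by simp
  have le1: "\<forall>\<^sub>F \<epsilon> in at_right 0. 0 < \<epsilon> \<and> \<epsilon> \<le> e" if "0 < e" for e :: real
    using that by (auto simp: eventually_at_right_field intro!: exI[of _ e])
  define d where "d = min 1 (Re (lam 0))"
  define W where "W = (\<Sum>i\<in>UNIV. rnorm 1 (V N i))"
  have d0: "0 < d" using Re_lam_pos[of 0] by (simp add: d_def)
  have VNd: "re_ge d (V N i)" for i
    unfolding V_def
  proof (rule qvars_all[OF coord])
    show "re_ge d (single 1 1)" by (rule re_ge_single) (simp add: d_def)
    show "re_ge d (ser lq c lam j {..<N})" for j
      using Re_lam_mono[of 0] by (intro re_ge_ser) (auto simp: d_def intro: min.coboundedI2)
  qed
  have "((\<lambda>\<epsilon>. \<epsilon> powr d * W) \<longlongrightarrow> 0 * W) (at_right 0)" by (intro tendsto_mult pw1 d0 tendsto_const)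
  hence "\<forall>\<^sub>F \<epsilon> in at_right 0. \<epsilon> powr d * W < r / 16" by (rule order_tendstoD) (use Cr in simp)
  with le1[OF zero_less_one] have "\<forall>\<^sub>F \<epsilon> in at_right 0. (0 < \<epsilon> \<and> \<epsilon> \<le> 1) \<and> \<epsilon> powr d * W < r / 16"
    by eventually_elim blast
  then obtain \<epsilon>0 :: real where e0: "0 < \<epsilon>0" "\<epsilon>0 \<le> 1" "\<epsilon>0 powr d * W < r / 16"
    using eventually_happens[of _ "at_right (0::real)"] by auto
  have VN: "rnorm \<epsilon>0 (V N i) \<le> r / 16" for i
  proof -
    have "rnorm \<epsilon>0 (V N i) \<le> (\<epsilon>0 / 1) powr d * rnorm 1 (V N i)"
      by (rule wnorm_rweight_scale[OF VNd e0(1,2)])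
    also have "\<dots> \<le> (\<epsilon>0 / 1) powr d * W"
      unfolding W_def by (intro mult_left_mono member_le_sum wnorm_nonneg) auto
    finally show ?thesis using e0 by simp
  qed
  let ?C = "C * 2 ^ CARD('v)"
  let ?S = "\<lambda>\<epsilon>. D * ((\<epsilon> / \<epsilon>0) powr (Re (lam N) - m0) * (\<epsilon>0 powr (- m0 - Re \<nu>) * ?C) +
       (\<Sum>j\<le>n. (\<epsilon> / \<epsilon>0) powr \<delta> * (\<epsilon>0 powr (- Re \<nu>) * ?C + cmod (A j))) +
       \<epsilon> powr (m0 - Re \<nu>) * (64 / r\<^sup>2 * C * 2 ^ CARD('v)))"
  have "(?S \<longlongrightarrow> D * (0 * (\<epsilon>0 powr (- m0 - Re \<nu>) * ?C) +
       (\<Sum>j\<le>n. 0 * (\<epsilon>0 powr (- Re \<nu>) * ?C + cmod (A j))) + 0 * (64 / r\<^sup>2 * C * 2 ^ CARD('v)))) (at_right 0)"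
    using m0 m0N gap(1) e0(1) by (intro tendsto_intros pw pw1) auto
  hence "\<forall>\<^sub>F \<epsilon> in at_right 0. ?S \<epsilon> < 1" by (rule order_tendstoD) simp
  moreover have "\<forall>\<^sub>F \<epsilon> in at_right 0. \<epsilon> powr m0 < r / 16"
    using m0 Re_\<nu>_nonneg Cr by (intro order_tendstoD[OF pw1]) auto
  ultimately have "\<forall>\<^sub>F \<epsilon> in at_right 0. (0 < \<epsilon> \<and> \<epsilon> \<le> \<epsilon>0) \<and> ?S \<epsilon> < 1 \<and> \<epsilon> powr m0 < r / 16"
    using le1[OF e0(1)] by eventually_elim blast
  then obtain \<epsilon> :: real where e: "0 < \<epsilon>" "\<epsilon> \<le> \<epsilon>0" "?S \<epsilon> < 1" "\<epsilon> powr m0 < r / 16"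
    using eventually_happens[of _ "at_right (0::real)"] by (metis (no_types, lifting) trivial_limit_at_right_real)
  have "(\<Sum>k\<in>{N..<K}. majorant B \<Omega> m0 \<epsilon> k) \<le> 1" for K
  proof (cases "N \<le> K")
    case True
    thus ?thesis
    proof (induction K rule: dec_induct)
      case (step K)
      show ?case
        by (rule majorant_step[OF m0 N step(1) \<Omega> B D Cr gap e(1,2) VN _ _ step(3)]) (use e in auto)
    qed simp
  qed simp
  with e(1) that show ?thesis by blast
qed

end

section \<open>Resonances and rational exponents\<close>

context q_equation
begin

text \<open>Differentiating the equation along a derivation that kills \<open>x\<close> gives a solution of the
  linearized equation, whose leading exponent must be a zero of \<open>L(q\<^sup>\<lambda>)\<close>.\<close>

lemma resonance:
  assumes add: "\<And>s t. \<psi> (s + t) = \<psi> s + \<psi> t" and \<psi>1: "\<psi> 1 = 0"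
    and ex: "\<exists>k. \<psi> (lam k) * c k \<noteq> 0"
  shows "\<exists>k. c k \<noteq> 0 \<and> Lq k = 0"
proof -
  \<comment> \<open>Coefficients of the differentiated series. \<open>K\<close> is the first index
    that survives, so the derivative of the argument tuple is a tail starting at
    \<open>lam K\<close>, and comparing coefficients at lam K + \<nu> isolates the divisor.\<close>
  define d where "d k = \<psi> (lam k) * c k" for k
  define K where "K = (LEAST k. d k \<noteq> 0)"
  have "\<exists>k. d k \<noteq> 0" using ex by (simp add: d_def)
  from LeastI_ex[OF this] have dK: "d K \<noteq> 0" unfolding K_def .
  have dlt: "d k = 0" if "k < K" for k using not_less_Least[OF that[unfolded K_def]] by simp
  obtain \<delta> where \<delta>: "0 < \<delta>" "\<And>j l. j \<le> n \<Longrightarrow> Re l < Re \<nu> + \<delta> \<Longrightarrow>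
    Fy j l = (if l = \<nu> then A j else 0)"
    by (rule leading_gap) blast
  obtain M m0 where Mm: "\<And>m l. m0 \<le> m \<Longrightarrow> Re l \<le> Re (lam K) + Re \<nu> \<Longrightarrow>
      lookup (peval tc (Suc M) (V m)) l = 0"
    "\<And>m l j. m0 \<le> m \<Longrightarrow> Re l \<le> Re (lam K) + Re \<nu> \<Longrightarrow>
      lookup (peval (dtc j) M (V m)) l =
        Fy j l"
    using eval_V[of "Re (lam K) + Re \<nu>"] le_SucI by blast
  define m where "m = max m0 (Suc K)"
  have m: "m0 \<le> m" "K < m" by (auto simp: m_def)
  have ser: "pder \<psi> (ser lq c lam j {..<m}) = ser lq d lam j {K..<m}" for j
  proof -
    have "pder \<psi> (ser lq c lam j {..<m}) = ser lq d lam j {..<m}"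
      unfolding ser_def pder_sum by (intro sum.cong refl) (simp add: pder_single d_def mult_ac)
    also have "\<dots> = ser lq d lam j {K..<m}"
      unfolding ser_def by (rule sum.mono_neutral_right) (auto simp: dlt)
    finally show ?thesis .
  qed
  have V: "pder \<psi> (V m i) = qv 0 (\<lambda>j. ser lq d lam j {K..<m}) i" for i
    using coord_cases[OF coord, of i]
    by cases (simp_all add: V_def qvars_coord[OF coord] pder_single \<psi>1 ser)
  have "pder \<psi> (peval tc (Suc M) (V m)) = (\<Sum>j\<le>n. peval (dtc j) M (V m) * ser lq d lam j {K..<m})"
    unfolding pder_peval[OF add] V sum_qvars[OF coord] dtc_def ..
  also have "\<dots> = (\<Sum>j\<le>n. ser lq d lam j {K..<m} * peval (dtc j) M (V m))"
    by (simp only: mult.commute)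
  finally have "pder \<psi> (peval tc (Suc M) (V m)) = \<dots>" .
  hence "(\<Sum>j\<le>n. lookup (ser lq d lam j {K..<m} * peval (dtc j) M (V m)) (lam K + \<nu>)) =
      lookup (pder \<psi> (peval tc (Suc M) (V m))) (lam K + \<nu>)"
    by (simp add: lookup_sum)
  also have "\<dots> = 0" using Mm(1)[OF m(1), of "lam K + \<nu>"] by (simp add: lookup_pder)
  also have "(\<Sum>j\<le>n. lookup (ser lq d lam j {K..<m} * peval (dtc j) M (V m)) (lam K + \<nu>)) =
      (\<Sum>j\<le>n. exp (of_nat j * lam K * lq) * d K * A j)"
  proof (intro sum.cong refl)
    fix j assume j: "j \<in> {..n}"
    have "lookup (peval (dtc j) M (V m)) l = (if l = \<nu> then A j else 0)" if "Re l \<le> Re \<nu>" for l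
    proof -
      have "Re l \<le> Re (lam K) + Re \<nu>" using that Re_lam_pos[of K] by linarith
      thus ?thesis using Mm(2)[OF m(1)] \<delta> j that by auto
    qed
    from lookup_ser_mult_leading[OF this order_refl m(2)]
    show "lookup (ser lq d lam j {K..<m} * peval (dtc j) M (V m)) (lam K + \<nu>) =
      exp (of_nat j * lam K * lq) * d K * A j" by simp
  qed
  also have "\<dots> = Lq K * d K" by (simp add: Lq_def sum_distrib_left mult_ac)
  finally have "Lq K = 0" using dK by simp
  thus ?thesis using dK by (auto simp: d_def)
qed

end

text \<open>Over the rationals 1 and z are linearly independent; the functional comes from extending
  them to a Hamel basis of the complex numbers.\<close>

lemma additive_functional_exists:
  fixes z :: complex
  assumes "z \<notin> \<rat>"
  shows "\<exists>\<psi>::complex \<Rightarrow> complex. (\<forall>s t. \<psi> (s + t) = \<psi> s + \<psi> t) \<and> \<psi> 1 = 0 \<and> \<psi> z \<noteq> 0"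
proof -
  interpret V: vector_space "\<lambda>r x. of_rat r * x :: complex"
    by unfold_locales (auto simp: algebra_simps of_rat_add of_rat_mult)
  interpret P: vector_space_pair "\<lambda>r x. of_rat r * x :: complex" "\<lambda>r x. of_rat r * x :: complex" ..
  have "z \<notin> V.span {1}"
    using assms by (auto simp: V.span_singleton Rats_def)
  hence "V.independent {z, 1}"
    by (rule V.independent_insertI) simp
  from P.linear_independent_extend[OF this, of "\<lambda>x. if x = z then 1 else 0"]
  obtain g where g: "Vector_Spaces.linear (\<lambda>r x. of_rat r * x :: complex) (\<lambda>r x. of_rat r * x :: complex) g"
    "\<forall>x\<in>{z, 1}. g x = (if x = z then 1 else 0)" by blast
  have "g (s + t) = g s + g t" for s t
    using g(1) by (simp add: Vector_Spaces.linear_def module_hom_axioms_def module_hom_def)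
  moreover have "z \<noteq> 1" using assms by auto
  ultimately show ?thesis using g(2) by (intro exI[of _ g]) auto
qed

lemma (in q_equation) exponents_rational:
  assumes "\<And>k. c k \<noteq> 0 \<Longrightarrow> Lq k \<noteq> 0" "c k \<noteq> 0"
  shows "lam k \<in> \<rat>"
proof (rule ccontr)
  assume "lam k \<notin> \<rat>"
  then obtain \<psi> :: "complex \<Rightarrow> complex"
    where \<psi>: "\<And>s t. \<psi> (s + t) = \<psi> s + \<psi> t" "\<psi> 1 = 0" "\<psi> (lam k) \<noteq> 0"
    by (blast dest: additive_functional_exists)
  have "\<psi> (lam k) * c k \<noteq> 0" using \<psi>(3) assms(2) by simp
  with resonance[OF \<psi>(1,2)] assms(1) show False by blast
qed

section \<open>Convergence in sectors\<close>

lemma sector_image: "sector \<alpha> \<beta> = (\<lambda>(r, \<theta>). rcis r \<theta>) ` ({0<..} \<times> {\<alpha><..<\<beta>})"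
  unfolding sector_def image_def by fastforce

lemma connected_sector: "connected (sector \<alpha> \<beta>)"
  unfolding sector_image
proof (rule connected_continuous_image)
  show "continuous_on ({0<..} \<times> {\<alpha><..<\<beta>}) (\<lambda>(r, \<theta>). rcis r \<theta>)"
    unfolding rcis_def cis_conv_exp split_beta by (intro continuous_intros)
  show "connected ({0<..} \<times> {\<alpha><..<\<beta>} :: (real \<times> real) set)"
    by (intro convex_connected convex_Times convex_real_interval)
qed

lemma Ln_rotated_rcis:
  assumes "0 < r" "\<bar>\<theta> - \<theta>0\<bar> < pi"
  shows "Ln (rcis r \<theta> * cis (- \<theta>0)) = of_real (ln r) + \<i> * of_real (\<theta> - \<theta>0)"
    "rcis r \<theta> * cis (- \<theta>0) \<notin> \<real>\<^sub>\<le>\<^sub>0"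
proof -
  let ?w = "of_real (ln r) + \<i> * of_real (\<theta> - \<theta>0)"
  have e: "rcis r \<theta> * cis (- \<theta>0) = exp ?w"
    using assms by (simp add: rcis_def cis_mult exp_add exp_of_real cis_conv_exp exp_add[symmetric] mult.assoc)
      (simp add: algebra_simps)
  have Im: "- pi < Im ?w" "Im ?w < pi" using assms by auto
  thus L: "Ln (rcis r \<theta> * cis (- \<theta>0)) = ?w" unfolding e by (intro Ln_exp) auto
  show "rcis r \<theta> * cis (- \<theta>0) \<notin> \<real>\<^sub>\<le>\<^sub>0"
  proof
    assume "rcis r \<theta> * cis (- \<theta>0) \<in> \<real>\<^sub>\<le>\<^sub>0"
    moreover have "rcis r \<theta> * cis (- \<theta>0) \<noteq> 0" unfolding e by simp
    ultimately have "Im (Ln (rcis r \<theta> * cis (- \<theta>0))) = pi"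
      by (subst Im_Ln_eq_pi) (auto simp: complex_nonpos_Reals_iff complex_eq_iff)
    thus False using Im L by simp
  qed
qed

text \<open>Rotation by the bisecting direction makes the sector symmetric about the positive axis.
  An opening below 2 pi keeps it off the branch cut, so the principal logarithm describes
  it.\<close>

lemma sector_iff:
  assumes "\<alpha> < \<beta>" "\<beta> - \<alpha> < 2 * pi"
  defines "\<theta>0 \<equiv> (\<alpha> + \<beta>) / 2"
  shows "x \<in> sector \<alpha> \<beta> \<longleftrightarrow> x * cis (- \<theta>0) \<in> - \<real>\<^sub>\<le>\<^sub>0 \<and> \<bar>Im (Ln (x * cis (- \<theta>0)))\<bar> < (\<beta> - \<alpha>) / 2"
proof
  assume "x \<in> sector \<alpha> \<beta>"
  then obtain r \<theta> where x: "x = rcis r \<theta>" "0 < r" "\<alpha> < \<theta>" "\<theta> < \<beta>" by (auto simp: sector_def)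
  have "\<bar>\<theta> - \<theta>0\<bar> < (\<beta> - \<alpha>) / 2" using x by (auto simp: \<theta>0_def abs_less_iff field_simps)
  thus "x * cis (- \<theta>0) \<in> - \<real>\<^sub>\<le>\<^sub>0 \<and> \<bar>Im (Ln (x * cis (- \<theta>0)))\<bar> < (\<beta> - \<alpha>) / 2"
    using Ln_rotated_rcis[of r \<theta> \<theta>0] x assms(2) by auto
next
  let ?y = "x * cis (- \<theta>0)"
  assume y: "?y \<in> - \<real>\<^sub>\<le>\<^sub>0 \<and> \<bar>Im (Ln ?y)\<bar> < (\<beta> - \<alpha>) / 2"
  hence y0: "?y \<noteq> 0" by auto
  have "?y = rcis (cmod ?y) (Im (Ln ?y))"
  proof -
    have "?y = exp (Ln ?y)" using y0 by simp
    also have "\<dots> = of_real (exp (Re (Ln ?y))) * cis (Im (Ln ?y))" by (rule exp_eq_polar)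
    finally show ?thesis using y0 by (simp only: Re_Ln rcis_def) simp
  qed
  hence "x = rcis (cmod ?y) (Im (Ln ?y)) * cis \<theta>0"
    by (metis cis_mult cis_zero mult.assoc mult.right_neutral add.commute add.right_inverse minus_minus)
  hence "x = rcis (cmod ?y) (Im (Ln ?y) + \<theta>0)" by (simp add: rcis_def cis_mult mult.assoc)
  moreover have "\<alpha> < Im (Ln ?y) + \<theta>0" "Im (Ln ?y) + \<theta>0 < \<beta>"
    using y by (auto simp: \<theta>0_def abs_less_iff field_simps)
  ultimately show "x \<in> sector \<alpha> \<beta>" using y0 unfolding sector_def
    by (intro CollectI exI[of _ "cmod ?y"] exI[of _ "Im (Ln ?y) + \<theta>0"]) auto
qed

text \<open>The given branch differs from the rotated principal logarithm by a continuous function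
  with constant exponential. Its values lie in a translate of 2 pi i Z, so on the connected sector
  it is constant.\<close>

lemma sector_log:
  assumes ab: "\<alpha> < \<beta>" "\<beta> - \<alpha> < 2 * pi"
    and lg: "continuous_on (sector \<alpha> \<beta>) lg" "\<forall>x\<in>sector \<alpha> \<beta>. exp (lg x) = x"
  shows "open (sector \<alpha> \<beta>)" "lg holomorphic_on sector \<alpha> \<beta>"
    "\<exists>\<Theta>. \<forall>x\<in>sector \<alpha> \<beta>. \<bar>Im (lg x)\<bar> \<le> \<Theta>"
proof -
  let ?S = "sector \<alpha> \<beta>"
  define \<theta>0 where "\<theta>0 = (\<alpha> + \<beta>) / 2"
  define u where "u x = x * cis (- \<theta>0)" for x
  note iff = sector_iff[OF ab, folded \<theta>0_def, folded u_def]
  have "?S = u -` {y \<in> - \<real>\<^sub>\<le>\<^sub>0. Ln y \<in> {z. \<bar>Im z\<bar> < (\<beta> - \<alpha>) / 2}}" using iff by auto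
  also have "{y \<in> - \<real>\<^sub>\<le>\<^sub>0. Ln y \<in> {z. \<bar>Im z\<bar> < (\<beta> - \<alpha>) / 2}} =
      - \<real>\<^sub>\<le>\<^sub>0 \<inter> Ln -` {z. \<bar>Im z\<bar> < (\<beta> - \<alpha>) / 2}" by auto
  also have "open (u -` \<dots>)"
  proof (intro open_vimage continuous_open_preimage)
    show "continuous_on (- \<real>\<^sub>\<le>\<^sub>0) Ln" by (intro continuous_on_Ln continuous_intros) auto
    show "open {z. \<bar>Im z\<bar> < (\<beta> - \<alpha>) / 2}" by (intro open_Collect_less continuous_intros)
    show "continuous_on UNIV u" unfolding u_def by (intro continuous_intros)
  qed (auto simp: open_Compl)
  finally show "open ?S" .
  have hol: "(\<lambda>x. Ln (u x)) holomorphic_on ?S"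
    using iff unfolding u_def by (intro holomorphic_intros) auto
  define g where "g x = lg x - Ln (u x)" for x
  have gexp: "exp (g x) = cis \<theta>0" if "x \<in> ?S" for x
  proof -
    have u0: "u x \<noteq> 0" using iff[of x] that by auto
    have "exp (lg x) = x" using lg(2) that by blast
    hence "exp (g x) = x / u x" using u0 by (simp add: g_def exp_diff)
    moreover have "x = u x * cis \<theta>0" unfolding u_def mult.assoc cis_mult by simp
    ultimately show ?thesis using u0 by (metis nonzero_mult_div_cancel_left)
  qed
  have gd: "\<exists>k::int. g y = g x + of_int (2 * k) * pi * \<i>" if "x \<in> ?S" "y \<in> ?S" for x y
    using gexp[OF that(1)] gexp[OF that(2)] exp_eq[of "g y" "g x"] by simp
  have "g constant_on ?S"
  proof (rule continuous_discrete_range_constant[OF connected_sector])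
    show "continuous_on ?S g"
      unfolding g_def by (intro continuous_intros lg holomorphic_on_imp_continuous_on hol)
    fix x assume x: "x \<in> ?S"
    show "\<exists>e>0. \<forall>y. y \<in> ?S \<and> g y \<noteq> g x \<longrightarrow> e \<le> cmod (g y - g x)"
    proof (intro exI[of _ 1] conjI allI impI)
      fix y assume y: "y \<in> ?S \<and> g y \<noteq> g x"
      then obtain k :: int where k: "g y = g x + of_int (2 * k) * pi * \<i>" using gd x by blast
      with y have "k \<noteq> 0" by auto
      hence "1 \<le> \<bar>k\<bar>" by linarith
      hence "1 \<le> \<bar>real_of_int k\<bar>" by (metis of_int_1 of_int_abs of_int_le_iff)
      hence "1 * 1 \<le> (2 * \<bar>real_of_int k\<bar>) * pi" using pi_gt3 by (intro mult_mono) auto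
      thus "1 \<le> cmod (g y - g x)" by (simp add: k norm_mult)
    qed simp
  qed
  then obtain a where a: "\<And>x. x \<in> ?S \<Longrightarrow> g x = a" by (auto simp: constant_on_def)
  hence lg_eq: "lg x = a + Ln (u x)" if "x \<in> ?S" for x using that by (auto simp: g_def algebra_simps)
  show "lg holomorphic_on ?S"
    by (rule holomorphic_transform[of "\<lambda>x. a + Ln (u x)"]) (auto simp: lg_eq intro!: holomorphic_intros hol)
  show "\<exists>\<Theta>. \<forall>x\<in>?S. \<bar>Im (lg x)\<bar> \<le> \<Theta>"
  proof (intro exI ballI)
    fix x assume x: "x \<in> ?S"
    have "\<bar>Im (Ln (u x))\<bar> < (\<beta> - \<alpha>) / 2" using iff[of x] x by auto
    moreover have "Im (lg x) = Im a + Im (Ln (u x))" using lg_eq[OF x] by simp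
    ultimately show "\<bar>Im (lg x)\<bar> \<le> \<bar>Im a\<bar> + (\<beta> - \<alpha>) / 2" by linarith
  qed
qed

lemma converges_in_sectors_if_summable:
  assumes pos: "\<And>k. 0 < Re (lam k)"
    and im: "0 \<le> \<kappa>" "\<And>k. c k \<noteq> 0 \<Longrightarrow> \<bar>Im (lam k)\<bar> \<le> \<kappa> * Re (lam k)"
    and \<epsilon>: "0 < \<epsilon>" "summable (\<lambda>k. cmod (c k) * \<epsilon> powr Re (lam k))"
  shows "converges_in_sectors c lam"
  unfolding converges_in_sectors_def
proof (intro allI impI)
  fix \<alpha> \<beta> :: real and lg :: "complex \<Rightarrow> complex"
  assume A: "\<alpha> < \<beta> \<and> \<beta> - \<alpha> < 2 * pi \<and> continuous_on (sector \<alpha> \<beta>) lg \<and> (\<forall>x\<in>sector \<alpha> \<beta>. exp (lg x) = x)"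
  let ?S = "sector \<alpha> \<beta>"
  have S: "open ?S" "lg holomorphic_on ?S" "\<exists>\<Theta>. \<forall>x\<in>?S. \<bar>Im (lg x)\<bar> \<le> \<Theta>"
    using sector_log[of \<alpha> \<beta> lg] A by auto
  then obtain \<Theta> where \<Theta>: "\<And>x. x \<in> ?S \<Longrightarrow> \<bar>Im (lg x)\<bar> \<le> \<Theta>" by blast
  \<comment> \<open>|x^\<lambda>| \<le> |x|^(Re \<lambda>) exp (|Im \<lambda>| \<Theta>) and |Im
    \<lambda>| \<le> \<kappa> Re \<lambda>; hence |x| < R gives |x^\<lambda>| \<le> \<epsilon>^(Re
    \<lambda>).\<close>
  define R where "R = \<epsilon> * exp (- \<kappa> * \<Theta>)"
  have bound: "cmod (c k * exp (lam k * lg x)) \<le> cmod (c k) * \<epsilon> powr Re (lam k)"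
    if x: "x \<in> ?S" "cmod x < R" for k x
  proof (cases "c k = 0")
    case False
    have x0: "x \<noteq> 0" using A x(1) by (metis exp_not_eq_zero)
    have "cmod x = exp (Re (lg x))" using A x(1) by (metis norm_exp_eq_Re)
    hence "Re (lg x) = ln (cmod x)" by simp
    also have "\<dots> \<le> ln R"
      using x(2) x0 norm_ge_zero[of x] by (subst ln_le_cancel_iff) (auto simp del: norm_ge_zero)
    also have "\<dots> = ln \<epsilon> - \<kappa> * \<Theta>" using \<epsilon>(1) by (simp add: R_def ln_mult)
    finally have re: "Re (lg x) \<le> ln \<epsilon> - \<kappa> * \<Theta>" .
    have \<Theta>0: "0 \<le> \<Theta>" using \<Theta>[OF x(1)] by linarith
    have "Re (lam k * lg x) \<le> Re (lam k) * Re (lg x) + \<bar>Im (lam k)\<bar> * \<bar>Im (lg x)\<bar>"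
      by (simp add: abs_mult[symmetric])
    also have "\<dots> \<le> Re (lam k) * (ln \<epsilon> - \<kappa> * \<Theta>) + (\<kappa> * Re (lam k)) * \<Theta>"
      using pos[of k] im False \<Theta>[OF x(1)] \<Theta>0 re
      by (intro add_mono mult_left_mono mult_mono) (auto simp: less_imp_le)
    also have "\<dots> = Re (lam k) * ln \<epsilon>" by (simp add: algebra_simps)
    finally have "exp (Re (lam k * lg x)) \<le> \<epsilon> powr Re (lam k)" using \<epsilon>(1) by (simp add: powr_def)
    thus ?thesis unfolding norm_mult norm_exp_eq_Re by (rule mult_left_mono) simp
  qed simp
  have R: "0 < R" using \<epsilon>(1) by (simp add: R_def)
  show "\<exists>R>0. \<forall>r. 0 < r \<and> r \<le> R \<longrightarrow>
      (\<exists>f. uniform_limit (?S \<inter> ball 0 r) (\<lambda>K x. \<Sum>k<K. c k * exp (lam k * lg x)) f sequentially \<and>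
           f holomorphic_on (?S \<inter> ball 0 r))"
  proof (intro exI[of _ R] conjI R allI impI)
    fix r assume r: "0 < r \<and> r \<le> R"
    let ?A = "?S \<inter> ball 0 r"
    let ?f = "\<lambda>x. suminf (\<lambda>k. c k * exp (lam k * lg x))"
    have ul: "uniform_limit ?A (\<lambda>K x. \<Sum>k<K. c k * exp (lam k * lg x)) ?f sequentially"
      by (rule Weierstrass_m_test[OF _ \<epsilon>(2)]) (use bound r in auto)
    have opA: "open ?A" using S by auto
    have "?f holomorphic_on ?A"
    proof (rule holomorphic_uniform_sequence[OF opA])
      show "(\<lambda>x. \<Sum>k<K. c k * exp (lam k * lg x)) holomorphic_on ?A" for K
        by (intro holomorphic_intros holomorphic_on_subset[OF S(2)]) auto
      fix x assume "x \<in> ?A"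
      then obtain d where "0 < d" "cball x d \<subseteq> ?A" using opA open_contains_cball by blast
      thus "\<exists>d>0. cball x d \<subseteq> ?A \<and>
          uniform_limit (cball x d) (\<lambda>K x. \<Sum>k<K. c k * exp (lam k * lg x)) ?f sequentially"
        using uniform_limit_on_subset[OF ul] by blast
    qed
    with ul show "\<exists>f. uniform_limit ?A (\<lambda>K x. \<Sum>k<K. c k * exp (lam k * lg x)) f sequentially \<and>
           f holomorphic_on ?A" by blast
  qed
qed

section \<open>Divisors\<close>

text \<open>Passage from the logarithmic form to |q^l - a|. Put h = q^l / a - 1. If |h| < 1/2, then
  |Ln (1 + h)| \<le> 2 |h|, and Ln (1 + h) is one of the numbers bounded from below. If |h| \<ge>
  1/2, this is enough, since the total degree is at least 1 and its negative power at most
  1.\<close>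

lemma diophantine_bound:
  assumes "diophantine \<tau> \<rho> lq a" "a \<noteq> 0"
  shows "\<exists>c>0. \<exists>\<gamma>>0. \<forall>m. (\<exists>i<\<tau>. m i \<noteq> 0) \<longrightarrow>
    c * real (\<Sum>i<\<tau>. m i) powr (- \<gamma>) \<le> cmod (exp ((\<Sum>i<\<tau>. of_nat (m i) * \<rho> i) * lq) - a)"
proof -
  obtain c \<gamma> where c: "c > 0" "\<gamma> > 0" and dio: "\<And>m (k::int). \<exists>i<\<tau>. m i \<noteq> 0 \<Longrightarrow>
        cmod ((\<Sum>i<\<tau>. of_nat (m i) * \<rho> i) * lq - Ln a - 2 * of_real pi * of_int k * \<i>)
          > c * real (\<Sum>i<\<tau>. m i) powr (- \<gamma>)"
    using assms(1) unfolding diophantine_def by blast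
  let ?c = "cmod a * min (c / 2) (1 / 2)"
  have "?c * real (\<Sum>i<\<tau>. m i) powr (- \<gamma>) \<le> cmod (exp ((\<Sum>i<\<tau>. of_nat (m i) * \<rho> i) * lq) - a)"
    if m: "\<exists>i<\<tau>. m i \<noteq> 0" for m :: "nat \<Rightarrow> nat"
  proof -
    define s where "s = (\<Sum>i<\<tau>. m i)"
    define w where "w = (\<Sum>i<\<tau>. of_nat (m i) * \<rho> i) * lq"
    define h where "h = exp (w - Ln a) - 1"
    have s1: "1 \<le> s"
      using m member_le_sum[of _ "{..<\<tau>}" m] unfolding s_def
      by (metis finite_lessThan lessThan_iff le0 less_one not_le order_trans)
    have "min (c / 2) (1 / 2) * real s powr (- \<gamma>) \<le> cmod h"
    proof (cases "cmod h < 1/2")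
      case True
      have "exp (w - Ln a) = exp (Ln (1 + h))" by (simp add: h_def)
      then obtain k :: int where "w - Ln a = Ln (1 + h) + (of_int (2 * k) * pi) * \<i>"
        unfolding exp_eq by blast
      hence "Ln (1 + h) = w - Ln a - 2 * of_real pi * of_int k * \<i>" by (simp add: algebra_simps)
      hence "c * real s powr (- \<gamma>) < 2 * cmod h"
        using dio[OF m, of k] norm_Ln_le[OF True] unfolding s_def w_def by simp
      moreover have "min (c / 2) (1 / 2) * real s powr (- \<gamma>) \<le> c / 2 * real s powr (- \<gamma>)"
        by (intro mult_right_mono) auto
      ultimately show ?thesis by simp
    next
      case False
      have "real s powr (- \<gamma>) \<le> 1" using powr_mono[of "- \<gamma>" 0 "real s"] s1 c by simp
      hence "min (c / 2) (1 / 2) * real s powr (- \<gamma>) \<le> 1 / 2 * 1"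
        using c by (intro mult_mono) auto
      thus ?thesis using False by simp
    qed
    hence "cmod a * (min (c / 2) (1 / 2) * real s powr (- \<gamma>)) \<le> cmod a * cmod h"
      by (rule mult_left_mono) simp
    also have "cmod a * cmod h = cmod (a * h)" by (rule norm_mult[symmetric])
    also have "a * h = exp w - a"
      using assms(2) by (simp add: h_def exp_diff right_diff_distrib)
    finally show ?thesis by (simp add: s_def w_def mult.assoc)
  qed
  moreover have "0 < ?c" using c assms by simp
  ultimately show ?thesis using c(2) by blast
qed

text \<open>Used with w = i and w = -i for the cone containing the exponents, and with w = ln q and
  w = -ln q for the size of q^l.\<close>

lemma add_semigroup_Re_le:
  assumes "\<And>i. i < \<tau> \<Longrightarrow> Re (\<rho> i * w) \<le> \<kappa> * Re (\<rho> i)" "l \<in> add_semigroup \<tau> \<rho>"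
  shows "Re (l * w) \<le> \<kappa> * Re l"
proof -
  obtain m :: "nat \<Rightarrow> nat" where l: "l = (\<Sum>i<\<tau>. of_nat (m i) * \<rho> i)"
    using assms(2) by (auto simp: add_semigroup_def)
  have "Re (l * w) = (\<Sum>i<\<tau>. real (m i) * Re (\<rho> i * w))"
    unfolding l sum_distrib_right Re_sum by (intro sum.cong refl) (simp add: algebra_simps)
  also have "\<dots> \<le> (\<Sum>i<\<tau>. real (m i) * (\<kappa> * Re (\<rho> i)))"
    by (intro sum_mono mult_left_mono assms) auto
  also have "\<dots> = \<kappa> * Re l" unfolding l Re_sum sum_distrib_left by (intro sum.cong refl) simp
  finally show ?thesis .
qed

lemma add_semigroup_Im_bound:
  assumes pos: "\<forall>i<\<tau>. 0 < Re (\<rho> i)"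
  obtains \<kappa> where "0 \<le> \<kappa>" "\<And>l. l \<in> add_semigroup \<tau> \<rho> \<Longrightarrow> \<bar>Im l\<bar> \<le> \<kappa> * Re l"
proof -
  define \<kappa> where "\<kappa> = (\<Sum>i<\<tau>. \<bar>Im (\<rho> i)\<bar> / Re (\<rho> i))"
  have nn: "0 \<le> \<bar>Im (\<rho> i)\<bar> / Re (\<rho> i)" if "i < \<tau>" for i using pos that by (simp add: less_imp_le)
  have i: "\<bar>Im (\<rho> i)\<bar> \<le> \<kappa> * Re (\<rho> i)" if "i < \<tau>" for i
  proof -
    have "\<bar>Im (\<rho> i)\<bar> / Re (\<rho> i) \<le> \<kappa>" unfolding \<kappa>_def using nn that by (intro member_le_sum) auto
    thus ?thesis using pos that by (simp add: pos_divide_le_eq)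
  qed
  have "\<bar>Im l\<bar> \<le> \<kappa> * Re l" if l: "l \<in> add_semigroup \<tau> \<rho>" for l
    using add_semigroup_Re_le[of \<tau> \<rho> \<i> \<kappa> l] add_semigroup_Re_le[of \<tau> \<rho> "- \<i>" \<kappa> l] i l
    by (force simp: abs_le_iff)
  moreover have "0 \<le> \<kappa>" unfolding \<kappa>_def using nn by (intro sum_nonneg) auto
  ultimately show ?thesis using that by blast
qed

lemma add_semigroup_strict:
  assumes pos: "\<forall>i<\<tau>. 0 < Re (\<rho> i)" and neg: "\<forall>i<\<tau>. Re (\<rho> i * w) < 0"
  obtains \<gamma> where "0 < \<gamma>" "\<And>l. l \<in> add_semigroup \<tau> \<rho> \<Longrightarrow> Re (l * w) \<le> - \<gamma> * Re l"
proof -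
  \<comment> \<open>The inserted 1 keeps the minimum defined when there are no generators.\<close>
  define \<gamma> where "\<gamma> = Min (insert 1 ((\<lambda>i. - Re (\<rho> i * w) / Re (\<rho> i)) ` {..<\<tau>}))"
  have "0 < \<gamma>" unfolding \<gamma>_def using pos neg by (subst Min_gr_iff) (auto simp: divide_less_0_iff)
  moreover have "Re (l * w) \<le> - \<gamma> * Re l" if "l \<in> add_semigroup \<tau> \<rho>" for l
  proof (rule add_semigroup_Re_le[OF _ that])
    fix i assume i: "i < \<tau>"
    have "\<gamma> \<le> - Re (\<rho> i * w) / Re (\<rho> i)" unfolding \<gamma>_def using i by (intro Min_le) auto
    hence "\<gamma> * Re (\<rho> i) \<le> - Re (\<rho> i * w)" using pos i by (simp add: pos_le_divide_eq)
    thus "Re (\<rho> i * w) \<le> - \<gamma> * Re (\<rho> i)" by simp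
  qed
  ultimately show ?thesis using that by blast
qed

context q_equation
begin

section \<open>From divisor estimates to absolute convergence\<close>

abbreviation abs_convergent :: bool where
  "abs_convergent \<equiv> \<exists>\<epsilon>>0. summable (\<lambda>k. cmod (c k) * \<epsilon> powr Re (lam k))"

definition Lpoly :: "complex poly" where
  "Lpoly = (\<Sum>j\<le>n. monom (A j) j)"

lemma exp_of_nat: "exp (of_nat j * lam k * lq) = exp (lam k * lq) ^ j"
  by (simp add: exp_of_nat_mult[symmetric] mult.assoc)

lemma Lq_poly: "Lq k = poly Lpoly (exp (lam k * lq))"
  by (simp add: Lq_def Lpoly_def poly_sum poly_monom exp_of_nat)

lemma Lpoly_nonzero: "Lpoly \<noteq> 0"
proof -
  obtain j where j: "j \<le> n" "A j \<noteq> 0" using A_nonzero by blast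
  have "coeff Lpoly j = A j" using j by (simp add: Lpoly_def coeff_sum sum.delta')
  thus ?thesis using j by auto
qed

text \<open>Exponential growth of \<open>\<Omega>\<close> costs only radius:
  \<open>\<epsilon>\<close> is replaced by \<open>\<epsilon> / G\<close>.\<close>

lemma summable_if_majorant_bounded:
  assumes N: "\<And>k. N \<le> k \<Longrightarrow> m0 < Re (lam k)"
    and B: "\<And>k. N \<le> k \<Longrightarrow> c k \<noteq> 0 \<Longrightarrow> 1 \<le> B k"
    and \<Omega>: "0 < G" "\<And>t. 1 \<le> \<Omega> t" "\<And>t. 0 \<le> t \<Longrightarrow> \<Omega> t \<le> G powr t"
    and \<epsilon>: "0 < \<epsilon>" "\<And>K. (\<Sum>k\<in>{N..<K}. majorant B \<Omega> m0 \<epsilon> k) \<le> 1"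
  shows abs_convergent
proof (intro exI conjI)
  let ?e = "\<epsilon> / G"
  let ?f = "\<lambda>k. cmod (c k) * ?e powr (Re (lam k) - m0)"
  show "0 < ?e" using \<epsilon> \<Omega> by simp
  have le: "?f k \<le> majorant B \<Omega> m0 \<epsilon> k" if k: "N \<le> k" for k
  proof (cases "c k = 0")
    case False
    let ?t = "Re (lam k) - m0"
    have "0 < \<Omega> ?t" using \<Omega>(2)[of ?t] by linarith
    hence pos: "0 < G powr ?t * \<Omega> ?t" using \<Omega>(1) by simp
    have "?e powr ?t = 1 * (\<epsilon> powr ?t / G powr ?t)" using \<epsilon> \<Omega> by (simp add: powr_divide)
    also have "\<dots> \<le> B k * (\<epsilon> powr ?t / \<Omega> ?t)"
      using B[OF k False] \<Omega>(3)[of ?t] N[OF k] pos by (intro mult_mono divide_left_mono) auto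
    finally have "?f k \<le> cmod (c k) * (B k * (\<epsilon> powr ?t / \<Omega> ?t))" by (rule mult_left_mono) simp
    thus ?thesis by (simp add: majorant_def mult.assoc)
  qed (simp add: majorant_def)
  have "summable (\<lambda>k. ?f (k + N))"
  proof (rule summableI_nonneg_bounded)
    fix K
    have "(\<Sum>k<K. ?f (k + N)) = (\<Sum>k\<in>{N..<K + N}. ?f k)"
      using sum.shift_bounds_nat_ivl[of ?f 0 N K] by (simp add: atLeast0LessThan add.commute)
    also have "\<dots> \<le> (\<Sum>k\<in>{N..<K + N}. majorant B \<Omega> m0 \<epsilon> k)" by (intro sum_mono le) auto
    also have "\<dots> \<le> 1" by (rule \<epsilon>)
    finally show "(\<Sum>k<K. ?f (k + N)) \<le> 1" .
  qed simp
  hence "summable ?f" by (subst (asm) summable_iff_shift)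
  hence "summable (\<lambda>k. ?e powr m0 * ?f k)" by (rule summable_mult)
  also have "(\<lambda>k. ?e powr m0 * ?f k) = (\<lambda>k. cmod (c k) * ?e powr Re (lam k))"
    by (rule ext) (simp add: powr_add[symmetric] mult.left_commute)
  finally show "summable (\<lambda>k. cmod (c k) * ?e powr Re (lam k))" .
qed

text \<open>Here \<open>\<Omega>\<close> is constantly 1: the divisor by itself dominates all the
  powers |q^\<lambda>|^j, up to a constant.\<close>

lemma no_small_divisors:
  assumes D: "0 < D" and m0: "Re \<nu> < m0" and N: "\<And>k. N \<le> k \<Longrightarrow> m0 < Re (lam k)"
    and B: "\<And>k j. N \<le> k \<Longrightarrow> c k \<noteq> 0 \<Longrightarrow> j \<le> n \<Longrightarrow> cmod (exp (lam k * lq)) ^ j \<le> B k"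
    and BD: "\<And>k. N \<le> k \<Longrightarrow> c k \<noteq> 0 \<Longrightarrow> B k \<le> D * cmod (Lq k)"
  shows abs_convergent
proof -
  have B': "cmod (exp (of_nat j * lam k * lq)) \<le> B k" if "N \<le> k" "c k \<noteq> 0" "j \<le> n" for j k
    unfolding exp_of_nat norm_power by (rule B[OF that])
  have sw: "super_weight (\<lambda>_. 1)" by (simp add: super_weight_def)
  obtain \<epsilon> where "0 < \<epsilon>" "\<And>K. (\<Sum>k\<in>{N..<K}. majorant B (\<lambda>_. 1) m0 \<epsilon> k) \<le> 1"
    by (rule majorant_bounded[OF m0 N sw B' D, of N]) (use BD in auto)
  thus ?thesis
    using B[of _ 0] by (intro summable_if_majorant_bounded[OF N, of N B 1 "\<lambda>_. 1"]) auto
qed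

lemma exp_lam_small:
  assumes "0 < \<gamma>" "0 < \<eta>"
  shows "\<exists>N. \<forall>k\<ge>N. m0 < Re (lam k) \<and> exp (- \<gamma> * Re (lam k)) < \<eta>"
proof -
  obtain N where N: "\<forall>k\<ge>N. max m0 (- ln \<eta> / \<gamma>) < Re (lam k)" using Re_lam_large by blast
  have "exp (- \<gamma> * Re (lam k)) < \<eta>" if "N \<le> k" for k
  proof -
    have "- ln \<eta> / \<gamma> < Re (lam k)" using N that by auto
    hence "- \<gamma> * Re (lam k) < ln \<eta>" using assms by (simp add: field_simps)
    hence "exp (- \<gamma> * Re (lam k)) < exp (ln \<eta>)" by (subst exp_less_cancel_iff)
    thus ?thesis using assms by simp
  qed
  thus ?thesis using N by auto
qed

lemma poly_near_0:
  fixes p :: "complex poly"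
  assumes "coeff p 0 \<noteq> 0"
  obtains \<eta> where "0 < \<eta>" "\<And>z. cmod z < \<eta> \<Longrightarrow> cmod (coeff p 0) / 2 \<le> cmod (poly p z)"
proof -
  have "isCont (poly p) 0" by simp
  hence "(poly p \<longlongrightarrow> coeff p 0) (nhds 0)"
    unfolding isCont_def poly_0_coeff_0[symmetric] by (simp only: tendsto_at_iff_tendsto_nhds)
  hence "\<forall>\<^sub>F z in nhds 0. dist (poly p z) (coeff p 0) < cmod (coeff p 0) / 2"
    using assms by (intro tendstoD) auto
  then obtain \<eta> where \<eta>: "0 < \<eta>" "\<And>z. dist z 0 < \<eta> \<Longrightarrow> dist (poly p z) (coeff p 0) < cmod (coeff p 0) / 2"
    unfolding eventually_nhds_metric by blast
  show ?thesis
  proof (rule that[OF \<eta>(1)])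
    fix z :: complex assume "cmod z < \<eta>"
    hence "cmod (poly p z - coeff p 0) < cmod (coeff p 0) / 2" using \<eta>(2)[of z] by (simp add: dist_norm)
    thus "cmod (coeff p 0) / 2 \<le> cmod (poly p z)"
      using norm_triangle_ineq2[of "coeff p 0" "poly p z"] by (simp add: norm_minus_commute)
  qed
qed

lemma coeff_Lpoly: "j \<le> n \<Longrightarrow> coeff Lpoly j = A j"
  by (simp add: Lpoly_def coeff_sum sum.delta')

text \<open>q^\<lambda> tends to 0 along the exponents, so L(q^\<lambda>) tends to
  \<open>A 0\<close>, and all powers of |q^\<lambda>| are at most 1.\<close>

lemma summable_inside:
  assumes A0: "A 0 \<noteq> 0" and \<gamma>: "0 < \<gamma>" "\<And>k. c k \<noteq> 0 \<Longrightarrow> Re (lam k * lq) \<le> - \<gamma> * Re (lam k)"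
  shows abs_convergent
proof -
  have cA: "coeff Lpoly 0 = A 0" by (simp add: coeff_Lpoly)
  with A0 obtain \<eta> where \<eta>: "0 < \<eta>" "\<And>z. cmod z < \<eta> \<Longrightarrow> cmod (A 0) / 2 \<le> cmod (poly Lpoly z)"
    using poly_near_0[of Lpoly] by metis
  obtain N where N: "\<And>k. N \<le> k \<Longrightarrow> Re \<nu> + 1 < Re (lam k)" "\<And>k. N \<le> k \<Longrightarrow> exp (- \<gamma> * Re (lam k)) < \<eta>"
    using exp_lam_small[OF \<gamma>(1) \<eta>(1), of "Re \<nu> + 1"] by blast
  have z: "cmod (exp (lam k * lq)) \<le> exp (- \<gamma> * Re (lam k))" if "c k \<noteq> 0" for k
    unfolding norm_exp_eq_Re using \<gamma>(2)[OF that] by simp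
  show ?thesis
  proof (rule no_small_divisors[of "2 / cmod (A 0)" "Re \<nu> + 1" N "\<lambda>_. 1"])
    fix k assume k: "N \<le> k" "c k \<noteq> 0"
    have "exp (- \<gamma> * Re (lam k)) \<le> 1" using \<gamma>(1) Re_lam_pos[of k] by simp
    with z[OF k(2)] have "cmod (exp (lam k * lq)) \<le> 1" by (rule order_trans)
    thus "cmod (exp (lam k * lq)) ^ j \<le> 1" for j by (simp add: power_le_one)
    have "cmod (A 0) / 2 \<le> cmod (Lq k)"
      unfolding Lq_poly using z[OF k(2)] N(2)[OF k(1)] by (intro \<eta>(2)) linarith
    thus "1 \<le> 2 / cmod (A 0) * cmod (Lq k)" using A0 by (simp add: field_simps)
  qed (use A0 N in auto)
qed

text \<open>Mirror image of the inner case: L(z) = z^n R(1/z) with the reversed polynomial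
  \<open>R\<close>, whose constant term is \<open>A n\<close>. The divisor grows like
  |q^\<lambda>|^n, which is just what \<open>B\<close> has to be.\<close>

lemma summable_outside:
  assumes An: "A n \<noteq> 0" and \<gamma>: "0 < \<gamma>" "\<And>k. c k \<noteq> 0 \<Longrightarrow> \<gamma> * Re (lam k) \<le> Re (lam k * lq)"
  shows abs_convergent
proof -
  define R where "R = (\<Sum>i\<le>n. monom (A (n - i)) i)"
  have cR: "coeff R 0 = A n" by (simp add: R_def coeff_sum sum.delta')
  have R: "poly Lpoly z = z ^ n * poly R (inverse z)" if "z \<noteq> 0" for z
  proof -
    have "poly Lpoly z = (\<Sum>i\<le>n. A (n - i) * z ^ (n - i))"
      unfolding Lpoly_def poly_sum poly_monom
      using sum.nat_diff_reindex[of "\<lambda>j. A j * z ^ j" "Suc n"] by (simp add: lessThan_Suc_atMost)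
    also have "\<dots> = (\<Sum>i\<le>n. z ^ n * (A (n - i) * inverse z ^ i))"
      using that by (intro sum.cong refl) (simp add: power_diff field_simps)
    finally show ?thesis by (simp add: R_def poly_sum poly_monom sum_distrib_left)
  qed
  from cR An obtain \<eta> where \<eta>: "0 < \<eta>" "\<And>z. cmod z < \<eta> \<Longrightarrow> cmod (A n) / 2 \<le> cmod (poly R z)"
    using poly_near_0[of R] by metis
  obtain N where N: "\<And>k. N \<le> k \<Longrightarrow> Re \<nu> + 1 < Re (lam k)" "\<And>k. N \<le> k \<Longrightarrow> exp (- \<gamma> * Re (lam k)) < \<eta>"
    using exp_lam_small[OF \<gamma>(1) \<eta>(1), of "Re \<nu> + 1"] by blast
  have z: "cmod (inverse (exp (lam k * lq))) \<le> exp (- \<gamma> * Re (lam k))" if "c k \<noteq> 0" for k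
    unfolding exp_minus[symmetric] norm_exp_eq_Re using \<gamma>(2)[OF that] by simp
  show ?thesis
  proof (rule no_small_divisors[of "2 / cmod (A n)" "Re \<nu> + 1" N "\<lambda>k. cmod (exp (lam k * lq)) ^ n"])
    fix k assume k: "N \<le> k" "c k \<noteq> 0"
    have "0 \<le> \<gamma> * Re (lam k)" using \<gamma>(1) Re_lam_pos[of k] by simp
    hence "1 \<le> cmod (exp (lam k * lq))"
      unfolding norm_exp_eq_Re using \<gamma>(2)[OF k(2)] by simp
    thus "cmod (exp (lam k * lq)) ^ j \<le> cmod (exp (lam k * lq)) ^ n" if "j \<le> n" for j
      using that by (rule power_increasing[rotated])
    have "cmod (A n) / 2 \<le> cmod (poly R (inverse (exp (lam k * lq))))"
      using z[OF k(2)] N(2)[OF k(1)] by (intro \<eta>(2)) linarith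
    hence "cmod (exp (lam k * lq)) ^ n * (cmod (A n) / 2) \<le> cmod (Lq k)"
      unfolding Lq_poly R[OF exp_not_eq_zero] norm_mult norm_power by (intro mult_left_mono) auto
    thus "cmod (exp (lam k * lq)) ^ n \<le> 2 / cmod (A n) * cmod (Lq k)" using An by (simp add: field_simps)
  qed (use An N in auto)
qed

text \<open>The one-dimensional small divisor problem. On the unit circle |z k - z l| = |q^((k - l)
  \<omega>) - 1|, so the estimate for the root 1 supplies the mutual distance of the values
  q^\<lambda>, and \<open>root\<close> supplies their distance from the roots of L.\<close>

lemma summable_circle:
  fixes \<omega> :: real
  assumes \<omega>: "0 < \<omega>" "\<And>k. c k \<noteq> 0 \<Longrightarrow> lam k \<in> (\<lambda>s. of_nat s * of_real \<omega>) ` I"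
    and lq: "Re lq = 0"
    and c1: "0 < c1" "0 < \<gamma>1" "\<And>d. 0 < d \<Longrightarrow> c1 * real d powr (- \<gamma>1) \<le> cmod (exp (of_nat d * of_real \<omega> * lq) - 1)"
    and root: "\<And>a. poly Lpoly a = 0 \<Longrightarrow> cmod a = 1 \<Longrightarrow> \<exists>c2>0. \<exists>\<gamma>2>0. \<forall>s\<in>I. 0 < s \<longrightarrow>
        c2 * real s powr (- \<gamma>2) \<le> cmod (exp (of_nat s * of_real \<omega> * lq) - a)"
  shows abs_convergent
proof -
  \<comment> \<open>\<open>m0\<close> is taken as a multiple of \<open>\<omega>\<close>, so that the
    shifted exponents are again multiples k \<omega>, with k = s - p.\<close>
  obtain p :: nat where p: "Re \<nu> / \<omega> < real p" using reals_Archimedean2 by blast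
  define m0 where "m0 = real p * \<omega>"
  have m0: "Re \<nu> < m0" using p \<omega> by (simp add: m0_def field_simps)
  obtain N where N: "\<And>k. N \<le> k \<Longrightarrow> m0 < Re (lam k)" using Re_lam_large by blast
  define J where "J = {k. 0 < k \<and> p + k \<in> I}"
  define z where "z k = exp (of_nat (p + k) * of_real \<omega> * lq)" for k
  have z1: "cmod (z k) = 1" for k using lq by (simp add: z_def norm_exp_eq_Re)
  have "tame J (\<lambda>k. cmod (z k - a))" if a: "poly Lpoly a = 0" for a
  proof (cases "cmod a = 1")
    case False
    show ?thesis
    proof (rule tame_lower_bound)
      show "0 < \<bar>cmod a - 1\<bar>" using False by simp
      show "\<bar>cmod a - 1\<bar> \<le> cmod (z k - a)" for k
        using norm_triangle_ineq3[of "z k" a] z1[of k] by (simp add: abs_minus_commute)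
    qed
  next
    case True
    then obtain c2 \<gamma>2 where c2: "0 < c2" "0 < \<gamma>2" "\<And>s. s \<in> I \<Longrightarrow> 0 < s \<Longrightarrow>
        c2 * real s powr (- \<gamma>2) \<le> cmod (exp (of_nat s * of_real \<omega> * lq) - a)"
      using root[OF a] by blast
    \<comment> \<open>One exponent and one constant must serve both estimates. Since p + k \<le> (p
      + 1) k for k \<ge> 1, the bound at the original index p + k becomes one at k, at the cost of a
      power of p + 1.\<close>
    define g where "g = max \<gamma>1 \<gamma>2"
    define c3 where "c3 = min c1 (c2 * real (Suc p) powr (- g))"
    have c3: "0 < c3" "c3 \<le> c1" "c3 \<le> c2 * real (Suc p) powr (- g)" using c1 c2 by (auto simp: c3_def)
    have g: "0 < g" "\<gamma>1 \<le> g" "\<gamma>2 \<le> g" using c1 by (auto simp: g_def)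
    show ?thesis
    proof (rule tame_small_divisors[OF c3(1) g(1)])
      fix k assume k: "k \<in> J" "0 < k"
      have "real (p + k) \<le> real (Suc p * k)" using k by (cases k) (auto simp: algebra_simps)
      hence "real (Suc p * k) powr (- g) \<le> real (p + k) powr (- g)"
        using k g by (intro powr_mono2') auto
      also have "\<dots> \<le> real (p + k) powr (- \<gamma>2)" using k g by (intro powr_mono) auto
      finally have "real (Suc p) powr (- g) * real k powr (- g) \<le> real (p + k) powr (- \<gamma>2)"
        by (simp only: of_nat_mult powr_mult)
      hence "c2 * (real (Suc p) powr (- g) * real k powr (- g)) \<le> c2 * real (p + k) powr (- \<gamma>2)"
        using c2 by (intro mult_left_mono) auto
      moreover have "c3 * real k powr (- g) \<le> c2 * real (Suc p) powr (- g) * real k powr (- g)"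
        by (intro mult_right_mono c3) auto
      moreover have "c2 * real (p + k) powr (- \<gamma>2) \<le> cmod (z k - a)"
        using k unfolding z_def by (intro c2(3)) (auto simp: J_def)
      ultimately show "c3 * real k powr (- g) \<le> cmod (z k - a)" by (simp add: mult.assoc)
    next
      fix k l assume kl: "k \<in> J" "l \<in> J" "l < k"
      have "z k = z l * exp (of_nat (k - l) * of_real \<omega> * lq)"
        using kl by (simp add: z_def exp_add[symmetric] of_nat_diff algebra_simps)
      hence "z k - z l = z l * (exp (of_nat (k - l) * of_real \<omega> * lq) - 1)" by (simp add: algebra_simps)
      hence "cmod (z k - z l) = cmod (exp (of_nat (k - l) * of_real \<omega> * lq) - 1)"
        by (simp add: norm_mult z1)
      moreover have "c3 * real (k - l) powr (- g) \<le> c1 * real (k - l) powr (- \<gamma>1)"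
        using c3 g kl c1 by (intro mult_mono powr_mono) auto
      moreover have "c1 * real (k - l) powr (- \<gamma>1) \<le> cmod (exp (of_nat (k - l) * of_real \<omega> * lq) - 1)"
        using kl by (intro c1) simp
      ultimately show "c3 * real (k - l) powr (- g) \<le> cmod (z k - z l)" by simp
    qed
  qed
  \<comment> \<open>L is factored over its roots, and tameness passes to products with
    multiplicities.\<close>
  hence "tame J (\<lambda>k. cmod (lead_coeff Lpoly) * (\<Prod>a | poly Lpoly a = 0. cmod (z k - a) ^ order a Lpoly))"
    using Lpoly_nonzero
    by (intro tame_mult[OF tame_lower_bound[of "cmod (lead_coeff Lpoly)"]] tame_prod tame_power
        poly_roots_finite) auto
  also have "(\<lambda>k. cmod (lead_coeff Lpoly) * (\<Prod>a | poly Lpoly a = 0. cmod (z k - a) ^ order a Lpoly)) =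
      (\<lambda>k. cmod (poly Lpoly (z k)))"
  proof
    fix k
    have "poly Lpoly (z k) = lead_coeff Lpoly * (\<Prod>a | poly Lpoly a = 0. (z k - a) ^ order a Lpoly)"
      using arg_cong[OF complex_poly_decompose[of Lpoly], of "\<lambda>p. poly p (z k)"]
      by (simp add: poly_prod)
    thus "cmod (lead_coeff Lpoly) * (\<Prod>a | poly Lpoly a = 0. cmod (z k - a) ^ order a Lpoly) =
        cmod (poly Lpoly (z k))"
      by (simp add: norm_mult prod_norm[symmetric] norm_power)
  qed
  finally have "tame J (\<lambda>k. cmod (poly Lpoly (z k)))" .
  then obtain W C b where W: "C > 0" "b \<ge> 1" "\<And>k. 1 \<le> W k" "\<And>k. W k \<le> b ^ k"
    "\<And>i j. W i * W j \<le> W (i + j)"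
    "\<And>k l. k \<in> J \<Longrightarrow> l < k \<Longrightarrow> W l \<le> C * cmod (poly Lpoly (z k)) * W k"
    unfolding tame_def by metis
  have Wmono: "W i \<le> W j" if "i \<le> j" for i j
  proof -
    have "W i * 1 \<le> W i * W (j - i)" using W(3)[of i] by (intro mult_left_mono W) auto
    also have "\<dots> \<le> W j" using W(5)[of i "j - i"] that by simp
    finally show ?thesis by simp
  qed
  \<comment> \<open>The weight on indices becomes one on real numbers by rounding down;
    superadditivity of the floor keeps it supermultiplicative.\<close>
  define \<Omega> where "\<Omega> t = W (nat \<lfloor>t / \<omega>\<rfloor>)" for t
  have sw: "super_weight \<Omega>" unfolding super_weight_def
  proof (intro conjI allI impI)
    show "1 \<le> \<Omega> t" for t by (simp add: \<Omega>_def W)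
    fix s t :: real assume st: "0 \<le> s" "0 \<le> t"
    have "nat \<lfloor>s / \<omega>\<rfloor> + nat \<lfloor>t / \<omega>\<rfloor> = nat (\<lfloor>s / \<omega>\<rfloor> + \<lfloor>t / \<omega>\<rfloor>)"
      using st \<omega> by (subst nat_add_distrib) auto
    also have "\<dots> \<le> nat \<lfloor>(s + t) / \<omega>\<rfloor>"
      unfolding add_divide_distrib by (intro nat_mono le_floor_add)
    finally show "\<Omega> s * \<Omega> t \<le> \<Omega> (s + t)"
      unfolding \<Omega>_def by (intro order_trans[OF W(5)] Wmono)
  qed
  have index: "\<exists>k'. k' \<in> J \<and> Re (lam k) - m0 = real k' * \<omega> \<and> Lq k = poly Lpoly (z k') \<and>
       cmod (exp (lam k * lq)) = 1" if k: "N \<le> k" "c k \<noteq> 0" for k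
  proof -
    obtain s where s: "s \<in> I" "lam k = of_nat s * of_real \<omega>" using \<omega>(2)[OF k(2)] by auto
    have "real p * \<omega> < real s * \<omega>" using N[OF k(1)] s by (simp add: m0_def)
    hence ps: "p < s" using \<omega> by simp
    show ?thesis
    proof (intro exI[of _ "s - p"] conjI)
      show "s - p \<in> J" using ps s by (simp add: J_def)
      show "Re (lam k) - m0 = real (s - p) * \<omega>" using s ps by (simp add: m0_def of_nat_diff algebra_simps)
      show "Lq k = poly Lpoly (z (s - p))" using s ps by (simp add: Lq_poly z_def)
      show "cmod (exp (lam k * lq)) = 1" using s lq by (simp add: norm_exp_eq_Re)
    qed
  qed
  obtain \<epsilon> where \<epsilon>: "0 < \<epsilon>" "\<And>K. (\<Sum>k\<in>{N..<K}. majorant (\<lambda>_. 1) \<Omega> m0 \<epsilon> k) \<le> 1"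
  proof (rule majorant_bounded[OF m0 N sw, of N "\<lambda>_. 1" C])
    show "cmod (exp (of_nat j * lam k * lq)) \<le> 1" if "N \<le> k" "c k \<noteq> 0" for j k
      unfolding exp_of_nat norm_power using index[OF that] by auto
    fix k and s :: real assume k: "N \<le> k" "c k \<noteq> 0" and s: "0 \<le> s" "s < Re (lam k) - m0"
    obtain k' where k': "k' \<in> J" "Re (lam k) - m0 = real k' * \<omega>" "Lq k = poly Lpoly (z k')"
      using index[OF k] by blast
    have "s / \<omega> < real k'" using s k' \<omega> by (simp add: divide_less_eq)
    hence "nat \<lfloor>s / \<omega>\<rfloor> < k'" using s \<omega> by (simp add: nat_less_iff floor_less_iff)
    from W(6)[OF k'(1) this] show "1 * \<Omega> s \<le> C * cmod (Lq k) * \<Omega> (Re (lam k) - m0)"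
      using \<omega> unfolding k'(2,3) \<Omega>_def by simp
  qed (use W(1) in auto)
  show ?thesis
  proof (rule summable_if_majorant_bounded[OF N, of N "\<lambda>_. 1" "b powr (1 / \<omega>)" \<Omega>, OF _ _ _ _ _ \<epsilon>])
    show "\<Omega> t \<le> (b powr (1 / \<omega>)) powr t" if "0 \<le> t" for t
    proof -
      have "\<Omega> t \<le> b ^ nat \<lfloor>t / \<omega>\<rfloor>" unfolding \<Omega>_def by (rule W)
      also have "\<dots> = b powr real (nat \<lfloor>t / \<omega>\<rfloor>)" using W(2) by (simp add: powr_realpow)
      also have "\<dots> \<le> b powr (t / \<omega>)"
        using W(2) that \<omega> by (intro powr_mono) (auto simp: of_nat_nat)
      finally show ?thesis by (simp add: powr_powr)
    qed
  qed (use W(2,3) in \<open>auto simp: \<Omega>_def\<close>)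
qed

end

section \<open>Exponents on a ray\<close>

lemma Rats_imp_Reals: "z \<in> \<rat> \<Longrightarrow> z \<in> \<real>" for z :: complex
  by (auto elim!: Rats_cases' intro!: Reals_divide Reals_of_int)

text \<open>A rational ratio l / l0 is an integer relation between the generators. By independence
  the coordinate vectors of l and l0 are proportional, so l is determined by its coordinate at
  \<open>i0\<close>.\<close>

lemma rational_ray:
  assumes ind: "Z_independent \<tau> \<rho>"
    and l0: "l0 = (\<Sum>i<\<tau>. of_nat (mv i) * \<rho> i)" "l0 \<in> \<rat>" "l0 \<noteq> 0" and i0: "i0 < \<tau>"
    and l: "l \<in> add_semigroup \<tau> \<rho>" "l \<in> \<rat>"
  obtains m :: "nat \<Rightarrow> nat" where "l = (\<Sum>i<\<tau>. of_nat (m i) * \<rho> i)"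
    "\<And>i. i < \<tau> \<Longrightarrow> m i * mv i0 = m i0 * mv i" "l * of_nat (mv i0) = of_nat (m i0) * l0"
proof -
  obtain m :: "nat \<Rightarrow> nat" where m: "l = (\<Sum>i<\<tau>. of_nat (m i) * \<rho> i)"
    using l by (auto simp: add_semigroup_def)
  have "l / l0 \<in> \<rat>" using l l0 by (intro Rats_divide) auto
  then obtain a b :: int where ab: "b > 0" "l / l0 = of_int a / of_int b"
    by (auto elim: Rats_cases')
  hence "of_int b * l = of_int a * l0" using l0(3) by (simp add: field_simps)
  hence "(\<Sum>i<\<tau>. of_int (b * int (m i) - a * int (mv i)) * \<rho> i) = 0"
    unfolding m l0(1) by (simp add: sum_distrib_left sum_subtractf algebra_simps)
  hence *: "b * int (m i) = a * int (mv i)" if "i < \<tau>" for i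
    using ind that unfolding Z_independent_def by fastforce
  have mm: "m i * mv i0 = m i0 * mv i" if i: "i < \<tau>" for i
  proof -
    have "b * (int (m i) * int (mv i0)) = (b * int (m i)) * int (mv i0)" by simp
    also have "\<dots> = (a * int (mv i0)) * int (mv i)" by (simp add: *[OF i])
    also have "\<dots> = b * (int (m i0) * int (mv i))" by (simp add: *[OF i0, symmetric])
    finally have "int (m i) * int (mv i0) = int (m i0) * int (mv i)" using ab(1) by simp
    thus ?thesis by (metis of_nat_eq_iff of_nat_mult)
  qed
  have "l * of_nat (mv i0) = (\<Sum>i<\<tau>. of_nat (m i * mv i0) * \<rho> i)"
    unfolding m sum_distrib_right by (intro sum.cong refl) simp
  also have "\<dots> = (\<Sum>i<\<tau>. of_nat (m i0 * mv i) * \<rho> i)" by (intro sum.cong refl) (simp only: mm lessThan_iff)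
  also have "\<dots> = of_nat (m i0) * l0" unfolding l0(1) sum_distrib_left by (intro sum.cong refl) simp
  finally show ?thesis using that m mm by blast
qed

text \<open>For a = q^l the lower bound would have to hold at the exponent l itself, where |q^l - a|
  is 0.\<close>

lemma diophantine_nonresonant:
  assumes "diophantine \<tau> \<rho> lq (exp (l * lq))" "l \<in> add_semigroup \<tau> \<rho>" "l \<noteq> 0"
  shows False
proof -
  obtain m :: "nat \<Rightarrow> nat" where m: "l = (\<Sum>i<\<tau>. of_nat (m i) * \<rho> i)"
    using assms by (auto simp: add_semigroup_def)
  have "\<exists>i<\<tau>. m i \<noteq> 0"
  proof (rule ccontr)
    assume "\<not> (\<exists>i<\<tau>. m i \<noteq> 0)"
    hence "(\<Sum>i<\<tau>. of_nat (m i) * \<rho> i) = 0" by (intro sum.neutral) auto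
    thus False using assms(3) m by simp
  qed
  then obtain i where i: "i < \<tau>" "m i \<noteq> 0" by blast
  obtain c \<gamma> where c: "c > 0" "\<And>m. \<exists>i<\<tau>. m i \<noteq> 0 \<Longrightarrow>
    c * real (\<Sum>i<\<tau>. m i) powr (- \<gamma>) \<le> cmod (exp ((\<Sum>i<\<tau>. of_nat (m i) * \<rho> i) * lq) - exp (l * lq))"
    using diophantine_bound[OF assms(1) exp_not_eq_zero] by blast
  have "m i \<le> (\<Sum>i<\<tau>. m i)" using i by (intro member_le_sum) auto
  hence "0 < real (\<Sum>i<\<tau>. m i)" using i by linarith
  hence "0 < c * real (\<Sum>i<\<tau>. m i) powr (- \<gamma>)" using c(1) by simp
  moreover have "c * real (\<Sum>i<\<tau>. m i) powr (- \<gamma>) \<le> 0" using c(2)[of m] i unfolding m[symmetric] by auto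
  ultimately show False by simp
qed

context q_equation
begin

text \<open>All exponents are proportional to \<open>lam k0\<close>. With \<omega> = lam k0 / M each
  of them is s \<omega>, where s is its coordinate at \<open>i0\<close>, which reduces the claim to
  the one-dimensional problem.\<close>

lemma summable_rational_circle:
  assumes ind: "Z_independent \<tau> \<rho>"
    and \<Gamma>: "\<And>k. c k \<noteq> 0 \<Longrightarrow> lam k \<in> add_semigroup \<tau> \<rho>" and rat: "\<And>k. c k \<noteq> 0 \<Longrightarrow> lam k \<in> \<rat>"
    and lq: "Re lq = 0" and dio1: "diophantine \<tau> \<rho> lq 1"
    and dio: "\<And>a. poly Lpoly a = 0 \<Longrightarrow> cmod a = 1 \<Longrightarrow> diophantine \<tau> \<rho> lq a"
    and k0: "c k0 \<noteq> 0"
  shows abs_convergent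
proof -
  obtain mv :: "nat \<Rightarrow> nat" where mv: "lam k0 = (\<Sum>i<\<tau>. of_nat (mv i) * \<rho> i)"
    using \<Gamma>[OF k0] by (auto simp: add_semigroup_def)
  have l0: "lam k0 \<noteq> 0" using Re_lam_pos[of k0] by auto
  have "\<exists>i<\<tau>. mv i \<noteq> 0"
  proof (rule ccontr)
    assume "\<not> (\<exists>i<\<tau>. mv i \<noteq> 0)"
    hence "(\<Sum>i<\<tau>. of_nat (mv i) * \<rho> i) = 0" by (intro sum.neutral) auto
    thus False using l0 mv by simp
  qed
  then obtain i0 where i0: "i0 < \<tau>" "mv i0 \<noteq> 0" by blast
  define M where "M = mv i0"
  have M: "0 < M" using i0 by (simp add: M_def)
  have real: "lam k = of_real (Re (lam k))" if "c k \<noteq> 0" for k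
    using Rats_imp_Reals[OF rat[OF that]] by (auto simp: complex_eq_iff complex_is_Real_iff)
  define \<omega> where "\<omega> = Re (lam k0) / real M"
  have \<omega>: "0 < \<omega>" using M Re_lam_pos[of k0] by (simp add: \<omega>_def)
  have l0\<omega>: "lam k0 = of_nat M * of_real \<omega>"
    by (subst real[OF k0]) (use M in \<open>simp add: \<omega>_def\<close>)
  define S where "S = (\<Sum>i<\<tau>. mv i)"
  have "mv i0 \<le> S" unfolding S_def using i0 by (intro member_le_sum) auto
  hence S: "0 < S" using i0 by simp
  \<comment> \<open>The indices s for which s \<omega> lies in the semigroup with coordinates
    proportional to those of \<open>lam k0\<close>; for these the condition at the roots of L can be
    applied directly.\<close>
  define I where "I = {s. \<exists>m. (\<Sum>i<\<tau>. of_nat (m i) * \<rho> i) = of_nat s * of_real \<omega> \<and> (\<forall>i<\<tau>. m i * M = s * mv i)}"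
  obtain c' \<gamma> where c': "c' > 0" "\<gamma> > 0" "\<And>m. \<exists>i<\<tau>. m i \<noteq> 0 \<Longrightarrow>
      c' * real (\<Sum>i<\<tau>. m i) powr (- \<gamma>) \<le> cmod (exp ((\<Sum>i<\<tau>. of_nat (m i) * \<rho> i) * lq) - 1)"
    using diophantine_bound[OF dio1 one_neq_zero] by blast
  show ?thesis
  proof (rule summable_circle[OF \<omega> _ lq, where I = I])
    fix k assume k: "c k \<noteq> 0"
    from rational_ray[OF ind mv rat[OF k0] l0 i0(1) \<Gamma>[OF k] rat[OF k]]
    obtain m :: "nat \<Rightarrow> nat" where m: "lam k = (\<Sum>i<\<tau>. of_nat (m i) * \<rho> i)"
      "\<And>i. i < \<tau> \<Longrightarrow> m i * M = m i0 * mv i" "lam k * of_nat M = of_nat (m i0) * lam k0"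
      unfolding M_def by blast
    have "lam k = of_nat (m i0) * of_real \<omega>" using m(3) M unfolding l0\<omega> by (simp add: field_simps)
    moreover from this have "m i0 \<in> I" unfolding I_def using m(1,2) by auto
    ultimately show "lam k \<in> (\<lambda>s. of_nat s * complex_of_real \<omega>) ` I" by blast
  next
    show "0 < c' * real S powr (- \<gamma>) / real M" using c' S M by simp
    show "0 < \<gamma>" by fact
    fix d :: nat assume d: "0 < d"
    let ?w = "exp (of_nat d * of_real \<omega> * lq)"
    have "c' * real (\<Sum>i<\<tau>. d * mv i) powr (- \<gamma>) \<le> cmod (exp ((\<Sum>i<\<tau>. of_nat (d * mv i) * \<rho> i) * lq) - 1)"
      using i0 d by (intro c') auto
    also have "(\<Sum>i<\<tau>. of_nat (d * mv i) * \<rho> i) = of_nat d * lam k0"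
      unfolding mv sum_distrib_left by (intro sum.cong refl) simp
    also have "exp (of_nat d * lam k0 * lq) = ?w ^ M"
      unfolding l0\<omega> exp_of_nat_mult[symmetric] by (simp add: mult_ac)
    \<comment> \<open>\<omega> need not lie in the semigroup, but M \<omega> = \<open>lam k0\<close>
      does. The condition is therefore applied to w^M, and |w^M - 1| \<le> M |w - 1| on the unit
      circle.\<close>
    also have "cmod (?w ^ M - 1) \<le> real M * cmod (?w - 1)"
      using norm_power_diff[of ?w 1 M] lq by (simp add: norm_exp_eq_Re)
    finally have "c' * real (d * S) powr (- \<gamma>) \<le> real M * cmod (?w - 1)"
      unfolding S_def sum_distrib_left .
    thus "c' * real S powr (- \<gamma>) / real M * real d powr (- \<gamma>) \<le> cmod (?w - 1)"
      using M by (simp add: powr_mult field_simps)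
  next
    fix a assume a: "poly Lpoly a = 0" "cmod a = 1"
    hence "a \<noteq> 0" by auto
    from diophantine_bound[OF dio[OF a] this]
    obtain c2 \<gamma>2 where c2: "c2 > 0" "\<gamma>2 > 0" "\<And>m. \<exists>i<\<tau>. m i \<noteq> 0 \<Longrightarrow>
        c2 * real (\<Sum>i<\<tau>. m i) powr (- \<gamma>2) \<le> cmod (exp ((\<Sum>i<\<tau>. of_nat (m i) * \<rho> i) * lq) - a)"
      by blast
    have "c2 * real S powr (- \<gamma>2) * real s powr (- \<gamma>2) \<le> cmod (exp (of_nat s * of_real \<omega> * lq) - a)"
      if s: "s \<in> I" "0 < s" for s
    proof -
      obtain m where m: "(\<Sum>i<\<tau>. of_nat (m i) * \<rho> i) = of_nat s * of_real \<omega>"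
        "\<And>i. i < \<tau> \<Longrightarrow> m i * M = s * mv i" using s by (auto simp: I_def)
      have mi0: "m i0 \<noteq> 0" using m(2)[OF i0(1)] s i0 by (metis mult_eq_0_iff neq0_conv)
      have "m i0 \<le> (\<Sum>i<\<tau>. m i)" using i0 by (intro member_le_sum) auto
      hence pos: "0 < (\<Sum>i<\<tau>. m i)" using mi0 by simp
      \<comment> \<open>By proportionality the total degree of s \<omega> is at most s S, so the
        bound in the degree becomes one in s.\<close>
      have "(\<Sum>i<\<tau>. m i) * 1 \<le> (\<Sum>i<\<tau>. m i) * M" using M by (intro mult_left_mono) auto
      also have "\<dots> = s * S" unfolding S_def sum_distrib_left sum_distrib_right by (intro sum.cong refl) (simp add: m)
      finally have "real (\<Sum>i<\<tau>. m i) \<le> real (s * S)" by (simp only: of_nat_le_iff mult_1_right)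
      hence "real (s * S) powr (- \<gamma>2) \<le> real (\<Sum>i<\<tau>. m i) powr (- \<gamma>2)"
        using pos c2(2) by (intro powr_mono2') (auto simp del: of_nat_sum)
      hence "c2 * (real s powr (- \<gamma>2) * real S powr (- \<gamma>2)) \<le> c2 * real (\<Sum>i<\<tau>. m i) powr (- \<gamma>2)"
        using c2(1) unfolding of_nat_mult powr_mult by (intro mult_left_mono) auto
      also have "\<dots> \<le> cmod (exp ((\<Sum>i<\<tau>. of_nat (m i) * \<rho> i) * lq) - a)" using i0 mi0 by (intro c2) auto
      finally show ?thesis unfolding m(1) by (simp add: mult_ac)
    qed
    moreover have "0 < c2 * real S powr (- \<gamma>2)" using c2 S by simp
    ultimately show "\<exists>c2>0. \<exists>\<gamma>2>0. \<forall>s\<in>I. 0 < s \<longrightarrow>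
      c2 * real s powr (- \<gamma>2) \<le> cmod (exp (of_nat s * of_real \<omega> * lq) - a)"
      using c2(2) by blast
  qed
qed

text \<open>Under the nonresonance part of the diophantine condition all exponents are rational, so
  \<open>\<bar>q\<^sup>\<lambda>\<bar>\<close> is governed by the sign of \<open>Re lq\<close> alone.\<close>

lemma summable_mixed:
  assumes ind: "Z_independent \<tau> \<rho>"
    and \<Gamma>: "\<And>k. c k \<noteq> 0 \<Longrightarrow> lam k \<in> add_semigroup \<tau> \<rho>"
    and dio1: "diophantine \<tau> \<rho> lq 1"
    and dio: "\<And>a. poly Lpoly a = 0 \<Longrightarrow> P a \<Longrightarrow> diophantine \<tau> \<rho> lq a"
    and P1: "\<And>a. cmod a = 1 \<Longrightarrow> P a" and P: "\<And>k. c k \<noteq> 0 \<Longrightarrow> P (exp (lam k * lq))"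
    and neg: "\<And>k. c k \<noteq> 0 \<Longrightarrow> Re (lam k * lq) < 0 \<Longrightarrow> A 0 \<noteq> 0"
    and pos: "\<And>k. c k \<noteq> 0 \<Longrightarrow> 0 < Re (lam k * lq) \<Longrightarrow> A n \<noteq> 0"
  shows abs_convergent
proof (cases "\<exists>k. c k \<noteq> 0")
  case False
  thus ?thesis by (intro exI[of _ 1]) simp
next
  case True
  then obtain k0 where k0: "c k0 \<noteq> 0" by blast
  have rat: "lam k \<in> \<rat>" if "c k \<noteq> 0" for k
  proof (rule exponents_rational[OF _ that])
    fix k assume k: "c k \<noteq> 0"
    \<comment> \<open>A vanishing divisor would make q^\<lambda> a root of L at which the condition
      is assumed, and that contradicts nonresonance at \<lambda>.\<close>
    show "Lq k \<noteq> 0"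
    proof
      assume "Lq k = 0"
      hence "diophantine \<tau> \<rho> lq (exp (lam k * lq))" using P[OF k] by (intro dio) (simp_all add: Lq_poly)
      moreover have "lam k \<noteq> 0" using Re_lam_pos[of k] by auto
      ultimately show False using diophantine_nonresonant \<Gamma>[OF k] by blast
    qed
  qed
  have Re: "Re (lam k * lq) = Re lq * Re (lam k)" if "c k \<noteq> 0" for k
  proof -
    have "lam k \<in> \<real>" using rat[OF that] by (rule Rats_imp_Reals)
    thus ?thesis by (simp add: complex_is_Real_iff)
  qed
  consider "Re lq < 0" | "Re lq = 0" | "0 < Re lq" by linarith
  thus ?thesis
  proof cases
    case 1
    show ?thesis
    proof (rule summable_inside[where \<gamma> = "- Re lq"])
      have "Re (lam k0 * lq) < 0" unfolding Re[OF k0] using 1 Re_lam_pos[of k0] by (rule mult_neg_pos)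
      thus "A 0 \<noteq> 0" by (rule neg[OF k0])
      show "Re (lam k * lq) \<le> - (- Re lq) * Re (lam k)" if "c k \<noteq> 0" for k
        by (simp only: Re[OF that] minus_minus order_refl)
    qed (use 1 in simp)
  next
    case 2
    show ?thesis by (rule summable_rational_circle[OF ind \<Gamma> rat 2 dio1 _ k0]) (auto intro: dio P1)
  next
    case 3
    show ?thesis
    proof (rule summable_outside[where \<gamma> = "Re lq"])
      have "0 < Re (lam k0 * lq)" unfolding Re[OF k0] using 3 Re_lam_pos[of k0] by (rule mult_pos_pos)
      thus "A n \<noteq> 0" by (rule pos[OF k0])
      show "Re lq * Re (lam k) \<le> Re (lam k * lq)" if "c k \<noteq> 0" for k
        by (simp only: Re[OF that] order_refl)
    qed (rule 3)
  qed
qed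

end

section \<open>The five cases\<close>

theorem theorem6:
  fixes n \<tau> :: nat
    and F :: "complex ^ 'v::finite \<Rightarrow> complex"
    and coord :: "nat \<Rightarrow> 'v"
    and q lq \<nu> :: complex
    and c lam A \<rho> :: "nat \<Rightarrow> complex"
    and L :: "complex poly"
  assumes "n \<ge> 1"
    and "bij_betw coord {..<n + 2} UNIV"
    and "holomorphic_near_0 F"
    and "q \<noteq> 0" and "q \<noteq> 1" and "exp lq = q"
    and "gps_exponents lam"
    and "q_subst n coord lq F (gps_of c lam) = (\<lambda>l. 0)"
    and "\<forall>j\<le>n. \<exists>h\<in>gps_little_o \<nu>.
           q_subst n coord lq (cpartial (coord (Suc j)) F) (gps_of c lam)
             = (\<lambda>l. gps_monom (A j) \<nu> l + h l)"
    and "\<exists>j\<le>n. A j \<noteq> 0"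
    and "\<forall>i<\<tau>. Re (\<rho> i) > 0"
    and "Z_independent \<tau> \<rho>"
    and "gps_of c lam \<in> gps_over (add_semigroup \<tau> \<rho>)"
    and "L = (\<Sum>j\<le>n. monom (A j) j)"
  shows "
    (A 0 \<noteq> 0 \<and> (\<forall>i<\<tau>. cmod (exp (\<rho> i * lq)) < 1)
      \<longrightarrow> converges_in_sectors c lam) \<and>
    (A n \<noteq> 0 \<and> (\<forall>i<\<tau>. cmod (exp (\<rho> i * lq)) > 1)
      \<longrightarrow> converges_in_sectors c lam) \<and>
    ((\<forall>i<\<tau>. cmod (exp (\<rho> i * lq)) = 1) \<and>
     (\<forall>a. poly ([:- 1, 1:] * L) a = 0 \<and> cmod a = 1 \<longrightarrow> diophantine \<tau> \<rho> lq a)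
      \<longrightarrow> converges_in_sectors c lam) \<and>
    (A 0 \<noteq> 0 \<and> (\<forall>i<\<tau>. cmod (exp (\<rho> i * lq)) \<le> 1) \<and>
     (\<forall>a. poly ([:- 1, 1:] * L) a = 0 \<and> cmod a \<le> 1 \<longrightarrow> diophantine \<tau> \<rho> lq a)
      \<longrightarrow> converges_in_sectors c lam) \<and>
    (A n \<noteq> 0 \<and> (\<forall>i<\<tau>. cmod (exp (\<rho> i * lq)) \<ge> 1) \<and>
     (\<forall>a. poly ([:- 1, 1:] * L) a = 0 \<and> cmod a \<ge> 1 \<longrightarrow> diophantine \<tau> \<rho> lq a)
      \<longrightarrow> converges_in_sectors c lam)"
proof -
  interpret q_equation n coord F lq \<nu> c lam A
    by unfold_locales (fact assms)+
  have L: "L = Lpoly" using assms(14) by (simp add: Lpoly_def)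
  note \<rho> = assms(11) and ind = assms(12)
  have \<Gamma>: "lam k \<in> add_semigroup \<tau> \<rho>" if "c k \<noteq> 0" for k
    using assms(13) that gps_of_lam[OF inj_lam, of c k] unfolding gps_over_def by auto
  obtain \<kappa> where \<kappa>: "0 \<le> \<kappa>" "\<And>l. l \<in> add_semigroup \<tau> \<rho> \<Longrightarrow> \<bar>Im l\<bar> \<le> \<kappa> * Re l"
    by (rule add_semigroup_Im_bound[OF \<rho>]) blast
  have conv: "converges_in_sectors c lam" if abs_convergent
    using that converges_in_sectors_if_summable[of lam \<kappa> c] Re_lam_pos \<kappa> \<Gamma> by blast
  have le: "Re (lam k * lq) \<le> 0" if "\<forall>i<\<tau>. cmod (exp (\<rho> i * lq)) \<le> 1" "c k \<noteq> 0" for k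
    using add_semigroup_Re_le[OF _ \<Gamma>[OF that(2)], of lq 0] that(1) by (simp add: norm_exp_eq_Re)
  have ge: "0 \<le> Re (lam k * lq)" if "\<forall>i<\<tau>. cmod (exp (\<rho> i * lq)) \<ge> 1" "c k \<noteq> 0" for k
    using add_semigroup_Re_le[OF _ \<Gamma>[OF that(2)], of "- lq" 0] that(1) by (simp add: norm_exp_eq_Re)
  \<comment> \<open>Cases c, d and e at once: \<open>P\<close> describes the part of the plane in
    which the condition is assumed. A nonzero \<open>A 0\<close> is asked for if some |q^\<lambda>|
    is below 1, a nonzero \<open>A n\<close> if some is above 1; the sign of Re (\<lambda> ln q)
    settles which of these can happen.\<close>
  have mixed: "converges_in_sectors c lam"
    if "\<forall>a. poly ([:- 1, 1:] * L) a = 0 \<and> P a \<longrightarrow> diophantine \<tau> \<rho> lq a"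
      "\<And>a. cmod a = 1 \<Longrightarrow> P a" "\<And>k. c k \<noteq> 0 \<Longrightarrow> P (exp (lam k * lq))"
      "\<And>k. c k \<noteq> 0 \<Longrightarrow> Re (lam k * lq) < 0 \<Longrightarrow> A 0 \<noteq> 0"
      "\<And>k. c k \<noteq> 0 \<Longrightarrow> 0 < Re (lam k * lq) \<Longrightarrow> A n \<noteq> 0" for P
  proof (rule conv, rule summable_mixed[where P = P, OF ind \<Gamma> _ _ that(2-5)])
    show "diophantine \<tau> \<rho> lq 1" using that(1,2) by simp
    show "diophantine \<tau> \<rho> lq a" if "poly Lpoly a = 0" "P a" for a
      using \<open>\<forall>a. poly ([:- 1, 1:] * L) a = 0 \<and> P a \<longrightarrow> diophantine \<tau> \<rho> lq a\<close> that by (simp add: L)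
  qed
  show ?thesis
  proof (intro conjI impI)
    assume a: "A 0 \<noteq> 0 \<and> (\<forall>i<\<tau>. cmod (exp (\<rho> i * lq)) < 1)"
    hence "\<forall>i<\<tau>. Re (\<rho> i * lq) < 0" by (simp add: norm_exp_eq_Re)
    then obtain \<gamma> where "0 < \<gamma>" "\<And>l. l \<in> add_semigroup \<tau> \<rho> \<Longrightarrow> Re (l * lq) \<le> - \<gamma> * Re l"
      by (rule add_semigroup_strict[OF \<rho>]) blast
    with a show "converges_in_sectors c lam" by (intro conv summable_inside \<Gamma>) (auto intro: \<Gamma>)
  next
    assume a: "A n \<noteq> 0 \<and> (\<forall>i<\<tau>. cmod (exp (\<rho> i * lq)) > 1)"
    hence "\<forall>i<\<tau>. Re (\<rho> i * - lq) < 0" by (simp add: norm_exp_eq_Re)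
    then obtain \<gamma> where \<gamma>: "0 < \<gamma>" "\<And>l. l \<in> add_semigroup \<tau> \<rho> \<Longrightarrow> Re (l * - lq) \<le> - \<gamma> * Re l"
      by (rule add_semigroup_strict[OF \<rho>]) blast
    have "\<gamma> * Re (lam k) \<le> Re (lam k * lq)" if "c k \<noteq> 0" for k using \<gamma>(2)[OF \<Gamma>[OF that]] by simp
    with a \<gamma>(1) show "converges_in_sectors c lam" by (intro conv summable_outside) auto
  next
    assume a: "(\<forall>i<\<tau>. cmod (exp (\<rho> i * lq)) = 1) \<and>
     (\<forall>a. poly ([:- 1, 1:] * L) a = 0 \<and> cmod a = 1 \<longrightarrow> diophantine \<tau> \<rho> lq a)"
    hence 0: "Re (lam k * lq) = 0" if "c k \<noteq> 0" for k using le[OF _ that] ge[OF _ that] by simp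
    show "converges_in_sectors c lam"
    proof (rule mixed[of "\<lambda>a. cmod a = 1"])
      show "cmod (exp (lam k * lq)) = 1" if "c k \<noteq> 0" for k using 0[OF that] by (simp only: norm_exp_eq_Re exp_zero)
    qed (use a 0 in auto)
  next
    assume a: "A 0 \<noteq> 0 \<and> (\<forall>i<\<tau>. cmod (exp (\<rho> i * lq)) \<le> 1) \<and>
     (\<forall>a. poly ([:- 1, 1:] * L) a = 0 \<and> cmod a \<le> 1 \<longrightarrow> diophantine \<tau> \<rho> lq a)"
    hence 0: "Re (lam k * lq) \<le> 0" if "c k \<noteq> 0" for k using le[OF _ that] by simp
    show "converges_in_sectors c lam"
    proof (rule mixed[of "\<lambda>a. cmod a \<le> 1"])
      show "cmod (exp (lam k * lq)) \<le> 1" if "c k \<noteq> 0" for k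
        using 0[OF that] by (simp only: norm_exp_eq_Re exp_le_one_iff)
      show "A n \<noteq> 0" if "c k \<noteq> 0" "0 < Re (lam k * lq)" for k using 0[OF that(1)] that(2) by linarith
    qed (use a in auto)
  next
    assume a: "A n \<noteq> 0 \<and> (\<forall>i<\<tau>. cmod (exp (\<rho> i * lq)) \<ge> 1) \<and>
     (\<forall>a. poly ([:- 1, 1:] * L) a = 0 \<and> cmod a \<ge> 1 \<longrightarrow> diophantine \<tau> \<rho> lq a)"
    hence 0: "0 \<le> Re (lam k * lq)" if "c k \<noteq> 0" for k using ge[OF _ that] by simp
    show "converges_in_sectors c lam"
    proof (rule mixed[of "\<lambda>a. cmod a \<ge> 1"])
      show "cmod (exp (lam k * lq)) \<ge> 1" if "c k \<noteq> 0" for k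
        using 0[OF that] by (simp only: norm_exp_eq_Re one_le_exp_iff)
      show "A 0 \<noteq> 0" if "c k \<noteq> 0" "Re (lam k * lq) < 0" for k using 0[OF that(1)] that(2) by linarith
    qed (use a in auto)
  qed
qed

end
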